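(* Let $n\ge 2$. For $s,t\in\{2,3,\ldots,n\}$ and $i\in\{1,2,\ldots,n\}$, $$ \overline{\overline{\underline{A_{n,s,i,t}}}} = |\overline{A}|_{n,s+1,i,t} + |\overline{A}|_{n,s+1,i,t+1} + |\overline{A}|_{n,s,i+1,t} - |\overline{A}|_{n,s+1,i+1,t} - |\overline{A}|_{n,s,i,t+1} - |\overline{A}|_{n,s+1,i-1,t+1}, $$ where by convention $|\overline{A}|_{n,n+1,i,t} = |\overline{A}|_{n,s,i,n+1} = |\overline{A}|_{n,s,0,t} = |\overline{A}|_{n,s,n+1,t}=0$.
   Context: An $n\times n$ alternating sign matrix is a square matrix with entries in $\{1,-1,0\}$ such that in every row and every column the entries sum to $1$ and the non-zero entries alternate in sign. For $s,i,t\in\{1,\ldots,n\}$, $|\overline{A}|_{n,s,i,t}$ denotes the number of $n\times n$ alternating sign matrices having a $1$ in position $(s,1)$, a $1$ in position $(1,i)$ and a $1$ in position $(t,n)$ (row index first). Let $E_x$ denote the shift operator $E_x p(x)=p(x+1)$ and $\mathrm{id}$ the identity operator. For integers $k_1,\ldots,k_n$ define $$\alpha(n;k_1,\ldots,k_n)=\prod_{1\le p<q\le n}(\mathrm{id}-E_{k_p}+E_{k_p}E_{k_q})\prod_{1\le i<j\le n}\frac{k_j-k_i}{j-i},$$ a polynomial in $k_1,\ldots,k_n$ of degree at most $n-1$ in each variable (for strictly increasing $k_1<\dots<k_n$ it equals the number of monotone triangles with bottom row $(k_1,\ldots,k_n)$). The numbers $\overline{\overline{\underline{A_{n,s,i,t}}}}$,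 $s,i,t\in\{1,\ldots,n\}$, are defined as the unique coefficients in the polynomial expansion $$\alpha(n;k_1,2,3,\ldots,n-2,k_{n-1},k_n)=\sum_{s=1}^n\sum_{i=1}^n\sum_{t=1}^n \overline{\overline{\underline{A_{n,s,i,t}}}}\,(-1)^{s+1}\binom{k_1-2}{s-1}\binom{k_{n-1}-n+i}{i-1}\binom{k_n-n+t}{t-1},$$ where $\binom{x}{m}=x(x-1)\cdots(x-m+1)/m!$ as a polynomial in $x$. (For $i<t$ these numbers count $n\times n$ alternating sign matrices with respect to prescribed two top rows and bottom row; the identity is asserted for all $s,i,t$ in the stated ranges, including $i\ge t$.) *)

theory Defs
  imports Complex_Main
begin

definition alternating_line :: "nat \<Rightarrow> (nat \<Rightarrow> int) \<Rightarrow> bool" where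
  "alternating_line n v \<longleftrightarrow>
     (\<forall>j1 j2. 1 \<le> j1 \<and> j1 < j2 \<and> j2 \<le> n \<and> v j1 \<noteq> 0 \<and> v j2 \<noteq> 0
        \<and> (\<forall>j. j1 < j \<and> j < j2 \<longrightarrow> v j = 0) \<longrightarrow> v j2 = - v j1)"

definition is_asm :: "nat \<Rightarrow> (nat \<Rightarrow> nat \<Rightarrow> int) \<Rightarrow> bool" where
  "is_asm n A \<longleftrightarrow>
     (\<forall>r c. A r c \<in> {-1, 0, 1}) \<and>
     (\<forall>r c. r \<notin> {1..n} \<or> c \<notin> {1..n} \<longrightarrow> A r c = 0) \<and>
     (\<forall>r\<in>{1..n}. (\<Sum>c=1..n. A r c) = 1) \<and>
     (\<forall>c\<in>{1..n}. (\<Sum>r=1..n. A r c) = 1) \<and>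
     (\<forall>r\<in>{1..n}. alternating_line n (\<lambda>c. A r c)) \<and>
     (\<forall>c\<in>{1..n}. alternating_line n (\<lambda>r. A r c))"

text \<open>|A-bar|_{n,s,i,t}: number of n x n ASMs with a 1 at (s,1), (1,i) and (t,n).
  Out-of-range indices automatically give 0.\<close>
definition asm_count :: "nat \<Rightarrow> nat \<Rightarrow> nat \<Rightarrow> nat \<Rightarrow> nat" where
  "asm_count n s i t = card {A. is_asm n A \<and> A s 1 = 1 \<and> A 1 i = 1 \<and> A t n = 1}"

text \<open>The operator id - E_p + E_p E_q acting on functions of (k_1,...,k_n).\<close>
definition op_pq :: "nat \<Rightarrow> nat \<Rightarrow> ((nat \<Rightarrow> int) \<Rightarrow> real) \<Rightarrow> (nat \<Rightarrow> int) \<Rightarrow> real" where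
  "op_pq p q f k = f k - f (k(p := k p + 1)) + f (k(p := k p + 1, q := k q + 1))"

definition vandermonde_quot :: "nat \<Rightarrow> (nat \<Rightarrow> int) \<Rightarrow> real" where
  "vandermonde_quot n k =
     (\<Prod>i\<in>{1..n}. \<Prod>j\<in>{i<..n}. of_int (k j - k i) / of_int (int j - int i))"

definition alpha :: "nat \<Rightarrow> (nat \<Rightarrow> int) \<Rightarrow> real" where
  "alpha n = foldr (\<lambda>(p, q) g. op_pq p q g)
               [(p, q). p \<leftarrow> [1..<n+1], q \<leftarrow> [p+1..<n+1]] (vandermonde_quot n)"

definition special_args :: "nat \<Rightarrow> int \<Rightarrow> int \<Rightarrow> int \<Rightarrow> nat \<Rightarrow> int" where
  "special_args n k1 kn1 kn = (\<lambda>j. int j)(1 := k1, n - 1 := kn1, n := kn)"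

definition expansion_basis :: "nat \<Rightarrow> nat \<Rightarrow> nat \<Rightarrow> nat \<Rightarrow> int \<Rightarrow> int \<Rightarrow> int \<Rightarrow> real" where
  "expansion_basis n s i t k1 kn1 kn =
     (-1) ^ (s + 1) * ((of_int k1 - 2) gchoose (s - 1))
       * ((of_int kn1 - of_nat n + of_nat i) gchoose (i - 1))
       * ((of_int kn - of_nat n + of_nat t) gchoose (t - 1))"

definition Abb :: "nat \<Rightarrow> nat \<Rightarrow> nat \<Rightarrow> nat \<Rightarrow> real" where
  "Abb n = (THE c. (\<forall>s i t. c s i t \<noteq> 0 \<longrightarrow> s \<in> {1..n} \<and> i \<in> {1..n} \<and> t \<in> {1..n}) \<and>
     (\<forall>k1 kn1 kn. alpha n (special_args n k1 kn1 kn) =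
        (\<Sum>s=1..n. \<Sum>i=1..n. \<Sum>t=1..n. c s i t * expansion_basis n s i t k1 kn1 kn)))"

end

(* Idea. On lists of integers, write alpha as wop applied to the Vandermonde product.
   Expanding the Vandermonde determinant along its column of ones turns alpha into an
   alternating sum over deleted arguments in which the arguments behind the deleted one are
   shifted. Since alpha satisfies A(l, l+1) = A(l, l) + A(l+1, l+1) in adjacent arguments, this
   sum telescopes to the summation over strictly interlacing sequences, so alpha counts monotone
   triangles. The same formula, differenced in k_1 and k_n, expresses the left-hand side by
   alpha(n-1; k_1, l, k_n) summed over l interlacing (2, ..., n-2, k_(n-1)).
   Symmetric polynomials in the shift operators act on alpha as on constants; applied to the
   generating function in k_(n-1), this rewrites the interlacing sum through the values Q_i of
   alpha(n-1) at (k_1, 2, ..., n-1, k_n) with i omitted: up to a change of variables it is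
   (1 - E_x E_y^-1)(1 - E_z E_y^-1) applied to the sum of beta_i(y) Q_i(x, z). The coefficients of
   Q_i count the matrices with prescribed first row, first column and last column, and
   expanding the operator yields the six terms. *)
theory Submission
  imports Defs "HOL-Computational_Algebra.Formal_Power_Series"
begin

text \<open>The obstacle is that \<open>alpha\<close> counts monotone triangles only for increasing
  arguments, whereas the expansion defining \<open>Abb\<close> involves k_(n-1) and k_n in either
  order. The mixed difference in the two outermost arguments avoids this: it needs only the
  arguments in between to be increasing, and once the interlacing sum is rewritten, all remaining
  values of alpha(n-1) are taken at increasing arguments and are genuine counts. Both sides are then
  compared as polynomials on a half line, which determines every coefficient. The rewriting needs
  two further facts. First, alpha vanishes when three consecutive arguments coincide; this follows
  from the relation for adjacent arguments because a polynomial with g(x+1) = -g(x) is zero.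
  Secondly, all symmetric polynomials in the shifts are packed into the single product of the
  operators id - X E, so that their joint action becomes multiplication by a power of 1 - X, which
  can be cancelled among power series.\<close>

unbundle fps_syntax

section \<open>The operators on functions of integer lists\<close>

text \<open>\<open>wop\<close> is the product of the operators \<open>id - E_p + E_p E_q\<close> over all \<open>p < q\<close>;
  \<open>wop_head\<close> is the part with \<open>p = 1\<close>.\<close>

fun wop_head :: "(int \<Rightarrow> int list \<Rightarrow> 'a::comm_ring_1) \<Rightarrow> int \<Rightarrow> int list \<Rightarrow> 'a" where
  "wop_head g x [] = g x []"
| "wop_head g x (y # ys) =
     wop_head (\<lambda>u us. g u (y # us)) x ys - wop_head (\<lambda>u us. g u (y # us)) (x + 1) ys
     + wop_head (\<lambda>u us. g u ((y + 1) # us)) (x + 1) ys"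

text \<open>Registered as a congruence rule because \<open>wop\<close> calls itself inside the
  function handed to \<open>wop_head\<close>: \<open>g\<close> is only evaluated on lists as long as
  \<open>xs'\<close>, and this is what makes \<open>wop\<close> terminate.\<close>

lemma wop_head_cong [fundef_cong]:
  "x = x' \<Longrightarrow> xs = xs' \<Longrightarrow> (\<And>u us. length us = length xs' \<Longrightarrow> g u us = g' u us) \<Longrightarrow>
    wop_head g x xs = wop_head g' x' xs'"
proof (induction xs' arbitrary: g g' x x' xs)
  case (Cons y ys)
  have "wop_head (\<lambda>u us. g u (v # us)) z ys = wop_head (\<lambda>u us. g' u (v # us)) z ys" for v z
    by (rule Cons.IH[OF refl refl]) (simp add: Cons.prems)
  then show ?case using Cons.prems by simp
qed simp

fun wop :: "(int list \<Rightarrow> 'a::comm_ring_1) \<Rightarrow> int list \<Rightarrow> 'a" where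
  "wop f [] = f []"
| "wop f (x # xs) = wop_head (\<lambda>u us. wop (\<lambda>l. f (u # l)) us) x xs"

lemma wop_Cons_eq:
  "(\<And>u us. length us = length xs \<Longrightarrow> wop (\<lambda>l. f (u # l)) us = G u us) \<Longrightarrow>
    wop f (x # xs) = wop_head G x xs"
  by (auto intro: wop_head_cong)

lemma wop_cong:
  "length xs = n \<Longrightarrow> (\<And>l. length l = n \<Longrightarrow> f l = f' l) \<Longrightarrow> wop f xs = wop f' xs"
proof (induction n arbitrary: f f' xs)
  case (Suc n)
  then obtain x ys where xs: "xs = x # ys" "length ys = n" by (cases xs) auto
  have "wop (\<lambda>l. f (u # l)) us = wop (\<lambda>l. f' (u # l)) us" if "length us = n" for u us
    by (rule Suc.IH) (use that Suc.prems in auto)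
  then show ?case unfolding xs by (intro wop_Cons_eq[THEN trans]) (auto simp: xs)
qed simp

lemma wop_head_add: "wop_head (\<lambda>u us. g u us + h u us) x xs = wop_head g x xs + wop_head h x xs"
  by (induction xs arbitrary: g h x) auto

lemma wop_head_diff: "wop_head (\<lambda>u us. g u us - h u us) x xs = wop_head g x xs - wop_head h x xs"
  by (induction xs arbitrary: g h x) auto

lemma wop_head_scale: "wop_head (\<lambda>u us. c * g u us) x xs = c * wop_head g x xs"
  by (induction xs arbitrary: g x) (auto simp: algebra_simps)

lemma wop_head_uminus: "wop_head (\<lambda>u us. - g u us) x xs = - wop_head g x xs"
  using wop_head_scale[of "-1" g x xs] by simp

lemma wop_head_shift: "wop_head (\<lambda>u. g (u + 1)) x xs = wop_head g (x + 1) xs"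
proof (induction xs arbitrary: g x)
  case (Cons y ys)
  show ?case
    using Cons.IH[of "\<lambda>u us. g u (y # us)" x] Cons.IH[of "\<lambda>u us. g u (y # us)" "x + 1"]
      Cons.IH[of "\<lambda>u us. g u ((y + 1) # us)" "x + 1"] by simp
qed simp

lemma wop_add: "wop (\<lambda>l. g l + h l) xs = wop g xs + wop h xs"
proof (induction "length xs" arbitrary: g h xs)
  case (Suc n)
  then obtain x ys where xs: "xs = x # ys" "length ys = n" by (cases xs) auto
  have "wop (\<lambda>l. g l + h l) xs
      = wop_head (\<lambda>u us. wop (\<lambda>l. g (u # l)) us + wop (\<lambda>l. h (u # l)) us) x ys"
    unfolding xs by (rule wop_Cons_eq) (simp add: Suc xs)
  then show ?case by (simp add: xs wop_head_add)
qed simp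

lemma wop_scale: "wop (\<lambda>l. c * g l) xs = c * wop g xs"
proof (induction "length xs" arbitrary: g xs)
  case (Suc n)
  then obtain x ys where xs: "xs = x # ys" "length ys = n" by (cases xs) auto
  have "wop (\<lambda>l. c * g l) xs = wop_head (\<lambda>u us. c * wop (\<lambda>l. g (u # l)) us) x ys"
    unfolding xs by (rule wop_Cons_eq) (simp add: Suc xs)
  then show ?case by (simp add: xs wop_head_scale)
qed simp

lemma wop_uminus: "wop (\<lambda>l. - g l) xs = - wop g xs"
  using wop_scale[of "-1" g xs] by simp

lemma wop_diff: "wop (\<lambda>l. g l - h l) xs = wop g xs - wop h xs"
  using wop_add[of g "\<lambda>l. - h l" xs] by (simp add: wop_uminus)

text \<open>Both sides are products of commuting shifts. This lets the first two positions of
  \<open>wop\<close> trade places when the swap relation is proved.\<close>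

lemma wop_head_commute:
  "wop_head (\<lambda>a. wop_head (\<lambda>b vs. g a b vs) b) a vs = wop_head (\<lambda>b. wop_head (\<lambda>a vs. g a b vs) a) b vs"
proof (induction vs arbitrary: g a b)
  case (Cons v vs)
  have IH: "wop_head (\<lambda>a. wop_head (\<lambda>b vs. g a b (w # vs)) b') a' vs
      = wop_head (\<lambda>b. wop_head (\<lambda>a vs. g a b (w # vs)) a') b' vs" for w a' b'
    by (rule Cons.IH)
  show ?case
    unfolding wop_head.simps wop_head_add wop_head_diff IH by (simp add: algebra_simps)
qed simp

section \<open>Alternating sums over deleted arguments\<close>

fun del_sum :: "(int list \<Rightarrow> 'a::comm_ring_1) \<Rightarrow> int list \<Rightarrow> 'a" where
  "del_sum h [] = 0"
| "del_sum h (x # xs) = h xs - del_sum (\<lambda>l. h (x # l)) xs"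

fun del_shift_sum :: "(int list \<Rightarrow> 'a::comm_ring_1) \<Rightarrow> int list \<Rightarrow> 'a" where
  "del_shift_sum h [] = 0"
| "del_shift_sum h (x # xs) = h (map (\<lambda>v. v + 1) xs) - del_shift_sum (\<lambda>l. h (x # l)) xs"

lemma del_shift_sum_add: "del_shift_sum (\<lambda>l. g l + h l) xs = del_shift_sum g xs + del_shift_sum h xs"
  by (induction xs arbitrary: g h) auto

lemma del_shift_sum_diff: "del_shift_sum (\<lambda>l. g l - h l) xs = del_shift_sum g xs - del_shift_sum h xs"
  by (induction xs arbitrary: g h) auto

text \<open>If nothing depends on the head, E_p acts trivially and each factor id - E_p + E_p E_q
  reduces to E_q. This is the origin of the shift of the arguments behind a deleted one.\<close>

lemma wop_head_const: "wop_head (\<lambda>_. g) x xs = g (map (\<lambda>v. v + 1) xs)"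
  by (induction xs arbitrary: g x) auto

lemma wop_head_shift_tail:
  "wop_head (\<lambda>u us. g u (map (\<lambda>v. v + 1) us)) x xs = wop_head g x (map (\<lambda>v. v + 1) xs)"
proof (induction xs arbitrary: g x)
  case (Cons y ys)
  have "wop_head (\<lambda>u us. g u (w # map (\<lambda>v. v + 1) us)) z ys
      = wop_head (\<lambda>u us. g u (w # us)) z (map (\<lambda>v. v + 1) ys)" for w z
    by (rule Cons.IH)
  then show ?case by simp
qed simp

text \<open>A function that ignores the tail entry q turns id - E_p + E_p E_q into the identity, so
  a deletion further back leaves no trace at the head.\<close>

lemma wop_head_del_shift_sum:
  "wop_head (\<lambda>u us. del_shift_sum (g u) us) x xs = del_shift_sum (wop_head g x) xs"
  by (induction xs arbitrary: g x)
    (simp_all add: wop_head_diff wop_head_shift_tail del_shift_sum_add del_shift_sum_diff)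

text \<open>In the summand without k_j, the factors with p = j become E_q and those with q = j
  become the identity; hence exactly the arguments behind k_j are shifted.\<close>

lemma wop_del_sum: "wop (del_sum h) k = del_shift_sum (wop h) k"
proof (induction "length k" arbitrary: h k)
  case (Suc n)
  then obtain x ys where k: "k = x # ys" "length ys = n" by (cases k) auto
  have "wop (del_sum h) k
      = wop_head (\<lambda>u us. wop h us - del_shift_sum (wop (\<lambda>l. h (u # l))) us) x ys"
    unfolding k by (rule wop_Cons_eq) (simp add: wop_diff Suc k)
  then show ?case
    by (simp add: k wop_head_diff wop_head_const wop_head_del_shift_sum)
qed simp

section \<open>Products of differences and of id - t E over all arguments\<close>

fun diff_all :: "(int list \<Rightarrow> 'a::comm_ring_1) \<Rightarrow> int list \<Rightarrow> 'a" where
  "diff_all h [] = h []"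
| "diff_all h (x # xs) = diff_all (\<lambda>l. h ((x + 1) # l)) xs - diff_all (\<lambda>l. h (x # l)) xs"

text \<open>The generating function in \<open>t\<close> of the elementary symmetric polynomials in
  the shifts, with alternating signs. The scalar \<open>t\<close> is later 1 or a formal
  variable.\<close>

fun prod_op :: "'a \<Rightarrow> (int list \<Rightarrow> 'a::comm_ring_1) \<Rightarrow> int list \<Rightarrow> 'a" where
  "prod_op t h [] = h []"
| "prod_op t h (x # xs) = prod_op t (\<lambda>l. h (x # l)) xs - t * prod_op t (\<lambda>l. h ((x + 1) # l)) xs"

lemma diff_all_prod_op: "diff_all h xs = (- 1) ^ length xs * prod_op 1 h xs"
  by (induction xs arbitrary: h) (auto simp: algebra_simps)

lemma prod_op_add: "prod_op t (\<lambda>l. g l + h l) xs = prod_op t g xs + prod_op t h xs"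
proof (induction xs arbitrary: g h)
  case (Cons x xs)
  show ?case
    unfolding prod_op.simps append_Cons Cons.IH by (simp add: algebra_simps)
qed simp

lemma prod_op_scale: "prod_op t (\<lambda>l. c * h l) xs = c * prod_op t h xs"
proof (induction xs arbitrary: h)
  case (Cons x xs)
  show ?case
    unfolding prod_op.simps append_Cons Cons.IH by (simp add: algebra_simps)
qed simp

lemma prod_op_diff: "prod_op t (\<lambda>l. g l - h l) xs = prod_op t g xs - prod_op t h xs"
  using prod_op_add[of t g "\<lambda>l. - h l" xs] prod_op_scale[of t "- 1" h xs] by simp

lemma prod_op_zero: "prod_op t (\<lambda>l. 0) xs = 0"
  by (induction xs) auto

lemma diff_all_diff: "diff_all (\<lambda>l. g l - h l) xs = diff_all g xs - diff_all h xs"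
  by (simp add: diff_all_prod_op prod_op_diff algebra_simps)

lemma prod_op_snoc:
  "prod_op t h (xs @ [z]) = prod_op t (\<lambda>l. h (l @ [z])) xs - t * prod_op t (\<lambda>l. h (l @ [z + 1])) xs"
proof (induction xs arbitrary: h)
  case (Cons x xs)
  show ?case
    unfolding prod_op.simps append_Cons Cons.IH by (simp add: algebra_simps)
qed simp

lemma diff_all_snoc:
  "diff_all h (xs @ [z]) = diff_all (\<lambda>l. h (l @ [z + 1])) xs - diff_all (\<lambda>l. h (l @ [z])) xs"
proof (induction xs arbitrary: h)
  case (Cons x xs)
  show ?case
    unfolding diff_all.simps append_Cons Cons.IH by (simp add: algebra_simps)
qed simp

lemma del_shift_sum_snoc:
  "del_shift_sum h (xs @ [z]) = del_shift_sum (\<lambda>l. h (l @ [z + 1])) xs + (- 1) ^ length xs * h xs"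
proof (induction xs arbitrary: h)
  case (Cons x xs)
  show ?case
    unfolding del_shift_sum.simps list.map map_append append_Cons Cons.IH by (simp add: algebra_simps)
qed simp

lemma wop_head_prod_op:
  "wop_head (\<lambda>u us. prod_op t (g u) us) x xs = prod_op t (wop_head g x) xs"
proof (induction xs arbitrary: g x)
  case (Cons y ys)
  show ?case
    unfolding prod_op.simps wop_head.simps wop_head_diff wop_head_scale prod_op_add prod_op_diff Cons.IH
    by (simp add: algebra_simps)
qed simp

lemma prod_op_wop: "prod_op t (wop h) k = wop (prod_op t h) k"
proof (induction "length k" arbitrary: h k)
  case (Suc n)
  then obtain x ys where k: "k = x # ys" "length ys = n" by (cases k) auto
  let ?w = "\<lambda>u. wop (\<lambda>l. h (u # l))"
  have "wop (prod_op t h) k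
      = wop_head (\<lambda>u us. prod_op t (?w u) us - t * prod_op t (?w (u + 1)) us) x ys"
    unfolding k by (rule wop_Cons_eq) (simp add: wop_diff wop_scale Suc k)
  moreover have "wop_head (\<lambda>u. ?w (u + 1)) x = wop_head ?w (x + 1)"
    by (rule ext) (rule wop_head_shift)
  ultimately show ?case
    by (simp add: k wop_head_diff wop_head_scale wop_head_prod_op)
qed simp

lemma diff_all_wop: "diff_all (wop h) k = wop (diff_all h) k"
proof -
  have "wop (diff_all h) k = wop (\<lambda>l. (- 1) ^ length k * prod_op 1 h l) k"
    by (rule wop_cong[OF refl]) (simp add: diff_all_prod_op)
  then show ?thesis by (simp add: diff_all_prod_op wop_scale prod_op_wop)
qed

section \<open>Determinants of functions evaluated at lists\<close>

text \<open>Laplace expansion along a first column with entries f x, where \<open>h\<close> supplies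
  the minors as a function of the remaining arguments. Thus \<open>ldet fs ks\<close> is the
  determinant of the matrix f_j(k_i). Keeping \<open>h\<close> arbitrary allows column manipulations
  without reference to the other columns.\<close>

fun col_exp :: "(int \<Rightarrow> 'a::comm_ring_1) \<Rightarrow> (int list \<Rightarrow> 'a) \<Rightarrow> int list \<Rightarrow> 'a" where
  "col_exp f h [] = 0"
| "col_exp f h (x # xs) = f x * h xs - col_exp f (\<lambda>l. h (x # l)) xs"

fun ldet :: "(int \<Rightarrow> 'a::comm_ring_1) list \<Rightarrow> int list \<Rightarrow> 'a" where
  "ldet [] ks = (if ks = [] then 1 else 0)"
| "ldet (f # fs) ks = col_exp f (ldet fs) ks"

lemma col_exp_add: "col_exp f (\<lambda>l. g l + h l) ks = col_exp f g ks + col_exp f h ks"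
proof (induction ks arbitrary: g h)
  case (Cons x xs)
  show ?case unfolding col_exp.simps Cons.IH by (simp add: algebra_simps)
qed simp

lemma col_exp_scale: "col_exp f (\<lambda>l. c * h l) ks = c * col_exp f h ks"
proof (induction ks arbitrary: h)
  case (Cons x xs)
  show ?case unfolding col_exp.simps Cons.IH by (simp add: algebra_simps)
qed simp

lemma col_exp_uminus: "col_exp f (\<lambda>l. - h l) ks = - col_exp f h ks"
  using col_exp_scale[of f "- 1" h ks] by simp

lemma col_exp_diff: "col_exp f (\<lambda>l. g l - h l) ks = col_exp f g ks - col_exp f h ks"
  using col_exp_add[of f g "\<lambda>l. - h l" ks] by (simp add: col_exp_uminus)

lemma col_exp_zero: "col_exp f (\<lambda>l. 0) ks = 0"
  using col_exp_scale[of f 0 "\<lambda>_. 0" ks] by simp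

lemma col_exp_lincomb:
  "col_exp (\<lambda>x. c * f x + d * g x) h ks = c * col_exp f h ks + d * col_exp g h ks"
proof (induction ks arbitrary: h)
  case (Cons x xs)
  show ?case unfolding col_exp.simps Cons.IH by (simp add: algebra_simps)
qed simp

text \<open>Two equal leading columns: every pair of deleted rows occurs in both orders, with
  opposite signs.\<close>

lemma col_exp_twice: "col_exp f (col_exp f h) ks = 0"
proof (induction ks arbitrary: h)
  case (Cons x xs)
  show ?case unfolding col_exp.simps col_exp_diff col_exp_scale Cons.IH by simp
qed simp

definition alternating_fun :: "(int list \<Rightarrow> 'a::comm_ring_1) \<Rightarrow> bool" where
  "alternating_fun h \<longleftrightarrow> (\<forall>us a b vs. h (us @ a # b # vs) = - h (us @ b # a # vs))"

lemma alternating_funD: "alternating_fun h \<Longrightarrow> h (us @ a # b # vs) = - h (us @ b # a # vs)"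
  unfolding alternating_fun_def by blast

lemma alternating_fun_Cons: "alternating_fun h \<Longrightarrow> alternating_fun (\<lambda>l. h (x # l))"
  unfolding alternating_fun_def append_Cons[symmetric] by blast

lemma alternating_fun_col_exp:
  assumes "alternating_fun h"
  shows "alternating_fun (col_exp f h)"
proof -
  have "col_exp f h (us @ a # b # vs) = - col_exp f h (us @ b # a # vs)" for us a b vs
    using assms
  proof (induction us arbitrary: h)
    case Nil
    have "(\<lambda>l. h (b # a # l)) = (\<lambda>l. - h (a # b # l))"
      using alternating_funD[OF Nil, of "[]" b a] by (intro ext) simp
    then have "col_exp f (\<lambda>l. h (b # a # l)) vs = - col_exp f (\<lambda>l. h (a # b # l)) vs"
      by (simp only: col_exp_uminus)
    then show ?case by simp
  next
    case (Cons u us)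
    have "h (us @ a # b # vs) = - h (us @ b # a # vs)"
      by (rule alternating_funD[OF Cons.prems])
    moreover have "col_exp f (\<lambda>l. h (u # l)) (us @ a # b # vs)
        = - col_exp f (\<lambda>l. h (u # l)) (us @ b # a # vs)"
      by (rule Cons.IH[OF alternating_fun_Cons[OF Cons.prems]])
    ultimately show ?case by simp
  qed
  then show ?thesis unfolding alternating_fun_def by blast
qed

lemma alternating_fun_ldet: "alternating_fun (ldet fs)"
proof (induction fs)
  case Nil
  then show ?case by (auto simp: alternating_fun_def)
next
  case (Cons f fs)
  have "ldet (f # fs) = col_exp f (ldet fs)" by auto
  then show ?case using alternating_fun_col_exp[OF Cons] by simp
qed

text \<open>Each summand contains every argument exactly once, either in the column entry or in the
  minor, so the row operators can be distributed over the columns.\<close>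

lemma prod_op_col_exp:
  "prod_op t (col_exp f h) ks = col_exp (\<lambda>x. f x - t * f (x + 1)) (prod_op t h) ks"
proof (induction ks arbitrary: h)
  case (Cons x xs)
  show ?case
    unfolding col_exp.simps prod_op.simps prod_op_diff prod_op_scale col_exp_diff col_exp_scale Cons.IH
    by (simp add: algebra_simps)
qed simp

lemma prod_op_ldet: "prod_op t (ldet fs) ks = ldet (map (\<lambda>f x. f x - t * f (x + 1)) fs) ks"
proof (induction fs arbitrary: ks)
  case Nil
  then show ?case by (cases ks) (simp_all add: prod_op_zero)
next
  case (Cons f fs)
  have "prod_op t (ldet (f # fs)) ks = prod_op t (col_exp f (ldet fs)) ks"
    by (rule arg_cong[where f = "\<lambda>h. prod_op t h ks"]) auto
  also have "\<dots> = col_exp (\<lambda>x. f x - t * f (x + 1)) (prod_op t (ldet fs)) ks"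
    by (rule prod_op_col_exp)
  also have "prod_op t (ldet fs) = ldet (map (\<lambda>f x. f x - t * f (x + 1)) fs)"
    using Cons by auto
  finally show ?case by simp
qed

lemma col_exp_translate:
  "col_exp f h (map (\<lambda>v. v + c) ks) = col_exp (\<lambda>x. f (x + c)) (\<lambda>l. h (map (\<lambda>v. v + c) l)) ks"
  by (induction ks arbitrary: h) auto

lemma ldet_translate: "ldet fs (map (\<lambda>v. v + c) ks) = ldet (map (\<lambda>f x. f (x + c)) fs) ks"
proof (induction fs arbitrary: ks)
  case (Cons f fs)
  have "(\<lambda>l. ldet fs (map (\<lambda>v. v + c) l)) = ldet (map (\<lambda>f x. f (x + c)) fs)"
    using Cons by auto
  then show ?case by (simp add: col_exp_translate)
qed simp

lemma ldet_scale_cols: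
  "ldet (map (\<lambda>j x. e j * F j x) js) ks = (\<Prod>j\<leftarrow>js. e j) * ldet (map F js) ks"
proof (induction js arbitrary: ks)
  case (Cons j js)
  have "ldet (map (\<lambda>j x. e j * F j x) js) = (\<lambda>l. (\<Prod>j\<leftarrow>js. e j) * ldet (map F js) l)"
    using Cons by auto
  then show ?case
    using col_exp_lincomb[of "e j" "F j" 0 "\<lambda>_. 0"] by (simp add: col_exp_scale)
qed simp

lemma col_exp_scale_rows:
  "col_exp (\<lambda>x. g x * f x) (\<lambda>l. (\<Prod>v\<leftarrow>l. g v) * h l) ks = (\<Prod>v\<leftarrow>ks. g v) * col_exp f h ks"
proof (induction ks arbitrary: h)
  case (Cons x xs)
  have "col_exp (\<lambda>x. g x * f x) (\<lambda>l. g x * (\<Prod>v\<leftarrow>l. g v) * h (x # l)) xs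
      = g x * (\<Prod>v\<leftarrow>xs. g v) * col_exp f (\<lambda>l. h (x # l)) xs"
    unfolding mult.assoc col_exp_scale Cons.IH ..
  then show ?case by (simp add: algebra_simps)
qed simp

lemma ldet_scale_rows:
  "ldet (map (\<lambda>f x. g x * f x) fs) ks = (\<Prod>v\<leftarrow>ks. g v) * ldet fs ks"
proof (induction fs arbitrary: ks)
  case (Cons f fs)
  have "ldet (map (\<lambda>f x. g x * f x) fs) = (\<lambda>l. (\<Prod>v\<leftarrow>l. g v) * ldet fs l)"
    using Cons by auto
  then show ?case by (simp add: col_exp_scale_rows)
qed simp

lemma ldet_vanish_row: "(\<And>f. f \<in> set fs \<Longrightarrow> f x = 0) \<Longrightarrow> ldet fs (x # xs) = 0"
proof (induction fs arbitrary: xs)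
  case (Cons f fs)
  have "f x = 0" "\<And>l. ldet fs (x # l) = 0" using Cons by auto
  then show ?case by (simp add: col_exp_zero)
qed simp

text \<open>Column operations from the left: with F m standing in front, the part d * F m of the
  next column is killed by \<open>col_exp_twice\<close>, and then F (Suc m) takes over the role of F
  m.\<close>

lemma col_exp_ldet_chain:
  "col_exp (F m) (ldet (map (\<lambda>j x. c * F (Suc j) x + d * F j x) [m..<m + k])) ks
    = c ^ k * col_exp (F m) (ldet (map (\<lambda>j. F (Suc j)) [m..<m + k])) ks"
proof (induction k arbitrary: m ks)
  case (Suc k)
  let ?h = "ldet (map (\<lambda>j x. c * F (Suc j) x + d * F j x) [Suc m..<Suc m + k])"
  let ?h' = "ldet (map (\<lambda>j. F (Suc j)) [Suc m..<Suc m + k])"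
  have split: "[m..<m + Suc k] = m # [Suc m..<Suc m + k]"
    by (simp add: upt_conv_Cons)
  have "ldet (map (\<lambda>j x. c * F (Suc j) x + d * F j x) [m..<m + Suc k])
      = (\<lambda>l. c * col_exp (F (Suc m)) ?h l + d * col_exp (F m) ?h l)"
    unfolding split by (rule ext) (simp add: col_exp_lincomb del: upt_Suc)
  also have "\<dots> = (\<lambda>l. c * (c ^ k * col_exp (F (Suc m)) ?h' l) + d * col_exp (F m) ?h l)"
    using Suc.IH[of "Suc m"] by simp
  finally have "ldet (map (\<lambda>j x. c * F (Suc j) x + d * F j x) [m..<m + Suc k])
      = (\<lambda>l. c * (c ^ k * col_exp (F (Suc m)) ?h' l) + d * col_exp (F m) ?h l)" .
  moreover have "ldet (map (\<lambda>j. F (Suc j)) [m..<m + Suc k]) = col_exp (F (Suc m)) ?h'"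
    unfolding split by (rule ext) (simp del: upt_Suc)
  ultimately show ?case
    by (simp add: col_exp_add col_exp_scale col_exp_twice algebra_simps del: upt_Suc)
qed simp

text \<open>A triangular change of columns with diagonal c. It serves with c = 1 for translation
  invariance and with c = 1 - t for the action of \<open>prod_op\<close>, both through Pascal's
  rule.\<close>

lemma ldet_chain:
  fixes F :: "nat \<Rightarrow> int \<Rightarrow> 'a::comm_ring_1"
  shows "ldet (map (\<lambda>j x. c * F j x + (if j = 0 then 0 else d * F (j - 1) x)) [0..<n]) ks
    = c ^ n * ldet (map F [0..<n]) ks"
proof (cases n)
  case (Suc k)
  have upt: "[0..<n] = 0 # map Suc [0..<k]"
    by (simp add: Suc upt_conv_Cons map_Suc_upt del: upt_Suc)
  have "ldet (map (\<lambda>j x. c * F j x + (if j = 0 then 0 else d * F (j - 1) x)) [0..<n]) ks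
      = col_exp (\<lambda>x. c * F 0 x + 0 * 0)
          (ldet (map (\<lambda>j x. c * F (Suc j) x + d * F j x) [0..<0 + k])) ks"
    by (simp add: upt comp_def)
  also have "\<dots> = c * (c ^ k * col_exp (F 0) (ldet (map (\<lambda>j. F (Suc j)) [0..<0 + k])) ks)"
    by (simp only: col_exp_lincomb col_exp_ldet_chain) simp
  also have "\<dots> = c ^ n * ldet (map F [0..<n]) ks"
    unfolding upt by (simp add: Suc comp_def)
  finally show ?thesis .
qed simp

section \<open>The generalised Vandermonde product\<close>

definition binom_col :: "nat \<Rightarrow> int \<Rightarrow> real" where
  "binom_col j x = of_int x gchoose j"

definition vdet :: "int list \<Rightarrow> real" where
  "vdet ks = ldet (map binom_col [0..<length ks]) ks"

text \<open>The antidifference of \<open>vdet\<close> in every argument, since differencing binom(x,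
  j+1) gives binom(x, j). It is also the minor left when the column of ones is expanded.\<close>

definition vdet_sum :: "int list \<Rightarrow> real" where
  "vdet_sum ks = ldet (map (\<lambda>j. binom_col (Suc j)) [0..<length ks]) ks"

fun vprod :: "int list \<Rightarrow> real" where
  "vprod [] = 1"
| "vprod (x # xs) = (\<Prod>y\<leftarrow>xs. of_int (y - x)) / fact (length xs) * vprod xs"

lemma binom_col_0 [simp]: "binom_col 0 x = 1"
  by (simp add: binom_col_def)

lemma binom_col_Suc: "binom_col (Suc j) (x + 1) = binom_col (Suc j) x + binom_col j x"
  by (simp add: binom_col_def gbinomial_Suc_Suc)

lemma binom_col_absorb: "binom_col (Suc j) x = of_int x * (1 / real (Suc j) * binom_col j (x - 1))"
  using gbinomial_absorption'[of "Suc j" "of_int x :: real"] by (simp add: binom_col_def)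

lemma del_sum_col_exp: "del_sum h ks = col_exp (\<lambda>_. 1) h ks"
  by (induction ks arbitrary: h) auto

lemma vdet_Cons: "length ks = Suc n \<Longrightarrow>
  vdet ks = col_exp (\<lambda>_. 1) (ldet (map (\<lambda>j. binom_col (Suc j)) [0..<n])) ks"
proof -
  assume "length ks = Suc n"
  moreover have "[0..<Suc n] = 0 # map Suc [0..<n]"
    by (simp add: upt_conv_Cons map_Suc_upt del: upt_Suc)
  moreover have "binom_col 0 = (\<lambda>_. 1)" by auto
  ultimately show ?thesis by (simp add: vdet_def comp_def del: upt_Suc)
qed

lemma vdet_translate_1: "vdet (map (\<lambda>v. v + 1) ks) = vdet ks"
proof -
  have "map (\<lambda>f x. f (x + 1)) (map binom_col [0..<length ks])
      = map (\<lambda>j x. 1 * binom_col j x + (if j = 0 then 0 else 1 * binom_col (j - 1) x)) [0..<length ks]"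
  proof -
    have "binom_col j (x + 1) = 1 * binom_col j x + (if j = 0 then 0 else 1 * binom_col (j - 1) x)" for j x
      by (cases j) (auto simp: binom_col_Suc)
    then show ?thesis by simp
  qed
  then show ?thesis
    unfolding vdet_def length_map ldet_translate by (simp only: ldet_chain) simp
qed

lemma vdet_translate: "vdet (map (\<lambda>v. v + c) ks) = vdet ks"
proof (induction c rule: int_induct[where k = 0])
  case (step1 c)
  have "map (\<lambda>v. v + (c + 1)) ks = map (\<lambda>v. v + 1) (map (\<lambda>v. v + c) ks)" by simp
  then show ?case using step1 by (simp only: vdet_translate_1)
next
  case (step2 c)
  have "map (\<lambda>v. v + c) ks = map (\<lambda>v. v + 1) (map (\<lambda>v. v + (c - 1)) ks)" by simp
  then show ?case using step2 by (simp only: vdet_translate_1)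
qed simp

lemma prod_list_upt_Suc: "(\<Prod>j\<leftarrow>[0..<n]. 1 / (1 + real j)) = 1 / fact n"
  by (induction n) (simp_all add: mult.commute)

text \<open>By translation the first argument may be taken as 0. Its row is then (1, 0, ..., 0), and
  absorption takes a factor y out of each remaining row and 1/(j+1) out of each remaining column,
  leaving a determinant of the same kind at translated arguments.\<close>

lemma vdet_vprod: "vdet ks = vprod ks"
proof (induction ks)
  case (Cons x xs)
  define n where "n = length xs"
  define ys where "ys = map (\<lambda>v. v + (- x)) xs"
  let ?H = "ldet (map (\<lambda>j. binom_col (Suc j)) [0..<n])"
  have len: "length ys = n" by (simp add: ys_def n_def)
  have zero: "?H (0 # l) = 0" for l
    by (rule ldet_vanish_row) (auto simp: binom_col_absorb)
  have "vdet (x # xs) = vdet (map (\<lambda>v. v + (- x)) (x # xs))"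
    by (rule vdet_translate[symmetric])
  also have "\<dots> = vdet (0 # ys)"
    by (simp add: ys_def)
  also have "\<dots> = ?H ys"
    by (subst vdet_Cons[where n = n]) (simp_all add: len zero col_exp_zero)
  also have "\<dots> = ldet (map (\<lambda>f x. of_int x * f x)
      (map (\<lambda>j x. 1 / real (Suc j) * binom_col j (x - 1)) [0..<n])) ys"
    by (rule arg_cong[where f = "\<lambda>fs. ldet fs ys"]) (simp add: fun_eq_iff binom_col_absorb)
  also have "\<dots> = (\<Prod>y\<leftarrow>ys. of_int y) * (1 / fact n)
      * ldet (map (\<lambda>j x. binom_col j (x - 1)) [0..<n]) ys"
    unfolding ldet_scale_rows ldet_scale_cols by (simp add: prod_list_upt_Suc)
  also have "ldet (map (\<lambda>j x. binom_col j (x - 1)) [0..<n]) ys = vdet (map (\<lambda>v. v + (- 1)) ys)"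
    unfolding vdet_def ldet_translate by (simp add: len comp_def)
  also have "\<dots> = vdet xs" unfolding ys_def vdet_translate ..
  finally show ?case
    by (simp add: Cons ys_def n_def comp_def)
qed (simp add: vdet_def)

lemma del_sum_cong:
  "(\<And>l. Suc (length l) = length ks \<Longrightarrow> h l = h' l) \<Longrightarrow> del_sum h ks = del_sum h' ks"
proof (induction ks arbitrary: h h')
  case (Cons x xs)
  have "del_sum (\<lambda>l. h (x # l)) xs = del_sum (\<lambda>l. h' (x # l)) xs"
    by (rule Cons.IH) (simp add: Cons.prems)
  then show ?case by (simp add: Cons.prems)
qed simp

lemma vdet_del_sum: "ks \<noteq> [] \<Longrightarrow> vdet ks = del_sum vdet_sum ks"
proof -
  assume "ks \<noteq> []"
  then obtain n where n: "length ks = Suc n" by (cases ks) auto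
  show ?thesis
    unfolding vdet_Cons[OF n] del_sum_col_exp[symmetric]
    by (rule del_sum_cong) (simp add: n vdet_sum_def)
qed

lemma diff_all_vdet_sum: "diff_all vdet_sum ks = vdet ks"
proof -
  define n where "n = length ks"
  have cong: "prod_op t h ks = prod_op t h' ks" if "\<And>l. length l = length ks \<Longrightarrow> h l = h' l" for t::real and h h'
    using that
  proof (induction ks arbitrary: h h')
    case (Cons x xs)
    have "prod_op t (\<lambda>l. h (v # l)) xs = prod_op t (\<lambda>l. h' (v # l)) xs" for v
      by (rule Cons.IH) (simp add: Cons.prems)
    then show ?case by simp
  qed simp
  have "diff_all vdet_sum ks = (- 1) ^ n * prod_op 1 (ldet (map (\<lambda>j. binom_col (Suc j)) [0..<n])) ks"
    unfolding diff_all_prod_op n_def by (subst cong) (auto simp: vdet_sum_def)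
  also have "prod_op 1 (ldet (map (\<lambda>j. binom_col (Suc j)) [0..<n])) ks
      = ldet (map (\<lambda>j x. - 1 * binom_col j x) [0..<n]) ks"
    unfolding prod_op_ldet by (simp add: comp_def binom_col_Suc)
  also have "\<dots> = (- 1) ^ n * vdet ks"
    unfolding ldet_scale_cols by (simp add: vdet_def n_def prod_list_replicate map_replicate_const)
  finally show ?thesis by simp
qed

section \<open>The swap relation\<close>

text \<open>The operator id - E_b + E_a E_b, in which a and b have exchanged roles compared with the
  factor in \<open>wop\<close>, produces a function antisymmetric in these two neighbouring
  arguments.\<close>

definition swap_antisym :: "nat \<Rightarrow> (int list \<Rightarrow> real) \<Rightarrow> bool" where
  "swap_antisym k g \<longleftrightarrow> (\<forall>us a b vs. length us = k \<longrightarrow>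
     g (us @ a # b # vs) - g (us @ a # (b + 1) # vs) + g (us @ (a + 1) # (b + 1) # vs)
     = - (g (us @ b # a # vs) - g (us @ b # (a + 1) # vs) + g (us @ (b + 1) # (a + 1) # vs)))"

lemma swap_antisymD:
  "swap_antisym k g \<Longrightarrow> length us = k \<Longrightarrow>
     g (us @ a # b # vs) - g (us @ a # (b + 1) # vs) + g (us @ (a + 1) # (b + 1) # vs)
     = - (g (us @ b # a # vs) - g (us @ b # (a + 1) # vs) + g (us @ (b + 1) # (a + 1) # vs))"
  unfolding swap_antisym_def by blast

text \<open>The head contributes (id - E_u + E_u E_a)(id - E_u + E_u E_b), which is symmetric in a
  and b and so preserves the antisymmetry.\<close>

lemma swap_antisym_wop_head:
  "(\<And>u. swap_antisym k (G u)) \<Longrightarrow> swap_antisym k (wop_head G u)"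
proof (induction k arbitrary: G u)
  case 0
  have base: "wop_head G u (a # b # vs) - wop_head G u (a # (b + 1) # vs) + wop_head G u ((a + 1) # (b + 1) # vs)
     = - (wop_head G u (b # a # vs) - wop_head G u (b # (a + 1) # vs) + wop_head G u ((b + 1) # (a + 1) # vs))"
    for a b vs
  proof -
    define N where "N u a b = wop_head (\<lambda>u us. G u (a # b # us)) u vs" for u a b
    have N: "N u a b - N u a (b + 1) + N u (a + 1) (b + 1)
        = - (N u b a - N u b (a + 1) + N u (b + 1) (a + 1))" for u a b
      unfolding N_def wop_head_diff[symmetric] wop_head_add[symmetric] wop_head_uminus[symmetric]
    proof (intro wop_head_cong refl)
      fix u :: int and us :: "int list"
      show "G u (a # b # us) - G u (a # (b + 1) # us) + G u ((a + 1) # (b + 1) # us)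
        = - (G u (b # a # us) - G u (b # (a + 1) # us) + G u ((b + 1) # (a + 1) # us))"
        using swap_antisymD[OF 0, of "[]" u a b us] by simp
    qed
    have exp: "wop_head G u (a # b # vs)
        = (N u a b - N (u + 1) a b + N (u + 1) a (b + 1))
          - (N (u + 1) a b - N (u + 1 + 1) a b + N (u + 1 + 1) a (b + 1))
          + (N (u + 1) (a + 1) b - N (u + 1 + 1) (a + 1) b + N (u + 1 + 1) (a + 1) (b + 1))" for u a b
      by (simp only: wop_head.simps N_def)
    show ?thesis
      unfolding exp
      using N[of u a b] N[of "u + 1" a b] N[of "u + 1" a "b + 1"] N[of "u + 1 + 1" a b]
        N[of "u + 1 + 1" a "b + 1"] N[of "u + 1" "a + 1" b] N[of "u + 1 + 1" "a + 1" b]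
        N[of "u + 1 + 1" "a + 1" "b + 1"] by linarith
  qed
  show ?case
    unfolding swap_antisym_def length_0_conv
    by (intro allI impI, hypsubst, unfold append_Nil, rule base)
next
  case (Suc k)
  have "swap_antisym k (\<lambda>l. G u (c # l))" for u c
    using Suc.prems[of u] unfolding swap_antisym_def by (metis append_Cons length_Cons)
  then have IH: "swap_antisym k (wop_head (\<lambda>u us. G u (c # us)) u)" for u c
    by (rule Suc.IH)
  show ?case
    unfolding swap_antisym_def
  proof (intro allI impI)
    fix us :: "int list" and a b vs
    assume "length us = Suc k"
    then obtain c ws where us: "us = c # ws" "length ws = k" by (cases us) auto
    show "wop_head G u (us @ a # b # vs) - wop_head G u (us @ a # (b + 1) # vs)
          + wop_head G u (us @ (a + 1) # (b + 1) # vs)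
        = - (wop_head G u (us @ b # a # vs) - wop_head G u (us @ b # (a + 1) # vs)
          + wop_head G u (us @ (b + 1) # (a + 1) # vs))"
      unfolding us append_Cons wop_head.simps
      using swap_antisymD[OF IH[of c u] us(2), of a b vs]
        swap_antisymD[OF IH[of c "u + 1"] us(2), of a b vs]
        swap_antisymD[OF IH[of "c + 1" "u + 1"] us(2), of a b vs]
      by linarith
  qed
qed

text \<open>The factor id - E_b + E_a E_b completes the factor id - E_a + E_a E_b of
  \<open>wop\<close> to an operator symmetric in the two positions. The other factors together are
  symmetric as well, so an alternating \<open>h\<close> yields an antisymmetric result.\<close>

lemma swap_antisym_wop: "alternating_fun h \<Longrightarrow> swap_antisym k (wop h)"
proof (induction k arbitrary: h)
  case 0
  have base: "wop h (a # b # vs) - wop h (a # (b + 1) # vs) + wop h ((a + 1) # (b + 1) # vs)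
     = - (wop h (b # a # vs) - wop h (b # (a + 1) # vs) + wop h ((b + 1) # (a + 1) # vs))"
    for a b vs
  proof -
    \<comment> \<open>\<open>M\<close> carries all factors of \<open>wop\<close> except the one
      linking the first two positions.\<close>
    define M where "M a b = wop_head (\<lambda>u. wop_head (\<lambda>v vs. wop (\<lambda>l. h (u # v # l)) vs) b) a vs" for a b
    have M: "M a b = - M b a" for a b
    proof -
      have eq: "(\<lambda>l. h (u # v # l)) = (\<lambda>l. - h (v # u # l))" for u v
        using alternating_funD[OF 0, of "[]" u v] by (intro ext) simp
      have "M a b = wop_head (\<lambda>v. wop_head (\<lambda>u vs. wop (\<lambda>l. h (u # v # l)) vs) a) b vs"
        unfolding M_def by (rule wop_head_commute)
      also have "\<dots> = wop_head (\<lambda>v. wop_head (\<lambda>u vs. - wop (\<lambda>l. h (v # u # l)) vs) a) b vs"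
        unfolding wop_uminus[symmetric] by (subst eq) (rule refl)
      also have "\<dots> = - M b a"
        unfolding M_def wop_head_uminus
        using wop_head_uminus[of "\<lambda>v. wop_head (\<lambda>u vs. wop (\<lambda>l. h (v # u # l)) vs) a" b vs]
        by (simp add: wop_head_uminus[abs_def])
      finally show ?thesis .
    qed
    have exp: "wop h (a # b # vs) = M a b - M (a + 1) b + M (a + 1) (b + 1)" for a b
      by (simp only: wop.simps wop_head.simps M_def)
    show ?thesis
      unfolding exp using M[of a b] M[of "a + 1" b] M[of a "b + 1"] M[of "a + 1" "b + 1"]
        M[of "a + 1 + 1" "b + 1"] M[of "a + 1" "b + 1 + 1"] M[of "a + 1 + 1" "b + 1 + 1"]
      by linarith
  qed
  show ?case
    unfolding swap_antisym_def length_0_conv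
    by (intro allI impI, hypsubst, unfold append_Nil, rule base)
next
  case (Suc k)
  have *: "swap_antisym k (wop (\<lambda>l. h (u # l)))" for u
    by (rule Suc.IH[OF alternating_fun_Cons[OF Suc.prems]])
  have head: "swap_antisym k (wop_head (\<lambda>u. wop (\<lambda>l. h (u # l))) c)" for c
    by (rule swap_antisym_wop_head) (rule *)
  show ?case
    unfolding swap_antisym_def
  proof (intro allI impI)
    fix us :: "int list" and a b vs
    assume "length us = Suc k"
    then obtain c ws where us: "us = c # ws" "length ws = k" by (cases us) auto
    show "wop h (us @ a # b # vs) - wop h (us @ a # (b + 1) # vs) + wop h (us @ (a + 1) # (b + 1) # vs)
        = - (wop h (us @ b # a # vs) - wop h (us @ b # (a + 1) # vs) + wop h (us @ (b + 1) # (a + 1) # vs))"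
      using swap_antisymD[OF head us(2)] unfolding us append_Cons wop.simps .
  qed
qed

section \<open>The relation for adjacent arguments\<close>

definition adjacent_additive :: "(int list \<Rightarrow> 'a::comm_ring_1) \<Rightarrow> bool" where
  "adjacent_additive h \<longleftrightarrow>
     (\<forall>us l vs. h (us @ l # (l + 1) # vs) = h (us @ l # l # vs) + h (us @ (l + 1) # (l + 1) # vs))"

lemma adjacent_additiveD:
  "adjacent_additive h \<Longrightarrow> h (us @ l # (l + 1) # vs) = h (us @ l # l # vs) + h (us @ (l + 1) # (l + 1) # vs)"
  unfolding adjacent_additive_def by blast

lemma adjacent_additive_Cons: "adjacent_additive h \<Longrightarrow> adjacent_additive (\<lambda>l. h (x # l))"
  unfolding adjacent_additive_def append_Cons[symmetric] by blast

lemma adjacent_additive_snoc: "adjacent_additive h \<Longrightarrow> adjacent_additive (\<lambda>l. h (l @ [x]))"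
  unfolding adjacent_additive_def by simp

lemma adjacent_additive_scale:
  "adjacent_additive h \<Longrightarrow> adjacent_additive (\<lambda>l. c * h l)"
  unfolding adjacent_additive_def by (simp add: algebra_simps)

lemma adjacent_additive_diff:
  "adjacent_additive g \<Longrightarrow> adjacent_additive h \<Longrightarrow> adjacent_additive (\<lambda>l. g l - h l)"
  unfolding adjacent_additive_def by (simp add: algebra_simps)

text \<open>With a = b = l the swap relation makes a quantity equal to its own negative. The
  alternating function may depend on the length, because \<open>vdet\<close> chooses its columns by
  the length of the list.\<close>

lemma adjacent_additive_wop:
  fixes f :: "int list \<Rightarrow> real"
  assumes "\<And>n. \<exists>h. alternating_fun h \<and> (\<forall>l. length l = n \<longrightarrow> f l = h l)"
  shows "adjacent_additive (wop f)"
  unfolding adjacent_additive_def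
proof (intro allI)
  fix us :: "int list" and l and vs :: "int list"
  obtain h where h: "alternating_fun h" "\<And>ks. length ks = length us + length vs + 2 \<Longrightarrow> f ks = h ks"
    using assms by blast
  have "wop f ks = wop h ks" if "length ks = length us + length vs + 2" for ks
    by (rule wop_cong[OF that h(2)])
  then show "wop f (us @ l # (l + 1) # vs) = wop f (us @ l # l # vs) + wop f (us @ (l + 1) # (l + 1) # vs)"
    using swap_antisymD[OF swap_antisym_wop[OF h(1)] refl, of us l l vs] by simp
qed

section \<open>Polynomial growth\<close>

definition fwd :: "(int \<Rightarrow> real) \<Rightarrow> int \<Rightarrow> real" where
  "fwd g = (\<lambda>x. g (x + 1) - g x)"

text \<open>On the integers, a vanishing n-th difference expresses that g is a polynomial of degree
  less than n.\<close>

definition nilp :: "nat \<Rightarrow> (int \<Rightarrow> real) \<Rightarrow> bool" where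
  "nilp n g \<longleftrightarrow> (fwd ^^ n) g = (\<lambda>_. 0)"

lemma nilp_0: "nilp 0 g \<longleftrightarrow> g = (\<lambda>_. 0)"
  by (simp add: nilp_def)

lemma nilp_Suc: "nilp (Suc n) g \<longleftrightarrow> nilp n (fwd g)"
  by (simp add: nilp_def funpow_swap1)

lemma nilp_zero: "nilp n (\<lambda>_. 0)"
  by (induction n) (simp_all add: nilp_0 nilp_Suc fwd_def)

lemma nilp_add: "nilp n f \<Longrightarrow> nilp n g \<Longrightarrow> nilp n (\<lambda>x. f x + g x)"
proof (induction n arbitrary: f g)
  case (Suc n)
  have "fwd (\<lambda>x. f x + g x) = (\<lambda>x. fwd f x + fwd g x)" by (auto simp: fwd_def)
  then show ?case using Suc by (simp add: nilp_Suc)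
qed (simp add: nilp_0)

lemma nilp_scale: "nilp n f \<Longrightarrow> nilp n (\<lambda>x. c * f x)"
proof (induction n arbitrary: f)
  case (Suc n)
  have "fwd (\<lambda>x. c * f x) = (\<lambda>x. c * fwd f x)" by (auto simp: fwd_def algebra_simps)
  then show ?case using Suc by (simp add: nilp_Suc)
qed (simp add: nilp_0)

lemma nilp_uminus: "nilp n f \<Longrightarrow> nilp n (\<lambda>x. - f x)"
  using nilp_scale[of n f "-1"] by simp

lemma nilp_diff: "nilp n f \<Longrightarrow> nilp n g \<Longrightarrow> nilp n (\<lambda>x. f x - g x)"
  using nilp_add[of n f "\<lambda>x. - g x"] nilp_uminus[of n g] by simp

lemma nilp_shift: "nilp n f \<Longrightarrow> nilp n (\<lambda>x. f (x + c))"
proof (induction n arbitrary: f)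
  case (Suc n)
  have "fwd (\<lambda>x. f (x + c)) = (\<lambda>x. fwd f (x + c))" by (auto simp: fwd_def algebra_simps)
  then show ?case using Suc by (simp add: nilp_Suc)
qed (simp add: nilp_0)

lemma nilp_reflect: "nilp n f \<Longrightarrow> nilp n (\<lambda>x. f (c - x))"
proof (induction n arbitrary: f c)
  case (Suc n)
  have "fwd (\<lambda>x. f (c - x)) = (\<lambda>x. - fwd f (c - 1 - x))" by (auto simp: fwd_def algebra_simps)
  then show ?case using Suc by (simp add: nilp_Suc nilp_uminus)
qed (simp add: nilp_0)

lemma nilp_Suc_mono: "nilp n f \<Longrightarrow> nilp (Suc n) f"
  by (simp add: nilp_def fwd_def)

lemma nilp_mono: "nilp m f \<Longrightarrow> m \<le> n \<Longrightarrow> nilp n f"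
  by (induction n) (auto simp: le_Suc_eq nilp_Suc_mono)

text \<open>F(x+1, x+1) - F(x, x) splits into a difference in the first argument and one in the
  second. Both are again restricted to a diagonal, and each lowers one of the two degrees.\<close>

lemma nilp_diagonal:
  "(\<And>b. nilp m (\<lambda>a. F a b)) \<Longrightarrow> (\<And>a. nilp n (F a)) \<Longrightarrow> nilp (m + n) (\<lambda>x. F x x)"
proof (induction "m + n" arbitrary: m n F)
  case 0
  then show ?case by (simp add: nilp_0 fun_eq_iff)
next
  case (Suc k)
  show ?case
  proof (cases "m = 0 \<or> n = 0")
    case True
    then have "F x x = 0" for x
      using Suc.prems by (auto simp: nilp_0 fun_eq_iff)
    then show ?thesis by (simp add: nilp_zero)
  next
    case False
    then obtain m' n' where mn: "m = Suc m'" "n = Suc n'" by (metis not0_implies_Suc)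
    have 1: "nilp (m' + n) (\<lambda>x. F (x + 1) (x + 1) - F x (x + 1))"
    proof (rule Suc.hyps(1)[where F = "\<lambda>a b. F (a + 1) (b + 1) - F a (b + 1)"])
      show "k = m' + n" using Suc.hyps(2) mn by simp
      show "nilp m' (\<lambda>a. F (a + 1) (b + 1) - F a (b + 1))" for b
        using Suc.prems(1)[of "b + 1"] by (simp add: mn nilp_Suc fwd_def)
      show "nilp n (\<lambda>b. F (a + 1) (b + 1) - F a (b + 1))" for a
        by (intro nilp_diff nilp_shift[where f = "F _"] Suc.prems(2))
    qed
    have 2: "nilp (m + n') (\<lambda>x. F x (x + 1) - F x x)"
    proof (rule Suc.hyps(1)[where F = "\<lambda>a b. F a (b + 1) - F a b"])
      show "k = m + n'" using Suc.hyps(2) mn by simp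
      show "nilp m (\<lambda>a. F a (b + 1) - F a b)" for b
        by (intro nilp_diff Suc.prems(1))
      show "nilp n' (\<lambda>b. F a (b + 1) - F a b)" for a
        using Suc.prems(2)[of a] by (simp add: mn nilp_Suc fwd_def)
    qed
    have "nilp k (\<lambda>x. (F (x + 1) (x + 1) - F x (x + 1)) + (F x (x + 1) - F x x))"
      using Suc.hyps(2) mn by (intro nilp_add 1[THEN nilp_mono] 2[THEN nilp_mono]) auto
    then have "nilp k (fwd (\<lambda>x. F x x))" by (simp add: fwd_def)
    then show ?thesis using Suc.hyps(2) nilp_Suc by metis
  qed
qed

text \<open>Differencing multiplies such a \<open>g\<close> by -2, so the degree bound can be
  lowered down to 0.\<close>

lemma nilp_antiperiodic: "nilp n g \<Longrightarrow> (\<And>x. g (x + 1) = - g x) \<Longrightarrow> g x = 0"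
proof (induction n arbitrary: g)
  case (Suc n)
  have "fwd g = (\<lambda>x. - 2 * g x)" using Suc.prems(2) by (auto simp: fwd_def)
  then have "nilp n (\<lambda>x. - 2 * g x)" using Suc.prems(1) by (simp add: nilp_Suc)
  from nilp_scale[OF this, of "- 1 / 2"] have "nilp n g" by simp
  then show ?case using Suc by blast
qed (simp add: nilp_0)

lemma nilp_wop_head:
  "(\<And>u us. nilp n (\<lambda>x. K x u us)) \<Longrightarrow> nilp n (\<lambda>x. wop_head (K x) u vs)"
proof (induction vs arbitrary: K u)
  case (Cons v vs)
  have "nilp n (\<lambda>x. wop_head (\<lambda>u us. K x u (w # us)) z vs)" for w z
    by (rule Cons.IH) (rule Cons.prems)
  then show ?case by (simp add: nilp_add nilp_diff)
qed simp

lemma nilp_wop: "(\<And>l. nilp n (\<lambda>x. K x l)) \<Longrightarrow> nilp n (\<lambda>x. wop (K x) ks)"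
proof (induction "length ks" arbitrary: K ks)
  case (Suc m)
  then obtain k vs where ks: "ks = k # vs" by (cases ks) auto
  have eq: "wop (K x) ks = wop_head (\<lambda>u us. if length us = length vs then wop (\<lambda>l. K x (u # l)) us else 0) k vs" for x
    unfolding ks by (rule wop_Cons_eq) simp
  show ?case
    unfolding eq
  proof (rule nilp_wop_head)
    fix u and us :: "int list"
    show "nilp n (\<lambda>x. if length us = length vs then wop (\<lambda>l. K x (u # l)) us else 0)"
    proof (cases "length us = length vs")
      case True
      then have "nilp n (\<lambda>x. wop (\<lambda>l. K x (u # l)) us)"
        using Suc ks by (intro Suc.hyps(1)) auto
      then show ?thesis using True by simp
    qed (simp add: nilp_zero)
  qed
qed simp

text \<open>Degree less than n in the argument at position k, counted from 0, uniformly in the other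
  arguments and in the length of the list.\<close>

definition poly_at :: "nat \<Rightarrow> nat \<Rightarrow> (int list \<Rightarrow> real) \<Rightarrow> bool" where
  "poly_at n k h \<longleftrightarrow> (\<forall>us vs. length us = k \<longrightarrow> nilp n (\<lambda>x. h (us @ x # vs)))"

lemma poly_atD: "poly_at n k h \<Longrightarrow> length us = k \<Longrightarrow> nilp n (\<lambda>x. h (us @ x # vs))"
  by (simp add: poly_at_def)

lemma poly_at_Cons: "poly_at n (Suc k) h \<Longrightarrow> poly_at n k (\<lambda>l. h (u # l))"
  unfolding poly_at_def
proof (intro allI impI)
  fix us vs :: "int list"
  assume "\<forall>us vs. length us = Suc k \<longrightarrow> nilp n (\<lambda>x. h (us @ x # vs))" "length us = k"
  from this(1)[rule_format, of "u # us" vs] this(2)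
  show "nilp n (\<lambda>x. h (u # us @ x # vs))" by simp
qed

lemma nilp_wop_head_head:
  "(\<And>l. nilp n (\<lambda>u. G u l)) \<Longrightarrow> nilp n (\<lambda>u. wop_head G u l)"
proof (induction l arbitrary: G)
  case (Cons y ys)
  have "nilp n (\<lambda>u. wop_head (\<lambda>u us. G u (w # us)) u ys)" for w
    by (rule Cons.IH) (rule Cons.prems)
  then show ?case
    using nilp_shift[where f = "\<lambda>u. wop_head (\<lambda>u us. G u (_ # us)) u ys" and c = 1]
    by (simp add: nilp_add nilp_diff)
qed simp

lemma poly_at_wop_head:
  "(\<And>u. poly_at n k (G u)) \<Longrightarrow> poly_at n k (wop_head G u)"
proof (induction k arbitrary: G u)
  case 0
  have "nilp n (\<lambda>x. wop_head (\<lambda>u us. G u (x # us)) z vs)" for z vs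
    by (rule nilp_wop_head) (use poly_atD[OF 0, of "[]"] in simp)
  moreover have "nilp n (\<lambda>x. wop_head (\<lambda>u us. G u ((x + 1) # us)) z vs)" for z vs
    using nilp_shift[OF calculation] .
  ultimately show ?case by (simp add: poly_at_def nilp_add nilp_diff)
next
  case (Suc k)
  have "poly_at n k (wop_head (\<lambda>u us. G u (w # us)) z)" for w z
    by (rule Suc.IH) (rule poly_at_Cons[OF Suc.prems])
  then have "nilp n (\<lambda>x. wop_head (\<lambda>u us. G u (w # us)) z (us @ x # vs))" if "length us = k" for w z us vs
    using that by (rule poly_atD)
  then show ?case
    by (auto simp: poly_at_def length_Suc_conv intro!: nilp_add nilp_diff)
qed

lemma poly_at_wop: "(\<And>k. poly_at n k h) \<Longrightarrow> poly_at n k (wop h)"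
proof (induction k arbitrary: h)
  case 0
  have "nilp n (\<lambda>x. wop (\<lambda>l. h (x # l)) l)" for l
    by (rule nilp_wop) (use poly_atD[OF 0, of "[]"] in simp)
  then show ?case by (simp add: nilp_wop_head_head poly_at_def)
next
  case (Suc k)
  have "poly_at n k (wop (\<lambda>l. h (u # l)))" for u
    by (rule Suc.IH) (rule poly_at_Cons[OF Suc.prems])
  then have "poly_at n k (wop_head (\<lambda>u. wop (\<lambda>l. h (u # l))) u)" for u
    by (rule poly_at_wop_head)
  then have "nilp n (\<lambda>x. wop_head (\<lambda>u. wop (\<lambda>l. h (u # l))) u (us @ x # vs))" if "length us = k" for u us vs
    using that by (rule poly_atD)
  then show ?case
    by (auto simp: poly_at_def length_Suc_conv)
qed

lemma nilp_binom_col: "nilp (Suc j) (binom_col j)"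
proof (induction j)
  case 0
  show ?case by (simp add: nilp_Suc nilp_0 fwd_def)
next
  case (Suc j)
  have "fwd (binom_col (Suc j)) = binom_col j" by (auto simp: fwd_def binom_col_Suc)
  then show ?case using Suc by (simp add: nilp_Suc[of "Suc j"])
qed

lemma nilp_col_exp: "(\<And>l. nilp n (\<lambda>x. K x l)) \<Longrightarrow> nilp n (\<lambda>x. col_exp f (K x) ks)"
proof (induction ks arbitrary: K)
  case (Cons k ks)
  have "nilp n (\<lambda>x. col_exp f (\<lambda>l. K x (k # l)) ks)"
    by (rule Cons.IH) (rule Cons.prems)
  then show ?case by (simp add: Cons.prems nilp_scale nilp_diff)
qed (simp add: nilp_zero)

lemma poly_at_col_exp:
  "nilp n f \<Longrightarrow> (\<And>k. poly_at n k h) \<Longrightarrow> poly_at n k (col_exp f h)"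
proof (induction k arbitrary: h)
  case 0
  have "nilp n (\<lambda>x. col_exp f (\<lambda>l. h (x # l)) l)" for l
    by (rule nilp_col_exp) (use poly_atD[OF 0(2), of "[]"] in simp)
  moreover have "nilp n (\<lambda>x. f x * h l)" for l
    using nilp_scale[OF 0(1), of "h l"] by (simp add: mult.commute)
  ultimately show ?case by (simp add: poly_at_def nilp_diff)
next
  case (Suc k)
  have "poly_at n k (col_exp f (\<lambda>l. h (u # l)))" for u
    by (rule Suc.IH[OF Suc.prems(1)]) (rule poly_at_Cons[OF Suc.prems(2)])
  then have "nilp n (\<lambda>x. col_exp f (\<lambda>l. h (u # l)) (us @ x # vs))" if "length us = k" for u us vs
    using that by (rule poly_atD)
  moreover have "nilp n (\<lambda>x. f u * h (us @ x # vs))" for u us vs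
    by (rule nilp_scale) (rule poly_atD[OF Suc.prems(2) refl])
  ultimately show ?case
    by (auto simp: poly_at_def length_Suc_conv intro!: nilp_diff)
qed

lemma poly_at_ldet: "(\<And>f. f \<in> set fs \<Longrightarrow> nilp n f) \<Longrightarrow> poly_at n k (ldet fs)"
proof (induction fs arbitrary: k)
  case Nil
  then show ?case by (simp add: poly_at_def nilp_zero)
next
  case (Cons f fs)
  have "ldet (f # fs) = col_exp f (ldet fs)" by auto
  then show ?case using Cons by (simp add: poly_at_col_exp)
qed

section \<open>The polynomial counting monotone triangles\<close>

definition tri :: "int list \<Rightarrow> real" where
  "tri = wop vdet"

definition tri_sum :: "int list \<Rightarrow> real" where
  "tri_sum = wop vdet_sum"

lemma adjacent_additive_tri: "adjacent_additive tri"
  unfolding tri_def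
  by (rule adjacent_additive_wop) (metis alternating_fun_ldet vdet_def)

lemma adjacent_additive_tri_sum: "adjacent_additive tri_sum"
  unfolding tri_sum_def
  by (rule adjacent_additive_wop) (metis alternating_fun_ldet vdet_sum_def)

lemma diff_all_tri_sum: "diff_all tri_sum k = tri k"
proof -
  have "diff_all vdet_sum = vdet" by (rule ext) (rule diff_all_vdet_sum)
  then show ?thesis by (simp add: tri_def tri_sum_def diff_all_wop)
qed

lemma tri_eq_del_shift_sum:
  assumes "k \<noteq> []"
  shows "tri k = del_shift_sum tri_sum k"
proof -
  have "vdet l = del_sum vdet_sum l" if "length l = length k" for l
    using that assms by (intro vdet_del_sum) auto
  then have "tri k = wop (del_sum vdet_sum) k"
    unfolding tri_def by (intro wop_cong[OF refl]) auto
  then show ?thesis by (simp add: wop_del_sum tri_sum_def)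
qed

lemma tri_Nil: "tri [] = 1"
  by (simp add: tri_def vdet_def)

text \<open>On lists of one fixed length \<open>vdet\<close> is a determinant with fixed columns of
  degree less than n, and \<open>wop\<close> merely shifts arguments.\<close>

lemma nilp_tri: "length us + length vs < n \<Longrightarrow> nilp n (\<lambda>x. tri (us @ x # vs))"
proof -
  assume less: "length us + length vs < n"
  define m where "m = Suc (length us + length vs)"
  have "poly_at n k (ldet (map binom_col [0..<m]))" for k
  proof (rule poly_at_ldet)
    fix f assume "f \<in> set (map binom_col [0..<m])"
    then obtain j where "f = binom_col j" "Suc j \<le> n"
      using less by (auto simp: m_def)
    then show "nilp n f" using nilp_mono[OF nilp_binom_col] by simp
  qed
  then have "nilp n (\<lambda>x. wop (ldet (map binom_col [0..<m])) (us @ x # vs))"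
    by (intro poly_atD[OF poly_at_wop]) auto
  moreover have "wop (ldet (map binom_col [0..<m])) (us @ x # vs) = tri (us @ x # vs)" for x
    unfolding tri_def by (rule wop_cong[OF refl]) (auto simp: vdet_def m_def)
  ultimately show ?thesis by simp
qed

text \<open>Expanding (l, l, l+1) and then (l, l+1, l+1) by adjacent additivity shows that the value
  at (l+1, l+1, l+1) is minus the value at (l, l, l). As a polynomial in l it must vanish.\<close>

lemma tri_triple: "tri (us @ l # l # l # vs) = 0"
proof -
  define n where "n = length us + length vs + 3"
  define F where "F a b c = tri (us @ a # b # c # vs)" for a b c
  have 1: "nilp n (\<lambda>a. F a b c)" for b c
    unfolding F_def by (rule nilp_tri) (simp add: n_def)
  have 2: "nilp n (\<lambda>b. F a b c)" for a c
    using nilp_tri[of "us @ [a]" "c # vs" n] by (simp add: F_def n_def)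
  have 3: "nilp n (\<lambda>c. F a b c)" for a b
    using nilp_tri[of "us @ [a, b]" "vs" n] by (simp add: F_def n_def)
  have "nilp (n + n + n) (\<lambda>l. F l l l)"
  proof (rule nilp_diagonal[where F = "\<lambda>a c. F a a c"])
    show "nilp (n + n) (\<lambda>a. F a a c)" for c
      by (rule nilp_diagonal[where F = "\<lambda>a b. F a b c"]) (rule 1 2)+
    show "nilp n (\<lambda>c. F a a c)" for a by (rule 3)
  qed
  moreover have "F (l + 1) (l + 1) (l + 1) = - F l l l" for l
    using adjacent_additiveD[OF adjacent_additive_tri, of us l "l # vs"]
      adjacent_additiveD[OF adjacent_additive_tri, of "us @ [l]" l "vs"]
      adjacent_additiveD[OF adjacent_additive_tri, of us l "(l + 1) # vs"]
      adjacent_additiveD[OF adjacent_additive_tri, of "us @ [l + 1]" l "vs"]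
    by (simp add: F_def)
  ultimately have "F l l l = 0" by (rule nilp_antiperiodic)
  then show ?thesis by (simp add: F_def)
qed

lemma prod_op_cong:
  "(\<And>l. length l = length ks \<Longrightarrow> h l = h' l) \<Longrightarrow> prod_op t h ks = prod_op t h' ks"
proof (induction ks arbitrary: h h')
  case (Cons x xs)
  have "prod_op t (\<lambda>l. h (v # l)) xs = prod_op t (\<lambda>l. h' (v # l)) xs" for v
    by (rule Cons.IH) (simp add: Cons.prems)
  then show ?case by simp
qed simp

section \<open>Symmetric shift operators with power series coefficients\<close>

lemma fps_const_wop_head:
  "fps_const (wop_head g x xs) = wop_head (\<lambda>u us. fps_const (g u us)) x xs"
  by (induction xs arbitrary: g x)
    (simp_all add: fps_const_add[symmetric] fps_const_sub[symmetric] del: fps_const_add fps_const_sub)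

lemma fps_const_wop: "fps_const (wop h k) = wop (\<lambda>l. fps_const (h l)) k"
proof (induction "length k" arbitrary: h k)
  case (Suc n)
  then obtain x ys where k: "k = x # ys" "length ys = n" by (cases k) auto
  have "wop (\<lambda>l. fps_const (h l)) k = wop_head (\<lambda>u us. fps_const (wop (\<lambda>l. h (u # l)) us)) x ys"
    unfolding k by (rule wop_Cons_eq) (simp add: Suc k)
  then show ?case by (simp add: k fps_const_wop_head)
qed simp

lemma fps_const_col_exp:
  "fps_const (col_exp f h k) = col_exp (\<lambda>x. fps_const (f x)) (\<lambda>l. fps_const (h l)) k"
  by (induction k arbitrary: h)
    (simp_all add: fps_const_mult[symmetric] fps_const_sub[symmetric] del: fps_const_mult fps_const_sub)

lemma fps_const_ldet: "fps_const (ldet fs k) = ldet (map (\<lambda>f x. fps_const (f x)) fs) k"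
proof (induction fs arbitrary: k)
  case (Cons f fs)
  have "(\<lambda>l. fps_const (ldet fs l)) = ldet (map (\<lambda>f x. fps_const (f x)) fs)"
    using Cons by auto
  then show ?case by (simp add: fps_const_col_exp)
qed auto

text \<open>Symmetric polynomials in the shifts act on the Vandermonde product, and hence on
  \<^const>\<open>tri\<close>, as on a constant.\<close>

lemma prod_op_tri:
  fixes t :: "real fps"
  shows "prod_op t (\<lambda>l. fps_const (tri l)) k = (1 - t) ^ length k * fps_const (tri k)"
proof -
  let ?F = "\<lambda>j x. fps_const (binom_col j x)"
  have vdet: "fps_const (vdet l) = ldet (map ?F [0..<length l]) l" for l
    by (simp add: vdet_def fps_const_ldet comp_def)
  have *: "prod_op t (\<lambda>l. fps_const (vdet l)) ks = (1 - t) ^ length ks * fps_const (vdet ks)" for ks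
  proof -
    have "prod_op t (\<lambda>l. fps_const (vdet l)) ks = prod_op t (ldet (map ?F [0..<length ks])) ks"
      by (rule prod_op_cong) (simp add: vdet)
    also have "\<dots> = ldet (map (\<lambda>j x. (1 - t) * ?F j x
        + (if j = 0 then 0 else (- t) * ?F (j - 1) x)) [0..<length ks]) ks"
    proof -
      have "?F j x - t * ?F j (x + 1) = (1 - t) * ?F j x + (if j = 0 then 0 else (- t) * ?F (j - 1) x)" for j x
      proof (cases j)
        case (Suc i)
        have "?F (Suc i) (x + 1) = ?F (Suc i) x + ?F i x"
          by (simp add: binom_col_Suc)
        then show ?thesis by (simp add: Suc algebra_simps del: fps_const_add)
      qed (simp add: algebra_simps)
      then show ?thesis by (simp add: prod_op_ldet comp_def)
    qed
    also have "\<dots> = (1 - t) ^ length ks * fps_const (vdet ks)"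
      unfolding vdet by (rule ldet_chain)
    finally show ?thesis .
  qed
  have "(\<lambda>l. fps_const (tri l)) = wop (\<lambda>l. fps_const (vdet l))"
    by (auto simp: tri_def fps_const_wop)
  then have "prod_op t (\<lambda>l. fps_const (tri l)) k = wop (prod_op t (\<lambda>l. fps_const (vdet l))) k"
    by (simp add: prod_op_wop)
  also have "\<dots> = wop (\<lambda>l. (1 - t) ^ length k * fps_const (vdet l)) k"
    by (rule wop_cong[OF refl]) (simp add: *)
  finally show ?thesis by (simp add: wop_scale fps_const_wop[symmetric] tri_def)
qed

section \<open>From operators on indexed arguments to operators on lists\<close>

fun multi_upd :: "('a \<Rightarrow> 'b) \<Rightarrow> 'a list \<Rightarrow> 'b list \<Rightarrow> 'a \<Rightarrow> 'b" where
  "multi_upd k (v # vs) (x # xs) = multi_upd (k(v := x)) vs xs"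
| "multi_upd k _ _ = k"

lemma multi_upd_notin: "w \<notin> set ws \<Longrightarrow> multi_upd k ws xs w = k w"
  by (induction k ws xs rule: multi_upd.induct) auto

lemma multi_upd_fun_upd:
  "w \<notin> set ws \<Longrightarrow> multi_upd (k(w := a)) ws xs = (multi_upd k ws xs)(w := a)"
  by (induction k ws xs rule: multi_upd.induct) (auto simp: fun_upd_twist)

lemma multi_upd_twice:
  "length xs = length ws \<Longrightarrow> length ys = length ws \<Longrightarrow> distinct ws \<Longrightarrow>
    multi_upd (multi_upd k ws xs) ws ys = multi_upd k ws ys"
proof (induction ws arbitrary: k xs ys)
  case (Cons w ws)
  then obtain a as b bs where xs: "xs = a # as" "ys = b # bs" by (metis length_Suc_conv)
  have w: "w \<notin> set ws" using Cons.prems by simp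
  have "multi_upd (multi_upd k ws as) ws bs = multi_upd k ws bs"
    using Cons xs by simp
  then show ?case
    unfolding xs multi_upd.simps(1) multi_upd_fun_upd[OF w] by (simp only: fun_upd_upd)
qed simp

lemma map_multi_upd: "length xs = length vs \<Longrightarrow> distinct vs \<Longrightarrow> map (multi_upd k vs xs) vs = xs"
proof (induction vs arbitrary: k xs)
  case (Cons w ws)
  then obtain a as where xs: "xs = a # as" by (metis length_Suc_conv)
  have w: "w \<notin> set ws" using Cons.prems by simp
  have "map (multi_upd (k(w := a)) ws as) ws = as" using Cons xs by simp
  moreover have "multi_upd (k(w := a)) ws as w = a" by (simp only: multi_upd_notin[OF w] fun_upd_same)
  ultimately show ?case by (simp only: xs list.map multi_upd.simps(1))
qed simp

fun pairs :: "'a list \<Rightarrow> ('a \<times> 'a) list" where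
  "pairs [] = []"
| "pairs (v # vs) = map (Pair v) vs @ pairs vs"

lemma foldr_op_pq_head:
  "p \<notin> set qs \<Longrightarrow> distinct qs \<Longrightarrow>
    foldr (\<lambda>(p, q) g. op_pq p q g) (map (Pair p) qs) F k
      = wop_head (\<lambda>x xs. F (multi_upd (k(p := x)) qs xs)) (k p) (map k qs)"
proof (induction qs arbitrary: k)
  case (Cons q qs)
  let ?T = "foldr (\<lambda>(p, q) g. op_pq p q g) (map (Pair p) qs) F"
  have T: "?T (k(p := a, q := b)) = wop_head (\<lambda>x xs. F (multi_upd (k(p := x, q := b)) qs xs)) a (map k qs)" for a b
  proof -
    have 1: "map (k(p := a, q := b)) qs = map k qs" using Cons.prems by auto
    have 2: "k(p := a, q := b, p := x) = k(p := x, q := b)" for x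
      using Cons.prems by (metis fun_upd_twist fun_upd_upd list.set_intros(1))
    have 3: "(k(p := a, q := b)) p = a" using Cons.prems by simp
    have "p \<notin> set qs" "distinct qs" using Cons.prems by auto
    from Cons.IH[OF this, of "k(p := a, q := b)"] show ?thesis
      unfolding 1 2 3 .
  qed
  have T1: "?T k = wop_head (\<lambda>x xs. F (multi_upd (k(p := x, q := k q)) qs xs)) (k p) (map k qs)"
    using T[of "k p" "k q"] by simp
  have "k(p := k p + 1) = k(p := k p + 1, q := k q)"
    using Cons.prems by (auto simp: fun_eq_iff)
  then have T2: "?T (k(p := k p + 1))
      = wop_head (\<lambda>x xs. F (multi_upd (k(p := x, q := k q)) qs xs)) (k p + 1) (map k qs)"
    using T[of "k p + 1" "k q"] by simp
  have "foldr (\<lambda>(p, q) g. op_pq p q g) (map (Pair p) (q # qs)) F k = op_pq p q ?T k"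
    by simp
  also have "\<dots> = ?T k - ?T (k(p := k p + 1)) + ?T (k(p := k p + 1, q := k q + 1))"
    by (rule op_pq_def)
  also have "\<dots> = wop_head (\<lambda>x xs. F (multi_upd (k(p := x)) (q # qs) xs)) (k p) (map k (q # qs))"
    unfolding T1 T2 T by (simp only: list.map wop_head.simps multi_upd.simps)
  finally show ?case .
qed simp

text \<open>\<open>pairs\<close> groups the index pairs by their first index, in the order of
  composition used by \<open>alpha\<close>; each group is one application of
  \<open>wop_head\<close>.\<close>

lemma foldr_op_pq_pairs:
  "distinct vs \<Longrightarrow>
    foldr (\<lambda>(p, q) g. op_pq p q g) (pairs vs) F k = wop (\<lambda>xs. F (multi_upd k vs xs)) (map k vs)"
proof (induction vs arbitrary: k)
  case (Cons v vs)
  let ?T = "foldr (\<lambda>(p, q) g. op_pq p q g) (pairs vs) F"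
  have "?T k' = wop (\<lambda>xs. F (multi_upd k' vs xs)) (map k' vs)" for k'
    using Cons by simp
  then have "foldr (\<lambda>(p, q) g. op_pq p q g) (pairs (v # vs)) F k
    = wop_head (\<lambda>x xs. ?T (multi_upd (k(v := x)) vs xs)) (k v) (map k vs)"
    using foldr_op_pq_head[of v vs ?T k] Cons.prems by simp
  also have "\<dots> = wop_head (\<lambda>x xs. wop (\<lambda>ys. F (multi_upd (k(v := x)) vs ys)) xs) (k v) (map k vs)"
  proof (intro wop_head_cong refl)
    fix x :: int and xs :: "int list"
    assume len: "length xs = length (map k vs)"
    have "?T (multi_upd (k(v := x)) vs xs)
        = wop (\<lambda>ys. F (multi_upd (multi_upd (k(v := x)) vs xs) vs ys)) xs"
      using Cons len by (simp add: map_multi_upd)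
    also have "\<dots> = wop (\<lambda>ys. F (multi_upd (k(v := x)) vs ys)) xs"
      by (rule wop_cong[OF refl]) (use len Cons.prems in \<open>simp add: multi_upd_twice\<close>)
    finally show "?T (multi_upd (k(v := x)) vs xs) = wop (\<lambda>ys. F (multi_upd (k(v := x)) vs ys)) xs" .
  qed
  finally show ?case by simp
qed simp

lemma pairs_upt: "pairs [a..<n] = concat (map (\<lambda>p. map (Pair p) [p + 1..<n]) [a..<n])"
  by (induction "n - a" arbitrary: a) (simp_all add: upt_conv_Cons)

lemma vandermonde_quot_vprod: "vandermonde_quot n k = vprod (map k [1..<n + 1])"
proof -
  have "(\<Prod>i\<in>{a..<n + 1}. \<Prod>j\<in>{i<..n}. of_int (k j - k i) / of_int (int j - int i)) = vprod (map k [a..<n + 1])"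
    if "a \<le> n + 1" for a
    using that
  proof (induction "n + 1 - a" arbitrary: a)
    case (Suc m)
    then have a: "a \<le> n" by simp
    have "(\<Prod>j\<in>{a<..n}. real_of_int (k j - k a) / of_int (int j - int a))
        = (\<Prod>j\<in>{a<..n}. of_int (k j - k a)) / (\<Prod>j\<in>{a<..n}. of_int (int j - int a))"
      by (rule prod_dividef)
    also have "(\<Prod>j\<in>{a<..n}. of_int (int j - int a)) = (fact (n - a) :: real)"
    proof -
      have "(\<Prod>j\<in>{a<..n}. real_of_int (int j - int a)) = (\<Prod>i\<in>{1..n - a}. real i)"
        by (rule prod.reindex_bij_witness[of _ "\<lambda>i. i + a" "\<lambda>j. j - a"]) auto
      then show ?thesis by (simp add: fact_prod)
    qed
    also have "(\<Prod>j\<in>{a<..n}. real_of_int (k j - k a)) = (\<Prod>y\<leftarrow>map k [a + 1..<n + 1]. real_of_int (y - k a))"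
    proof -
      have "set [a + 1..<n + 1] = {a<..n}" by auto
      then show ?thesis
        using prod.distinct_set_conv_list[of "[a + 1..<n + 1]" "\<lambda>j. real_of_int (k j - k a)"]
        by (simp only: distinct_upt map_map comp_def)
    qed
    finally have row: "(\<Prod>j\<in>{a<..n}. real_of_int (k j - k a) / of_int (int j - int a))
        = (\<Prod>y\<leftarrow>map k [a + 1..<n + 1]. real_of_int (y - k a)) / fact (n - a)" .
    let ?R = "\<lambda>i. \<Prod>j\<in>{i<..n}. real_of_int (k j - k i) / of_int (int j - int i)"
    have "(\<Prod>i\<in>{a..<n + 1}. ?R i) = ?R a * (\<Prod>i\<in>{a + 1..<n + 1}. ?R i)"
      using a by (subst prod.atLeast_Suc_lessThan) auto
    also have "(\<Prod>i\<in>{a + 1..<n + 1}. ?R i) = vprod (map k [a + 1..<n + 1])"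
      using Suc a by (intro Suc.hyps(1)) auto
    also have "?R a * vprod (map k [a + 1..<n + 1]) = vprod (map k (a # [a + 1..<n + 1]))"
      unfolding row by (simp del: upt_Suc)
    also have "a # [a + 1..<n + 1] = [a..<n + 1]" using a by (simp add: upt_conv_Cons)
    finally show ?case .
  qed simp
  from this[of 1] show ?thesis
    unfolding vandermonde_quot_def atLeastLessThanSuc_atLeastAtMost by (simp add: atLeastLessThanSuc_atLeastAtMost)
qed

lemma alpha_eq_tri: "alpha n k = tri (map k [1..<n + 1])"
proof -
  have "[(p, q). p \<leftarrow> [1..<n + 1], q \<leftarrow> [p + 1..<n + 1]] = pairs [1..<n + 1]"
    unfolding pairs_upt by simp
  then have "alpha n k = wop (\<lambda>xs. vandermonde_quot n (multi_upd k [1..<n + 1] xs)) (map k [1..<n + 1])"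
    unfolding alpha_def by (simp only: foldr_op_pq_pairs distinct_upt)
  also have "\<dots> = tri (map k [1..<n + 1])"
    unfolding tri_def
    by (rule wop_cong[OF refl])
      (simp only: vandermonde_quot_vprod map_multi_upd length_map distinct_upt vdet_vprod)
  finally show ?thesis .
qed

section \<open>Interlacing sums\<close>

text \<open>For strictly increasing \<open>k\<close> these are the strictly increasing l with k_1 <=
  l_1 <= k_2 <= l_2 <= ... The choice l_1 = b raises the lower bound of the next entry to b + 1,
  which rules out a repetition.\<close>

fun interl :: "int list \<Rightarrow> int list set" where
  "interl [] = {}"
| "interl [a] = {[]}"
| "interl (a # b # r) = (\<Union>l\<in>{a..<b}. (#) l ` interl (b # r)) \<union> (#) b ` interl ((b + 1) # r)"

lemma finite_interl: "finite (interl k)"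
  by (induction k rule: interl.induct) auto

lemma length_interl: "l \<in> interl k \<Longrightarrow> Suc (length l) = length k"
  by (induction k arbitrary: l rule: interl.induct) auto

lemma sum_interl:
  fixes f :: "int list \<Rightarrow> 'a::comm_ring_1"
  shows "sum f (interl (a # b # r)) =
     (\<Sum>l\<in>{a..<b}. \<Sum>ys\<in>interl (b # r). f (l # ys)) + (\<Sum>ys\<in>interl ((b + 1) # r). f (b # ys))"
proof -
  have "sum f (interl (a # b # r)) =
     sum f (\<Union>l\<in>{a..<b}. (#) l ` interl (b # r)) + sum f ((#) b ` interl ((b + 1) # r))"
    unfolding interl.simps by (rule sum.union_disjoint) (auto simp: finite_interl)
  also have "sum f (\<Union>l\<in>{a..<b}. (#) l ` interl (b # r)) = (\<Sum>l\<in>{a..<b}. sum f ((#) l ` interl (b # r)))"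
    by (rule sum.UNION_disjoint) (auto simp: finite_interl)
  also have "sum f ((#) l ` interl ks) = (\<Sum>ys\<in>interl ks. f (l # ys))" for l ks
    by (simp add: sum.reindex inj_on_def)
  finally show ?thesis by (simp add: sum.reindex inj_on_def)
qed

lemma sum_telescope_int:
  fixes F :: "int \<Rightarrow> 'a::comm_ring_1"
  shows "a \<le> b \<Longrightarrow> (\<Sum>l\<in>{a..<b}. F (l + 1) - F l) = F b - F a"
proof (induction b rule: int_ge_induct)
  case (step b)
  have "{a..<b + 1} = insert b {a..<b}" using step by auto
  then show ?case using step by simp
qed simp

text \<open>The sum over l in [a, b) telescopes, and the separate choice l = b contributes the
  difference from b to b + 1. What is left over are terms beginning with (b, b+1), (b, b) and (b+1,
  b+1), which cancel by adjacent additivity. The bound a <= hd r is weak because the choice l = b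
  continues from b + 1, which may equal the next entry.\<close>

lemma sum_interl_diff_all:
  fixes h :: "int list \<Rightarrow> 'a::comm_ring_1"
  shows "adjacent_additive h \<Longrightarrow> sorted_wrt (<) r \<Longrightarrow> (r \<noteq> [] \<Longrightarrow> a \<le> hd r) \<Longrightarrow>
    sum (diff_all h) (interl (a # r)) = del_shift_sum h (a # r)"
proof (induction r arbitrary: a h)
  case (Cons b r)
  let ?S = "map (\<lambda>v. v + 1) r"
  have adj: "adjacent_additive (\<lambda>l. h (x # l))" for x
    by (rule adjacent_additive_Cons[OF Cons.prems(1)])
  have IH: "sum (diff_all (\<lambda>l. h (x # l))) (interl (c # r)) = del_shift_sum (\<lambda>l. h (x # l)) (c # r)"
    if "c \<le> b + 1" for x c
  proof (rule Cons.IH[OF adj])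
    show "sorted_wrt (<) r" using Cons.prems(2) by simp
    show "c \<le> hd r" if "r \<noteq> []" using that Cons.prems(2) \<open>c \<le> b + 1\<close> by (cases r) auto
  qed
  have "sum (diff_all h) (interl (a # b # r))
      = (\<Sum>l\<in>{a..<b}. del_shift_sum (\<lambda>ys. h ((l + 1) # ys)) (b # r) - del_shift_sum (\<lambda>ys. h (l # ys)) (b # r))
        + (del_shift_sum (\<lambda>ys. h ((b + 1) # ys)) ((b + 1) # r) - del_shift_sum (\<lambda>ys. h (b # ys)) ((b + 1) # r))"
    unfolding sum_interl diff_all.simps sum_subtractf by (simp only: IH)
  also have "(\<Sum>l\<in>{a..<b}. del_shift_sum (\<lambda>ys. h ((l + 1) # ys)) (b # r) - del_shift_sum (\<lambda>ys. h (l # ys)) (b # r))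
      = del_shift_sum (\<lambda>ys. h (b # ys)) (b # r) - del_shift_sum (\<lambda>ys. h (a # ys)) (b # r)"
    by (rule sum_telescope_int) (use Cons.prems(3) in simp)
  also have "del_shift_sum (\<lambda>l. h (b # (b + 1) # l)) r
      = del_shift_sum (\<lambda>l. h (b # b # l)) r + del_shift_sum (\<lambda>l. h ((b + 1) # (b + 1) # l)) r"
    unfolding del_shift_sum_add[symmetric]
    using adjacent_additiveD[OF Cons.prems(1), of "[]" b] by simp
  ultimately show ?case by simp
qed simp

lemma tri_sum_interl:
  assumes "sorted_wrt (<) k" "k \<noteq> []"
  shows "tri k = sum tri (interl k)"
proof -
  obtain a r where k: "k = a # r" using assms by (cases k) auto
  have "sum (diff_all tri_sum) (interl (a # r)) = del_shift_sum tri_sum (a # r)"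
    by (rule sum_interl_diff_all[OF adjacent_additive_tri_sum])
      (use assms k in \<open>auto intro: less_imp_le\<close>)
  then show ?thesis using k by (simp add: diff_all_tri_sum[abs_def] tri_eq_del_shift_sum)
qed

text \<open>The mixed difference in the two outermost arguments only sees the interlacing of the
  middle ones, so the outer arguments need not be ordered.\<close>

lemma tri_mixed_difference:
  assumes "sorted_wrt (<) mid" "mid \<noteq> []"
  shows "tri (x # mid @ [z]) - tri ((x + 1) # mid @ [z])
       - (tri (x # mid @ [z - 1]) - tri ((x + 1) # mid @ [z - 1]))
     = (\<Sum>l\<in>interl mid. tri (x # l @ [z]))"
proof -
  \<comment> \<open>With the outer differences built into \<open>h\<close>, differencing in all
    middle arguments as well recovers \<open>tri\<close> from \<open>tri_sum\<close>.\<close>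
  define h where "h l = (tri_sum ((x + 1) # l @ [z + 1]) - tri_sum (x # l @ [z + 1]))
    - (tri_sum ((x + 1) # l @ [z]) - tri_sum (x # l @ [z]))" for l
  obtain a r where mid: "mid = a # r" using assms by (cases mid) auto
  have adj: "adjacent_additive (\<lambda>l. tri_sum (u # l @ [w]))" for u w
    using adjacent_additive_snoc[OF adjacent_additive_Cons[OF adjacent_additive_tri_sum]] .
  have "adjacent_additive h"
    unfolding h_def by (intro adjacent_additive_diff adj)
  then have "sum (diff_all h) (interl mid) = del_shift_sum h mid"
    unfolding mid by (rule sum_interl_diff_all) (use assms mid in \<open>auto intro: less_imp_le\<close>)
  moreover have "diff_all h l = tri (x # l @ [z])" for l
    unfolding h_def diff_all_diff diff_all_tri_sum[symmetric] diff_all.simps diff_all_snoc by simp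
  \<comment> \<open>Deleting the left end leaves a term free of u, deleting the right end one free
    of w; both cancel in the mixed difference. In all other terms w has become w + 1, so z and z - 1
    in the claim match z + 1 and z in \<open>h\<close>.\<close>
  moreover have "tri (u # mid @ [w]) = tri_sum (map (\<lambda>v. v + 1) (mid @ [w]))
      - (del_shift_sum (\<lambda>l. tri_sum (u # l @ [w + 1])) mid + (- 1) ^ length mid * tri_sum (u # mid))" for u w
    by (simp add: tri_eq_del_shift_sum del_shift_sum_snoc)
  ultimately show ?thesis
    unfolding h_def del_shift_sum_diff by simp
qed

text \<open>Raising the last entry from c to z adds only the sequences whose last entry lies in (c,
  z], and such an entry exceeds everything that can stand before it.\<close>

lemma sum_interl_snoc:
  fixes f :: "int list \<Rightarrow> 'a::comm_ring_1"
  assumes "\<And>u. u \<in> set us \<Longrightarrow> u < c" "a \<le> c" "c \<le> z"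
  shows "sum f (interl (a # us @ [z])) = sum f (interl (a # us @ [c]))
    + (\<Sum>l\<in>{c<..z}. \<Sum>ys\<in>interl (a # us). f (ys @ [l]))"
  using assms
proof (induction us arbitrary: a f)
  case Nil
  have "{a..<z} \<union> {z} = ({a..<c} \<union> {c}) \<union> {c<..z}" using Nil by auto
  moreover have "sum g ({a..<z} \<union> {z}) = sum g {a..<z} + g z" "sum g ({a..<c} \<union> {c}) = sum g {a..<c} + g c"
    "sum g (({a..<c} \<union> {c}) \<union> {c<..z}) = sum g ({a..<c} \<union> {c}) + sum g {c<..z}" for g :: "int \<Rightarrow> 'a"
    by (subst sum.union_disjoint; auto)+
  ultimately have "sum g {a..<z} + g z = sum g {a..<c} + g c + sum g {c<..z}" for g :: "int \<Rightarrow> 'a"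
    by metis
  then show ?case by (simp add: sum_interl del: interl.simps(3))
next
  case (Cons e us)
  have IH: "sum f (interl (a' # us @ [z])) = sum f (interl (a' # us @ [c]))
    + (\<Sum>l\<in>{c<..z}. \<Sum>ys\<in>interl (a' # us). f (ys @ [l]))" if "a' \<le> c" for a' and f :: "int list \<Rightarrow> 'a"
    using Cons.prems that by (intro Cons.IH) auto
  have le: "e \<le> c" "e + 1 \<le> c" using Cons.prems(1)[of e] by auto
  have swap: "(\<Sum>l\<in>{a..<e}. \<Sum>w\<in>{c<..z}. \<Sum>ys\<in>interl (e # us). f (l # ys @ [w]))
    = (\<Sum>w\<in>{c<..z}. \<Sum>l\<in>{a..<e}. \<Sum>ys\<in>interl (e # us). f (l # ys @ [w]))"
    by (rule sum.swap)
  show ?case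
    unfolding append_Cons sum_interl IH[OF le(1)] IH[OF le(2)] sum.distrib swap
    by (simp add: algebra_simps)
qed

section \<open>Blocks of consecutive arguments\<close>

definition blk :: "int \<Rightarrow> nat \<Rightarrow> int list" where
  "blk a m = map (\<lambda>i. a + int i) [0..<m]"

text \<open>The lists summed over are the sequences interlacing a block of m consecutive integers:
  the block with one entry omitted.\<close>

definition gap_sum :: "(int list \<Rightarrow> 'a::comm_ring_1) \<Rightarrow> int \<Rightarrow> nat \<Rightarrow> 'a" where
  "gap_sum f a m = (\<Sum>j<m. f (blk a j @ blk (a + int j + 1) (m - 1 - j)))"

lemma length_blk [simp]: "length (blk a m) = m"
  by (simp add: blk_def)

lemma blk_0 [simp]: "blk a 0 = []"
  by (simp add: blk_def)

lemma blk_snoc: "blk a (Suc m) = blk a m @ [a + int m]"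
  by (simp add: blk_def)

lemma blk_Cons: "blk a (Suc m) = a # blk (a + 1) m"
proof -
  have "[0..<Suc m] = 0 # map Suc [0..<m]"
    by (simp add: upt_conv_Cons map_Suc_upt del: upt_Suc)
  then show ?thesis by (simp add: blk_def comp_def algebra_simps del: upt_Suc)
qed

lemma set_blk: "set (blk a m) = {a..<a + int m}"
proof -
  have "x \<in> (\<lambda>i. a + int i) ` {0..<m}" if "a \<le> x" "x < a + int m" for x
    using that by (intro image_eqI[of _ _ "nat (x - a)"]) auto
  then show ?thesis by (auto simp: blk_def)
qed

lemma sorted_blk: "sorted_wrt (<) (blk a m)"
  by (simp add: blk_def sorted_wrt_map)

lemma gap_sum_0 [simp]: "gap_sum f a 0 = 0"
  by (simp add: gap_sum_def)

lemma gap_blk_snoc: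
  "j \<le> m \<Longrightarrow> blk a j @ blk (a + int j + 1) (Suc m - j) = (blk a j @ blk (a + int j + 1) (m - j)) @ [a + int m + 1]"
  by (simp add: Suc_diff_le blk_snoc)

lemma gap_sum_snoc:
  "gap_sum f a (Suc m) = gap_sum (\<lambda>l. f (l @ [a + int m])) a m + f (blk a m)"
proof -
  have "f (blk a j @ blk (a + int j + 1) (m - j))
      = f ((blk a j @ blk (a + int j + 1) (m - 1 - j)) @ [a + int m])" if "j < m" for j
  proof -
    have "m - j = Suc (m - 1 - j)" using that by simp
    then show ?thesis using that by (simp add: blk_snoc)
  qed
  then show ?thesis by (simp add: gap_sum_def)
qed

lemma gap_sum_Cons:
  "gap_sum f a (Suc m) = f (blk (a + 1) m) + gap_sum (\<lambda>l. f (a # l)) (a + 1) m"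
  unfolding gap_sum_def by (subst sum.lessThan_Suc_shift) (simp add: blk_Cons algebra_simps)

lemma gap_sum_add: "gap_sum (\<lambda>l. f l + g l) a m = gap_sum f a m + gap_sum g a m"
  by (simp add: gap_sum_def sum.distrib)

lemma gap_sum_diff: "gap_sum (\<lambda>l. f l - g l) a m = gap_sum f a m - gap_sum g a m"
  by (simp add: gap_sum_def sum_subtractf)

lemma gap_sum_scale: "gap_sum (\<lambda>l. c * f l) a m = c * gap_sum f a m"
  by (simp add: gap_sum_def sum_distrib_left)

lemma gap_sum_cong: "(\<And>l. Suc (length l) = m \<Longrightarrow> f l = g l) \<Longrightarrow> gap_sum f a m = gap_sum g a m"
  by (simp add: gap_sum_def)

lemma gap_sum_fps_const: "gap_sum (\<lambda>l. fps_const (f l)) a m = fps_const (gap_sum f a m)"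
  by (rule fps_ext) (simp add: gap_sum_def fps_sum_nth)

lemma interl_blk_forced: "interl (c # blk c m) = {blk c m}"
  by (induction m arbitrary: c) (simp_all add: blk_Cons)

lemma sum_interl_blk:
  fixes f :: "int list \<Rightarrow> 'a::comm_ring_1"
  shows "sum f (interl (blk a (Suc m))) = gap_sum f a (Suc m)"
proof (induction m arbitrary: a f)
  case 0
  show ?case by (simp add: blk_Cons gap_sum_def)
next
  case (Suc m)
  have "sum f (interl (blk a (Suc (Suc m))))
      = (\<Sum>l\<in>{a..<a + 1}. \<Sum>ys\<in>interl (blk (a + 1) (Suc m)). f (l # ys))
        + (\<Sum>ys\<in>interl ((a + 1 + 1) # blk (a + 1 + 1) m). f ((a + 1) # ys))"
    unfolding blk_Cons[of a] blk_Cons[of "a + 1"] sum_interl ..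
  also have "{a..<a + 1} = {a}" by auto
  also have "(\<Sum>l\<in>{a}. \<Sum>ys\<in>interl (blk (a + 1) (Suc m)). f (l # ys))
      = gap_sum (\<lambda>l. f (a # l)) (a + 1) (Suc m)"
    by (simp add: Suc.IH)
  finally show ?case
    unfolding interl_blk_forced gap_sum_Cons[of f a "Suc m"] blk_Cons[of "a + 1" m]
    by (simp del: append_Cons)
qed

text \<open>An interlacing sequence either is the whole block, or it ends in some w >= a + m and
  omits exactly one entry of the block.\<close>

lemma sum_interl_blk_snoc:
  fixes f :: "int list \<Rightarrow> 'a::comm_ring_1"
  shows "sum f (interl (blk a m @ [a + int m + int r]))
    = f (blk a m) + (\<Sum>w\<in>{a + int m..a + int m + int r}. gap_sum (\<lambda>l. f (l @ [w])) a m)"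
proof (cases m)
  case 0
  then show ?thesis by simp
next
  case (Suc k)
  let ?c = "a + int m"
  have "sum f (interl (a # blk (a + 1) k @ [?c + int r])) = sum f (interl (a # blk (a + 1) k @ [?c]))
    + (\<Sum>l\<in>{?c<..?c + int r}. \<Sum>ys\<in>interl (a # blk (a + 1) k). f (ys @ [l]))"
    by (rule sum_interl_snoc) (auto simp: set_blk Suc)
  moreover have "sum f (interl (a # blk (a + 1) k @ [?c])) = gap_sum (\<lambda>l. f (l @ [?c])) a m + f (blk a m)"
    using sum_interl_blk[of f a m] gap_sum_snoc[of f a m] unfolding Suc blk_Cons[symmetric]
    by (simp add: blk_snoc[of a "Suc k"] blk_Cons[symmetric] del: append_Cons flip: append_Cons)
  moreover have "(\<Sum>ys\<in>interl (a # blk (a + 1) k). g ys) = gap_sum g a m" for g :: "int list \<Rightarrow> 'a"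
    using sum_interl_blk[of g a k] unfolding Suc blk_Cons .
  moreover have "{?c..?c + int r} = insert ?c {?c<..?c + int r}" by auto
  ultimately show ?thesis
    unfolding Suc blk_Cons append_Cons by (simp add: algebra_simps)
qed

text \<open>Induction from the right end, with c = a + m. The shift of the last block entry cancels
  against the gap term in which this entry is absent. Since triples vanish, the tail c, c+1, c+1 may
  be replaced by c, c, c+1, and the smaller instance with c + 1 appended applies.\<close>

lemma prod_op_blk_collapse:
  assumes "adjacent_additive A" "\<And>us l vs. A (us @ l # l # l # vs) = 0"
  shows "prod_op t (\<lambda>l. A (l @ [a + int m])) (blk a m)
    + t * gap_sum (prod_op t (\<lambda>l. A (l @ [a + int m, a + int m]))) a m = A (blk a (Suc m))"
  using assms
proof (induction m arbitrary: A)
  case 0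
  show ?case by (simp add: blk_Cons)
next
  case (Suc m)
  define c where "c = a + int m"
  have c': "a + int (Suc m) = c + 1" by (simp add: c_def)
  have "prod_op t (\<lambda>l. A (l @ [c, c + 1, c + 1])) l = prod_op t (\<lambda>l. A (l @ [c, c, c + 1])) l" for l
  proof -
    have "A (us @ [c, c + 1, c + 1]) = A (us @ [c, c, c + 1])" for us
      using adjacent_additiveD[OF Suc.prems(1), of us c "[c + 1]"] Suc.prems(2)[of us "c + 1" "[]"] by simp
    then show ?thesis by simp
  qed
  moreover have "prod_op t (\<lambda>l. A (l @ [c + 1, c + 1, c + 1])) l = 0" for l
    using Suc.prems(2)[of _ "c + 1" "[]"] by (simp add: prod_op_zero)
  moreover have "prod_op t (\<lambda>l. (\<lambda>l. A (l @ [c + 1])) (l @ [a + int m])) (blk a m)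
    + t * gap_sum (prod_op t (\<lambda>l. (\<lambda>l. A (l @ [c + 1])) (l @ [a + int m, a + int m]))) a m
    = (\<lambda>l. A (l @ [c + 1])) (blk a (Suc m))"
    by (rule Suc.IH) (use adjacent_additive_snoc[OF Suc.prems(1)] Suc.prems(2) in auto)
  ultimately show ?case
    unfolding c' gap_sum_snoc blk_snoc c_def[symmetric] prod_op_snoc
    by (simp add: c_def[symmetric] algebra_simps)
qed

text \<open>Expresses the generating function of the interlacing sums over a block with a free last
  entry by the values on a block with one gap.\<close>

lemma prod_op_blk_gap:
  assumes "adjacent_additive A" "\<And>us l vs. A (us @ l # l # l # vs) = 0"
  shows "prod_op t A (blk a m) + gap_sum (prod_op t (\<lambda>l. A (l @ [a + int m]))) a m
    = (\<Sum>j\<le>m. (1 - t) ^ (m - j) * A (blk a j @ blk (a + int j + 1) (m - j)))"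
  using assms
proof (induction m arbitrary: A)
  case 0
  show ?case by simp
next
  case (Suc m)
  define c where "c = a + int m"
  have c': "a + int (Suc m) = c + 1" by (simp add: c_def)
  define P where "P ws = prod_op t (\<lambda>l. A (l @ ws)) (blk a m)" for ws
  define Y where "Y ws = gap_sum (prod_op t (\<lambda>l. A (l @ ws))) a m" for ws
  define Z where "Z = (\<Sum>j\<le>m. (1 - t) ^ (m - j) * A ((blk a j @ blk (a + int j + 1) (m - j)) @ [c + 1]))"
  have IH: "P [c + 1] + Y [c, c + 1] = Z"
    using Suc.IH[OF adjacent_additive_snoc[OF Suc.prems(1)], of "c + 1"] Suc.prems(2)
    by (simp add: P_def Y_def Z_def c_def)
  have collapse: "P [c] + t * Y [c, c] = A (blk a (Suc m))"
    using prod_op_blk_collapse[OF Suc.prems, of t a m] by (simp add: P_def Y_def c_def)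
  have Y: "Y [c, c + 1] = Y [c, c] + Y [c + 1, c + 1]"
    unfolding Y_def gap_sum_add[symmetric] prod_op_add[symmetric]
    using adjacent_additiveD[OF Suc.prems(1), of _ c "[]"] by simp
  have gap: "(1 - t) ^ (Suc m - j) * A (blk a j @ blk (a + int j + 1) (Suc m - j))
      = (1 - t) * ((1 - t) ^ (m - j) * A ((blk a j @ blk (a + int j + 1) (m - j)) @ [c + 1]))"
    if "j \<le> m" for j
    unfolding gap_blk_snoc[OF that] using that by (simp add: Suc_diff_le c_def mult.assoc)
  have "(\<Sum>j\<le>Suc m. (1 - t) ^ (Suc m - j) * A (blk a j @ blk (a + int j + 1) (Suc m - j)))
      = (\<Sum>j\<le>m. (1 - t) * ((1 - t) ^ (m - j) * A ((blk a j @ blk (a + int j + 1) (m - j)) @ [c + 1])))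
        + A (blk a (Suc m))"
    unfolding sum.atMost_Suc
    by (intro arg_cong2[where f = "(+)"] sum.cong refl gap) auto
  also have "\<dots> = (1 - t) * Z + A (blk a (Suc m))"
    by (simp add: Z_def sum_distrib_left)
  finally have rhs: "(\<Sum>j\<le>Suc m. (1 - t) ^ (Suc m - j) * A (blk a j @ blk (a + int j + 1) (Suc m - j)))
      = (1 - t) * Z + A (blk a (Suc m))" .
  have "prod_op t A (blk a (Suc m)) = P [c] - t * P [c + 1]"
    by (simp add: blk_snoc prod_op_snoc P_def c_def)
  moreover have "gap_sum (prod_op t (\<lambda>l. A (l @ [c + 1]))) a (Suc m) = Y [c, c + 1] - t * Y [c + 1, c + 1] + P [c + 1]"
    by (simp add: gap_sum_snoc prod_op_snoc Y_def P_def c_def gap_sum_diff gap_sum_scale)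
  ultimately show ?case
    unfolding rhs c' IH[symmetric] collapse[symmetric] Y by (simp add: algebra_simps)
qed

section \<open>The interlacing sums in terms of blocks with a gap\<close>

text \<open>Backward differencing in w lowers the index s, and the values at w = 1, 2, ... are the
  coefficients of (1 - X)^(-s-1).\<close>

definition beta :: "nat \<Rightarrow> int \<Rightarrow> real" where
  "beta s w = (of_int w + of_nat s - 1) gchoose s"

lemma beta_0 [simp]: "beta 0 w = 1"
  by (simp add: beta_def)

lemma beta_Suc: "beta (Suc s) w = beta (Suc s) (w - 1) + beta s w"
  using gbinomial_Suc_Suc[of "real_of_int w + real s - 1" s] by (simp add: beta_def algebra_simps)

lemma beta_Suc_0 [simp]: "beta (Suc s) 0 = 0"
proof -
  have "(real s gchoose Suc s) = of_nat (s choose Suc s)"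
    by (simp only: binomial_gbinomial)
  then show ?thesis by (simp add: beta_def)
qed

lemma beta_minus_1: "beta (Suc (Suc s)) (- 1) = 0"
  using beta_Suc[of "Suc s" 0] by simp

lemma beta_1: "beta s 1 = 1"
  using beta_Suc[of "s - 1" 1] by (induction s) (simp_all add: beta_Suc[of _ 1])

definition beta_fps :: "nat \<Rightarrow> real fps" where
  "beta_fps s = Abs_fps (\<lambda>r. beta s (int r + 1))"

lemma fps_one_minus_X_mult_nth:
  "((1 - fps_X) * (f :: real fps)) $ r = (if r = 0 then f $ 0 else f $ r - f $ (r - 1))"
  by (cases r) (simp_all add: left_diff_distrib)

lemma beta_fps_power: "(1 - fps_X) ^ Suc s * beta_fps s = 1"
proof (induction s)
  case 0
  show ?case
    by (rule fps_ext) (simp add: fps_one_minus_X_mult_nth beta_fps_def)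
next
  case (Suc s)
  have "(1 - fps_X) * beta_fps (Suc s) = beta_fps s"
  proof (rule fps_ext)
    fix r
    show "((1 - fps_X) * beta_fps (Suc s)) $ r = beta_fps s $ r"
      using beta_Suc[of s "int r + 1"]
      by (cases r) (simp_all add: fps_one_minus_X_mult_nth beta_fps_def beta_1 algebra_simps)
  qed
  then show ?case using Suc by (simp add: mult.assoc mult.left_commute power_Suc2 del: power_Suc)
qed

text \<open>The generating function over r is multiplied by (1 - X)^(m+3). One factor undoes the
  summation over the last entry. The other m + 2 are realised by the operators id - X E on x, z and
  the m middle arguments, which together act on \<open>tri\<close> as (1 - X)^(m+2); the outcome is
  evaluated by \<open>prod_op_blk_gap\<close>.\<close>

lemma interl_sum_formula:
  fixes x z a :: int and m r :: nat
  defines "Q \<equiv> \<lambda>j x z. tri (x # blk a j @ blk (a + int j + 1) (m - j) @ [z])"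
  shows "(\<Sum>l\<in>interl (blk a m @ [a + int m + int r]). tri (x # l @ [z]))
    = (\<Sum>j\<le>m. beta (j + 2) (int r + 1) * Q j x z
        - beta (j + 2) (int r) * (Q j (x + 1) z + Q j x (z + 1))
        + beta (j + 2) (int r - 1) * Q j (x + 1) (z + 1))"
proof -
  let ?X = "fps_X :: real fps"
  define A0 where "A0 x z l = fps_const (tri (x # l @ [z]))" for x z l
  \<comment> \<open>The factors id - X E for x and z are built into \<open>A\<close>, so that
    \<open>prod_op\<close> over the middle arguments completes the symmetric product.\<close>
  define A where "A l = A0 x z l - ?X * A0 x (z + 1) l - ?X * (A0 (x + 1) z l - ?X * A0 (x + 1) (z + 1) l)" for l
  have adj_const: "adjacent_additive (\<lambda>l. fps_const (tri l))"
    using adjacent_additive_tri unfolding adjacent_additive_def by simp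
  have adj0: "adjacent_additive (A0 x z)" for x z
    unfolding A0_def[abs_def] using adjacent_additive_snoc[OF adjacent_additive_Cons[OF adj_const]] .
  have adj: "adjacent_additive A"
    unfolding A_def[abs_def] by (intro adjacent_additive_diff adjacent_additive_scale adj0)
  have trip: "A (us @ l # l # l # vs) = 0" for us l vs
    using tri_triple[of "_ # us" l "vs @ [_]"] by (simp add: A_def A0_def)
  have full: "prod_op ?X A l = (1 - ?X) ^ (length l + 2) * A0 x z l" for l
    using prod_op_tri[of ?X "x # l @ [z]"]
    by (simp add: prod_op_snoc A_def[abs_def] A0_def prod_op_diff prod_op_scale)
  define g where "g w = gap_sum (\<lambda>l. tri (x # l @ [w, z])) a m" for w
  define F where "F w = Abs_fps (\<lambda>r. g (w + int r))" for w
  \<comment> \<open>In \<open>K w\<close> the operator for the last middle argument w is missing.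
    Supplying it gives \<open>K_step\<close>, a recursion in w that determines \<open>K w\<close> as
    a multiple of the generating function \<open>F w\<close>.\<close>
  define K where "K w = gap_sum (prod_op ?X (\<lambda>l. A (l @ [w]))) a m" for w
  have K_step: "K w = ?X * K (w + 1) + (1 - ?X) ^ (m + 2) * fps_const (g w)" for w
  proof -
    have "K w - ?X * K (w + 1) = gap_sum (\<lambda>l. prod_op ?X A (l @ [w])) a m"
      by (simp add: K_def prod_op_snoc gap_sum_diff gap_sum_scale)
    also have "\<dots> = gap_sum (\<lambda>l. (1 - ?X) ^ (m + 2) * fps_const (tri (x # l @ [w, z]))) a m"
      by (rule gap_sum_cong) (auto simp: full A0_def)
    also have "\<dots> = (1 - ?X) ^ (m + 2) * fps_const (g w)"
      unfolding gap_sum_scale g_def gap_sum_fps_const ..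
    finally show ?thesis by (simp add: algebra_simps)
  qed
  have F_step: "F w = fps_const (g w) + ?X * F (w + 1)" for w
    by (rule fps_ext) (auto simp: F_def of_nat_diff)
  define D where "D w = K w - (1 - ?X) ^ (m + 2) * F w" for w
  have D_step: "D w = ?X * D (w + 1)" for w
    unfolding D_def by (subst K_step, subst F_step) (simp add: algebra_simps)
  \<comment> \<open>Iterating \<open>D_step\<close> makes \<open>D w\<close> divisible by every
    power of X.\<close>
  have "D w $ r = 0" for w r
    by (induction r arbitrary: w) (subst D_step, simp)+
  then have "D w = 0" for w by (simp add: fps_eq_iff)
  then have K: "K w = (1 - ?X) ^ (m + 2) * F w" for w by (simp add: D_def)
  define U where "U r = (\<Sum>l\<in>interl (blk a m @ [a + int m + int r]). tri (x # l @ [z]))" for r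
  have U: "U r = tri (x # blk a m @ [z]) + (\<Sum>w\<in>{a + int m..a + int m + int r}. g w)" for r
    unfolding U_def sum_interl_blk_snoc[where f = "\<lambda>l. tri (x # l @ [z])"] g_def by simp
  have step: "(1 - ?X) * Abs_fps U = A0 x z (blk a m) + F (a + int m)"
  proof (rule fps_ext)
    fix r
    show "((1 - ?X) * Abs_fps U) $ r = (A0 x z (blk a m) + F (a + int m)) $ r"
    proof (cases r)
      case 0
      then show ?thesis by (simp add: fps_one_minus_X_mult_nth U A0_def F_def)
    next
      case (Suc s)
      have "{a + int m..a + int m + int (Suc s)} = insert (a + int m + int (Suc s)) {a + int m..a + int m + int s}"
        by auto
      then have "U (Suc s) = U s + g (a + int m + int (Suc s))"
        unfolding U by simp
      then show ?thesis by (simp add: Suc fps_one_minus_X_mult_nth A0_def F_def)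
    qed
  qed
  have "(1 - ?X) ^ (m + 3) = (1 - ?X) ^ (m + 2) * (1 - ?X)"
    by (simp add: numeral_3_eq_3)
  then have "(1 - ?X) ^ (m + 3) * Abs_fps U = (1 - ?X) ^ (m + 2) * (A0 x z (blk a m) + F (a + int m))"
    by (simp only: mult.assoc step)
  also have "\<dots> = prod_op ?X A (blk a m) + K (a + int m)"
    by (simp add: full K algebra_simps)
  also have "\<dots> = (\<Sum>j\<le>m. (1 - ?X) ^ (m - j) * A (blk a j @ blk (a + int j + 1) (m - j)))"
    unfolding K_def by (rule prod_op_blk_gap[OF adj trip])
  also have "\<dots> = (\<Sum>j\<le>m. (1 - ?X) ^ (m + 3) * (beta_fps (j + 2) * A (blk a j @ blk (a + int j + 1) (m - j))))"
  proof (rule sum.cong[OF refl])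
    fix j assume "j \<in> {..m}"
    \<comment> \<open>Dividing (1 - X)^(m-j) by (1 - X)^(m+3) leaves the exponent -(j+3), which is
      \<open>beta_fps\<close> of index j + 2.\<close>
    then have "m + 3 = (m - j) + Suc (j + 2)" by simp
    then have "(1 - ?X) ^ (m + 3) * beta_fps (j + 2) = (1 - ?X) ^ (m - j)"
      by (simp only: power_add mult.assoc beta_fps_power) simp
    then show "(1 - ?X) ^ (m - j) * A (blk a j @ blk (a + int j + 1) (m - j))
      = (1 - ?X) ^ (m + 3) * (beta_fps (j + 2) * A (blk a j @ blk (a + int j + 1) (m - j)))"
      by (simp only: mult.assoc[symmetric])
  qed
  finally have "(1 - ?X) ^ (m + 3) * Abs_fps U
    = (1 - ?X) ^ (m + 3) * (\<Sum>j\<le>m. beta_fps (j + 2) * A (blk a j @ blk (a + int j + 1) (m - j)))"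
    by (simp only: sum_distrib_left)
  moreover have "(1 - ?X) ^ (m + 3) \<noteq> 0"
  proof -
    have "(1 - ?X) $ 0 \<noteq> 0" by simp
    then have "1 - ?X \<noteq> 0" by (metis fps_zero_nth)
    then show ?thesis by simp
  qed
  ultimately have Ueq: "Abs_fps U = (\<Sum>j\<le>m. beta_fps (j + 2) * A (blk a j @ blk (a + int j + 1) (m - j)))"
    by simp
  have "U r = (\<Sum>j\<le>m. (beta_fps (j + 2) * A (blk a j @ blk (a + int j + 1) (m - j))) $ r)"
    using arg_cong[OF Ueq, of "\<lambda>f. f $ r"] by (simp add: fps_sum_nth)
  also have "\<dots> = (\<Sum>j\<le>m. beta (j + 2) (int r + 1) * Q j x z
        - beta (j + 2) (int r) * (Q j (x + 1) z + Q j x (z + 1))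
        + beta (j + 2) (int r - 1) * Q j (x + 1) (z + 1))"
  proof (rule sum.cong[OF refl])
    fix j
    have A: "A (blk a j @ blk (a + int j + 1) (m - j))
      = fps_const (Q j x z) - ?X * fps_const (Q j x (z + 1) + Q j (x + 1) z)
        + ?X * (?X * fps_const (Q j (x + 1) (z + 1)))"
      by (simp add: A_def A0_def Q_def algebra_simps flip: fps_const_add)
    have prod: "beta_fps (j + 2) * A (blk a j @ blk (a + int j + 1) (m - j))
      = fps_const (Q j x z) * beta_fps (j + 2)
        - fps_const (Q j x (z + 1) + Q j (x + 1) z) * (?X * beta_fps (j + 2))
        + fps_const (Q j (x + 1) (z + 1)) * (?X * (?X * beta_fps (j + 2)))"
      unfolding A by (simp add: algebra_simps)
    have 1: "(?X * beta_fps (j + 2)) $ r = beta (j + 2) (int r)"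
      by (cases r) (simp_all add: beta_fps_def add.commute)
    \<comment> \<open>For r = 0 the coefficient is 0, while the right-hand side is a beta value at
      -1; it vanishes because its index is at least 2.\<close>
    have 2: "(?X * (?X * beta_fps (j + 2))) $ r = beta (j + 2) (int r - 1)"
      by (cases r; cases "r - 1") (simp_all add: beta_fps_def beta_minus_1 add.commute)
    have 3: "beta_fps (j + 2) $ r = beta (j + 2) (int r + 1)"
      by (simp add: beta_fps_def)
    show "(beta_fps (j + 2) * A (blk a j @ blk (a + int j + 1) (m - j))) $ r
      = beta (j + 2) (int r + 1) * Q j x z
        - beta (j + 2) (int r) * (Q j (x + 1) z + Q j x (z + 1))
        + beta (j + 2) (int r - 1) * Q j (x + 1) (z + 1)"
      unfolding prod fps_add_nth fps_sub_nth fps_mult_left_const_nth 1 2 3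
      by (simp add: algebra_simps)
  qed
  finally show ?thesis unfolding U_def .
qed

section \<open>Expansions in the basis of rising binomial coefficients\<close>

definition bwd :: "(int \<Rightarrow> real) \<Rightarrow> int \<Rightarrow> real" where
  "bwd f = (\<lambda>w. f w - f (w - 1))"

text \<open>Since backward differencing lowers the index of \<open>beta\<close>, the shift w - 1
  acts on coefficients by c_s - c_(s+1). The condition c n = 0 closes the index range.\<close>

lemma sum_beta_shift:
  assumes "c n = 0"
  shows "(\<Sum>s<n. c s * beta s (w - 1)) = (\<Sum>s<n. c s * beta s w) - (\<Sum>s<n. c (Suc s) * beta s w)"
proof -
  have "(\<Sum>s<n. c s * (beta s w - beta s (w - 1))) = (\<Sum>s<Suc n. c s * (beta s w - beta s (w - 1)))"
    by (simp add: assms)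
  also have "\<dots> = (\<Sum>s<n. c (Suc s) * (beta (Suc s) w - beta (Suc s) (w - 1)))"
    by (subst sum.lessThan_Suc_shift) simp
  also have "\<dots> = (\<Sum>s<n. c (Suc s) * beta s w)"
    using beta_Suc[of _ w] by simp
  finally show ?thesis by (simp add: algebra_simps sum_subtractf)
qed

text \<open>By induction both sides have the same backward difference, so they differ by a constant,
  and at w = 0 only \<open>beta 0\<close> is nonzero.\<close>

lemma newton_expansion: "nilp n f \<Longrightarrow> f w = (\<Sum>s<n. (bwd ^^ s) f 0 * beta s w)"
proof (induction n arbitrary: f w)
  case 0
  then show ?case by (simp add: nilp_0)
next
  case (Suc n)
  define g where "g w = (\<Sum>s<Suc n. (bwd ^^ s) f 0 * beta s w)" for w
  have "bwd f = (\<lambda>x. fwd f (x + - 1))" by (auto simp: bwd_def fwd_def)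
  then have "nilp n (bwd f)" using Suc.prems nilp_shift[of n "fwd f" "- 1"] by (simp add: nilp_Suc)
  then have IH: "bwd f w = (\<Sum>s<n. (bwd ^^ Suc s) f 0 * beta s w)" for w
    using Suc.IH by (simp add: funpow_swap1)
  have "g w - g (w - 1) = (\<Sum>s<Suc n. (bwd ^^ s) f 0 * (beta s w - beta s (w - 1)))" for w
    by (simp add: g_def sum_subtractf algebra_simps)
  also have "\<dots> w = (\<Sum>s<n. (bwd ^^ Suc s) f 0 * (beta (Suc s) w - beta (Suc s) (w - 1)))" for w
    by (subst sum.lessThan_Suc_shift) simp
  also have "\<dots> w = bwd f w" for w
    using beta_Suc[of _ w] by (simp add: IH)
  finally have step: "f w - g w = f (w - 1) - g (w - 1)" for w
    by (simp add: bwd_def algebra_simps)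
  have "f w - g w = f 0 - g 0" for w
  proof (induction w rule: int_induct[where k = 0])
    case (step1 i)
    then show ?case using step[of "i + 1"] by simp
  next
    case (step2 i)
    then show ?case using step[of i] by simp
  qed simp
  moreover have "g 0 = f 0"
    unfolding g_def by (subst sum.lessThan_Suc_shift) simp
  ultimately have "f w = g w" by simp
  then show ?case by (simp only: g_def)
qed

lemma nilp_funpow_bwd:
  "(\<And>x. nilp n (\<lambda>y. p x y)) \<Longrightarrow> nilp n (\<lambda>y. (bwd ^^ s) (\<lambda>x. p x y) w)"
proof (induction s arbitrary: p)
  case (Suc s)
  have "nilp n (\<lambda>y. (bwd ^^ s) (\<lambda>x. p x y - p (x - 1) y) w)"
    by (rule Suc.IH) (intro nilp_diff Suc.prems)
  moreover have "(bwd ^^ Suc s) (\<lambda>x. p x y) w = (bwd ^^ s) (\<lambda>x. p x y - p (x - 1) y) w" for y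
    unfolding funpow_Suc_right comp_def bwd_def[of "\<lambda>x. p x y"] ..
  ultimately show ?case by simp
qed simp

text \<open>Stated for a half line because the counting formulas are available only there. Each
  backward difference lowers the number of terms and moves the bound up by one.\<close>

lemma beta_independent:
  "(\<And>w. lb \<le> w \<Longrightarrow> (\<Sum>s<n. c s * beta s w) = 0) \<Longrightarrow> s < n \<Longrightarrow> c s = 0"
proof (induction n arbitrary: c lb s)
  case (Suc n)
  have Suc_zero: "c (Suc j) = 0" if "j < n" for j
  proof (rule Suc.IH[where c = "\<lambda>j. c (Suc j)" and lb = "lb + 1"])
    fix w assume w: "lb + 1 \<le> w"
    have "(\<Sum>s<n. c (Suc s) * beta s w) = (\<Sum>s<n. c (Suc s) * (beta (Suc s) w - beta (Suc s) (w - 1)))"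
      using beta_Suc[of _ w] by simp
    also have "\<dots> = (\<Sum>s<Suc n. c s * beta s w) - (\<Sum>s<Suc n. c s * beta s (w - 1))"
      unfolding sum.lessThan_Suc_shift by (simp add: sum_subtractf algebra_simps)
    finally show "(\<Sum>s<n. c (Suc s) * beta s w) = 0"
      using Suc.prems(1)[of w] Suc.prems(1)[of "w - 1"] w by simp
  qed fact
  then have "(\<Sum>s<Suc n. c s * beta s lb) = c 0"
    unfolding sum.lessThan_Suc_shift by simp
  then have "c 0 = 0" using Suc.prems(1)[of lb] by simp
  then show ?case using Suc_zero Suc.prems(2) by (cases s) auto
qed simp

definition beta_sum :: "nat \<Rightarrow> (nat \<Rightarrow> nat \<Rightarrow> nat \<Rightarrow> real) \<Rightarrow> int \<Rightarrow> int \<Rightarrow> int \<Rightarrow> real" where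
  "beta_sum n c x y z = (\<Sum>s<n. \<Sum>i<n. \<Sum>t<n. c s i t * (beta s x * beta i y * beta t z))"

lemma beta_sum_x:
  "beta_sum n c x y z = (\<Sum>s<n. (\<Sum>i<n. \<Sum>t<n. c s i t * (beta i y * beta t z)) * beta s x)"
  unfolding beta_sum_def by (simp add: sum_distrib_left sum_distrib_right algebra_simps)

lemma beta_sum_y:
  "beta_sum n c x y z = (\<Sum>i<n. (\<Sum>s<n. \<Sum>t<n. c s i t * (beta s x * beta t z)) * beta i y)"
  unfolding beta_sum_def by (subst sum.swap) (simp add: sum_distrib_left sum_distrib_right algebra_simps)

lemma beta_sum_z:
  "beta_sum n c x y z = (\<Sum>t<n. (\<Sum>s<n. \<Sum>i<n. c s i t * (beta s x * beta i y)) * beta t z)"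
proof -
  have "beta_sum n c x y z = (\<Sum>s<n. \<Sum>t<n. \<Sum>i<n. c s i t * (beta s x * beta i y * beta t z))"
    unfolding beta_sum_def by (rule sum.cong[OF refl]) (rule sum.swap)
  also have "\<dots> = (\<Sum>t<n. \<Sum>s<n. \<Sum>i<n. c s i t * (beta s x * beta i y * beta t z))"
    by (rule sum.swap)
  finally show ?thesis by (simp add: sum_distrib_left sum_distrib_right algebra_simps)
qed

lemma beta_sum_diff: "beta_sum n (\<lambda>s i t. c s i t - d s i t) x y z = beta_sum n c x y z - beta_sum n d x y z"
  by (simp add: beta_sum_def sum_subtractf left_diff_distrib)

lemma beta_sum_add: "beta_sum n (\<lambda>s i t. c s i t + d s i t) x y z = beta_sum n c x y z + beta_sum n d x y z"
  by (simp add: beta_sum_def sum.distrib distrib_right)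

lemma beta_sum_shift_x:
  assumes "\<And>i t. c n i t = 0"
  shows "beta_sum n c (x - 1) y z = beta_sum n (\<lambda>s i t. c s i t - c (Suc s) i t) x y z"
  unfolding beta_sum_diff beta_sum_x by (rule sum_beta_shift) (simp add: assms)

lemma beta_sum_shift_y:
  assumes "\<And>s t. c s n t = 0"
  shows "beta_sum n c x (y - 1) z = beta_sum n (\<lambda>s i t. c s i t - c s (Suc i) t) x y z"
  unfolding beta_sum_diff beta_sum_y by (rule sum_beta_shift) (simp add: assms)

lemma beta_sum_shift_z:
  assumes "\<And>s i. c s i n = 0"
  shows "beta_sum n c x y (z - 1) = beta_sum n (\<lambda>s i t. c s i t - c s i (Suc t)) x y z"
  unfolding beta_sum_diff beta_sum_z by (rule sum_beta_shift) (simp add: assms)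

lemma beta_sum_independent:
  assumes "\<And>x y z. lb \<le> x \<Longrightarrow> lb \<le> y \<Longrightarrow> lb \<le> z \<Longrightarrow> beta_sum n c x y z = 0"
    and "s < n" "i < n" "t < n"
  shows "c s i t = 0"
proof -
  have 1: "(\<Sum>i<n. \<Sum>t<n. c s i t * (beta i y * beta t z)) = 0" if "lb \<le> y" "lb \<le> z" for y z
    using beta_independent[where lb = lb and n = n
        and c = "\<lambda>s. \<Sum>i<n. \<Sum>t<n. c s i t * (beta i y * beta t z)"] that assms
    unfolding beta_sum_x by blast
  have 2: "(\<Sum>t<n. c s i t * beta t z) = 0" if "lb \<le> z" for z
  proof (rule beta_independent[where lb = lb and n = n and c = "\<lambda>i. \<Sum>t<n. c s i t * beta t z"])
    fix y assume "lb \<le> y"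
    from 1[OF this that] show "(\<Sum>i<n. (\<Sum>t<n. c s i t * beta t z) * beta i y) = 0"
      by (simp add: sum_distrib_left sum_distrib_right algebra_simps)
  qed fact
  show ?thesis
    by (rule beta_independent[where lb = lb and n = n and c = "c s i"]) (use 2 assms in auto)
qed

lemma beta_sum_expansion:
  assumes "\<And>y z. nilp n (\<lambda>x. p x y z)" "\<And>x z. nilp n (\<lambda>y. p x y z)" "\<And>x y. nilp n (\<lambda>z. p x y z)"
  shows "\<exists>c. \<forall>x y z. p x y z = beta_sum n c x y z"
proof -
  define c1 where "c1 s y z = (bwd ^^ s) (\<lambda>x. p x y z) 0" for s y z
  define c2 where "c2 s i z = (bwd ^^ i) (\<lambda>y. c1 s y z) 0" for s i z
  define c3 where "c3 s i t = (bwd ^^ t) (\<lambda>z. c2 s i z) 0" for s i t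
  have n1: "nilp n (\<lambda>y. c1 s y z)" "nilp n (\<lambda>z. c1 s y z)" for s y z
    unfolding c1_def by (rule nilp_funpow_bwd; rule assms)+
  have n2: "nilp n (\<lambda>z. c2 s i z)" for s i
    unfolding c2_def by (rule nilp_funpow_bwd) (rule n1)
  have "p x y z = (\<Sum>s<n. c1 s y z * beta s x)" for x y z
    unfolding c1_def by (rule newton_expansion) (rule assms)
  moreover have "c1 s y z = (\<Sum>i<n. c2 s i z * beta i y)" for s y z
    unfolding c2_def by (rule newton_expansion) (rule n1)
  moreover have "c2 s i z = (\<Sum>t<n. c3 s i t * beta t z)" for s i z
    unfolding c3_def by (rule newton_expansion) (rule n2)
  ultimately have "p x y z = (\<Sum>s<n. (\<Sum>i<n. (\<Sum>t<n. c3 s i t * beta t z) * beta i y) * beta s x)" for x y z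
    by simp
  then have "p x y z = beta_sum n c3 x y z" for x y z
    by (simp add: beta_sum_def sum_distrib_left sum_distrib_right algebra_simps)
  then show ?thesis by blast
qed

section \<open>The coefficients of the expansion\<close>

text \<open>The substitution k_1 = 2 - x, k_(n-1) = y + n - 2, k_n = z + n - 2 turns all three
  families of basis polynomials into \<open>beta\<close> and absorbs the sign (-1)^(s+1).\<close>

definition alpha_beta :: "nat \<Rightarrow> int \<Rightarrow> int \<Rightarrow> int \<Rightarrow> real" where
  "alpha_beta n x y z = alpha n (special_args n (2 - x) (y + int n - 2) (z + int n - 2))"

lemma expansion_basis_beta:
  assumes "1 \<le> s" "1 \<le> i" "1 \<le> t"
  shows "expansion_basis n s i t (2 - x) (y + int n - 2) (z + int n - 2)
    = beta (s - 1) x * beta (i - 1) y * beta (t - 1) z"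
proof -
  obtain s' i' t' where si: "s = Suc s'" "i = Suc i'" "t = Suc t'"
    using assms by (metis Suc_le_D One_nat_def)
  have "(- 1) ^ (s + 1) * ((real_of_int (2 - x) - 2) gchoose (s - 1)) = beta (s - 1) x"
    using gbinomial_minus[of "real_of_int x" s'] by (simp add: si beta_def)
  moreover have "real_of_int (y + int n - 2) - of_nat n + of_nat i = of_int y + of_nat (i - 1) - 1"
    "real_of_int (z + int n - 2) - of_nat n + of_nat t = of_int z + of_nat (t - 1) - 1"
    by (simp_all add: si)
  ultimately show ?thesis
    unfolding expansion_basis_def by (simp only: beta_def)
qed

lemma sum_expansion_basis:
  "(\<Sum>s=1..n. \<Sum>i=1..n. \<Sum>t=1..n. c s i t * expansion_basis n s i t (2 - x) (y + int n - 2) (z + int n - 2))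
    = beta_sum n (\<lambda>s i t. c (Suc s) (Suc i) (Suc t)) x y z"
proof -
  have shift: "(\<Sum>s=1..n. f s) = (\<Sum>s<n. f (Suc s))" for f :: "nat \<Rightarrow> real"
    using sum.atLeast_Suc_atMost_Suc_shift[of f 0 "n - 1"]
    by (cases n) (simp_all add: sum.atLeast_Suc_atMost_Suc_shift lessThan_Suc_atMost atMost_atLeast0 del: sum.cl_ivl_Suc)
  show ?thesis
    unfolding shift beta_sum_def by (simp add: expansion_basis_beta)
qed

lemma nilp_const: "1 \<le> n \<Longrightarrow> nilp n (\<lambda>_. a)"
  by (cases n) (simp_all add: nilp_Suc fwd_def nilp_zero)

lemma nilp_alpha:
  assumes "1 \<le> n"
  shows "nilp n (\<lambda>v. alpha n (k(j := v)))"
proof (cases "j \<in> {1..n}")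
  case True
  then have split: "[1..<n + 1] = [1..<j] @ j # [j + 1..<n + 1]"
    using upt_add_eq_append[of 1 j "n + 1 - j"] by (simp add: upt_conv_Cons)
  have "map (k(j := v)) [1..<n + 1] = map k [1..<j] @ v # map k [j + 1..<n + 1]" for v
    unfolding split by simp
  then show ?thesis
    unfolding alpha_eq_tri using nilp_tri[of "map k [1..<j]" "map k [j + 1..<n + 1]" n] True by (simp del: upt_Suc)
next
  case False
  then have "map (k(j := v)) [1..<n + 1] = map k [1..<n + 1]" for v by auto
  then show ?thesis
    unfolding alpha_eq_tri by (simp only: nilp_const[OF assms])
qed

lemma alpha_beta_expansion:
  assumes "1 \<le> n"
  shows "\<exists>c. \<forall>x y z. alpha_beta n x y z = beta_sum n c x y z"
proof (rule beta_sum_expansion)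
  have "nilp n (\<lambda>k1. alpha n (special_args n k1 y z))" for y z
  proof (cases "n = 1 \<or> n = 2")
    case True
    \<comment> \<open>For n = 1 and n = 2 a later update overwrites position 1, so nothing depends
      on k_1.\<close>
    then have "(\<lambda>k1. alpha n (special_args n k1 y z)) = (\<lambda>_. alpha n (special_args n 0 y z))"
      by (intro ext arg_cong[where f = "alpha n"]) (auto simp: special_args_def)
    then show ?thesis by (simp only: nilp_const[OF assms])
  next
    case False
    then have "(\<lambda>k1. alpha n (special_args n k1 y z)) = (\<lambda>v. alpha n ((special_args n 0 y z)(1 := v)))"
      using assms by (intro ext arg_cong[where f = "alpha n"]) (auto simp: special_args_def)
    then show ?thesis by (simp only: nilp_alpha[OF assms])
  qed
  then show "nilp n (\<lambda>x. alpha_beta n x y z)" for y z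
    unfolding alpha_beta_def by (rule nilp_reflect)
  have "(\<lambda>k2. alpha n (special_args n x k2 z)) = (\<lambda>v. alpha n ((special_args n x 0 z)(n - 1 := v)))" for x z
    using assms by (intro ext arg_cong[where f = "alpha n"]) (auto simp: special_args_def)
  then have "nilp n (\<lambda>k2. alpha n (special_args n x k2 z))" for x z
    by (simp only: nilp_alpha[OF assms])
  from nilp_shift[OF this, where c = "int n - 2"] show "nilp n (\<lambda>y. alpha_beta n x y z)" for x z
    by (simp add: alpha_beta_def algebra_simps)
  have "(\<lambda>k3. alpha n (special_args n x y k3)) = (\<lambda>v. alpha n ((special_args n x y 0)(n := v)))" for x y
    by (intro ext arg_cong[where f = "alpha n"]) (auto simp: special_args_def)
  then have "nilp n (\<lambda>k3. alpha n (special_args n x y k3))" for x y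
    by (simp only: nilp_alpha[OF assms])
  from nilp_shift[OF this, where c = "int n - 2"] show "nilp n (\<lambda>z. alpha_beta n x y z)" for x y
    by (simp add: alpha_beta_def algebra_simps)
qed

text \<open>The definite description denotes: within the range the coefficients are unique because
  products of \<open>beta\<close> are independent, and outside the range they are required to
  vanish.\<close>

lemma Abb_properties:
  assumes "1 \<le> n"
  shows "alpha_beta n x y z = beta_sum n (\<lambda>s i t. Abb n (Suc s) (Suc i) (Suc t)) x y z"
    and "Abb n s i t \<noteq> 0 \<Longrightarrow> s \<in> {1..n} \<and> i \<in> {1..n} \<and> t \<in> {1..n}"
proof -
  define P where "P c \<longleftrightarrow> (\<forall>s i t. c s i t \<noteq> 0 \<longrightarrow> s \<in> {1..n} \<and> i \<in> {1..n} \<and> t \<in> {1..n}) \<and>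
     (\<forall>k1 kn1 kn. alpha n (special_args n k1 kn1 kn) =
        (\<Sum>s=1..n. \<Sum>i=1..n. \<Sum>t=1..n. c s i t * expansion_basis n s i t k1 kn1 kn))"
    for c :: "nat \<Rightarrow> nat \<Rightarrow> nat \<Rightarrow> real"
  have P_iff: "P c \<longleftrightarrow> (\<forall>s i t. c s i t \<noteq> 0 \<longrightarrow> s \<in> {1..n} \<and> i \<in> {1..n} \<and> t \<in> {1..n}) \<and>
     (\<forall>x y z. alpha_beta n x y z = beta_sum n (\<lambda>s i t. c (Suc s) (Suc i) (Suc t)) x y z)" for c
  proof -
    have "(\<forall>k1 kn1 kn. F k1 kn1 kn) \<longleftrightarrow> (\<forall>x y z. F (2 - x) (y + int n - 2) (z + int n - 2))"
      for F :: "int \<Rightarrow> int \<Rightarrow> int \<Rightarrow> bool"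
    proof
      assume *: "\<forall>x y z. F (2 - x) (y + int n - 2) (z + int n - 2)"
      show "\<forall>k1 kn1 kn. F k1 kn1 kn"
      proof (intro allI)
        fix a b d
        show "F a b d" using *[rule_format, of "2 - a" "b - int n + 2" "d - int n + 2"] by simp
      qed
    qed blast
    from this show ?thesis
      unfolding P_def alpha_beta_def sum_expansion_basis[symmetric] by (intro conj_cong refl)
  qed
  obtain c where c: "\<And>x y z. alpha_beta n x y z = beta_sum n c x y z"
    using alpha_beta_expansion[OF assms] by blast
  define c' where "c' s i t = (if s \<in> {1..n} \<and> i \<in> {1..n} \<and> t \<in> {1..n} then c (s - 1) (i - 1) (t - 1) else 0)" for s i t
  have "P c'"
    unfolding P_iff c by (auto simp: c'_def beta_sum_def split: if_splits)
  moreover have "d = c'" if "P d" for d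
  proof (intro ext)
    fix s i t
    show "d s i t = c' s i t"
    proof (cases "s \<in> {1..n} \<and> i \<in> {1..n} \<and> t \<in> {1..n}")
      case True
      have "(\<lambda>s i t. d (Suc s) (Suc i) (Suc t) - c' (Suc s) (Suc i) (Suc t)) (s - 1) (i - 1) (t - 1) = 0"
      proof (rule beta_sum_independent[where n = n and lb = 0
          and c = "\<lambda>s i t. d (Suc s) (Suc i) (Suc t) - c' (Suc s) (Suc i) (Suc t)"])
        fix x y z
        show "beta_sum n (\<lambda>s i t. d (Suc s) (Suc i) (Suc t) - c' (Suc s) (Suc i) (Suc t)) x y z = 0"
          using that \<open>P c'\<close> unfolding P_iff beta_sum_diff by (metis diff_self)
      qed (use True in auto)
      then show ?thesis using True by simp
    next
      case False
      then show ?thesis using that \<open>P c'\<close> unfolding P_def by metis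
    qed
  qed
  ultimately have "P (Abb n)"
    unfolding Abb_def P_def[symmetric] by (rule theI)
  then show "alpha_beta n x y z = beta_sum n (\<lambda>s i t. Abb n (Suc s) (Suc i) (Suc t)) x y z"
    and "Abb n s i t \<noteq> 0 \<Longrightarrow> s \<in> {1..n} \<and> i \<in> {1..n} \<and> t \<in> {1..n}"
    unfolding P_iff by blast+
qed

lemma alpha_beta_tri:
  assumes "3 \<le> n"
  shows "alpha_beta n x y z = tri ((2 - x) # blk 2 (n - 3) @ [y + int n - 2, z + int n - 2])"
proof -
  have "[1..<n + 1] = 1 # [2..<n - 1] @ [n - 1, n]"
  proof -
    have "[1..<n + 1] = 1 # [2..<n + 1]" using assms by (simp add: upt_conv_Cons numeral_2_eq_2)
    also have "[2..<n + 1] = [2..<n - 1] @ [n - 1, n]"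
      using assms upt_add_eq_append[of 2 "n - 1" 2] by (simp add: upt_conv_Cons Suc_diff_le)
    finally show ?thesis .
  qed
  moreover have "map (special_args n a b c) [2..<n - 1] = blk 2 (n - 3)" for a b c
  proof (rule nth_equalityI)
    fix i assume "i < length (map (special_args n a b c) [2..<n - 1])"
    then show "map (special_args n a b c) [2..<n - 1] ! i = blk 2 (n - 3) ! i"
      by (auto simp: special_args_def blk_def)
  qed simp
  moreover have "n - 1 \<noteq> n" "n - 1 \<noteq> 1" "1 \<noteq> n" using assms by auto
  ultimately show ?thesis
    unfolding alpha_beta_def alpha_eq_tri by (simp add: special_args_def del: upt_Suc One_nat_def)
qed

text \<open>Separates the comparison of coefficients from the counting: \<open>R s i t\<close>
  stands for the coefficients in x and z of the value of \<open>tri\<close> at the arguments with i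
  omitted. The zeros required by \<open>R0\<close> make the index shifts close at the ends of the
  range.\<close>

lemma Abb_of_gap_expansion:
  fixes R :: "nat \<Rightarrow> nat \<Rightarrow> nat \<Rightarrow> real"
  assumes n: "3 \<le> n"
    and R0: "\<And>s i t. n \<le> s \<or> n \<le> t \<or> i < 2 \<or> n \<le> i \<Longrightarrow> R s i t = 0"
    and gap: "\<And>i x z. 2 \<le> i \<Longrightarrow> i < n \<Longrightarrow> 1 \<le> x \<Longrightarrow> 1 \<le> z \<Longrightarrow>
      tri ((2 - x) # blk 2 (i - 2) @ blk (int i + 1) (n - 1 - i) @ [z + int n - 1])
        = (\<Sum>s<n. \<Sum>t<n. R s i t * (beta s x * beta t z))"
    and "s < n" "i < n" "t < n"
  shows "Abb n (s + 2) (i + 1) (t + 2) = R (s + 1) (i + 1) t + R (s + 1) (i + 1) (t + 1)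
     + R s (i + 2) t - R (s + 1) (i + 2) t - R s (i + 1) (t + 1) - R (s + 1) i (t + 1)"
proof -
  define A where "A s i t = Abb n (Suc s) (Suc i) (Suc t)" for s i t
  have A: "alpha_beta n x y z = beta_sum n A x y z" for x y z
    unfolding A_def by (rule Abb_properties) (use n in simp)
  have A0: "A s i t = 0" if "n \<le> s \<or> n \<le> i \<or> n \<le> t" for s i t
    using Abb_properties(2)[of n "Suc s" "Suc i" "Suc t"] that n unfolding A_def by fastforce
  define m where "m = n - 3"
  define q where "q i x z = (\<Sum>s<n. \<Sum>t<n. R s i t * (beta s x * beta t z))" for i x z
  have RS: "beta_sum n R x y z = (\<Sum>j\<le>m. beta (j + 2) y * q (j + 2) x z)" for x y z
  proof -
    have "beta_sum n R x y z = (\<Sum>i<n. q i x z * beta i y)"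
      unfolding beta_sum_y q_def ..
    also have "\<dots> = (\<Sum>i\<in>{2..<n}. q i x z * beta i y)"
      by (rule sum.mono_neutral_right) (auto simp: q_def R0)
    also have "\<dots> = (\<Sum>j\<le>m. q (j + 2) x z * beta (j + 2) y)"
    proof -
      have "{2..<n} = {0 + 2..<Suc m + 2}" "{..m} = {0..<Suc m}" using n by (auto simp: m_def)
      then show ?thesis by (simp only: sum.shift_bounds_nat_ivl)
    qed
    finally show ?thesis by (simp add: mult.commute)
  qed
  \<comment> \<open>This is \<open>interl_sum_formula\<close> for r = y - 1, with i = j + 2. The
    bounds 2 on x and z keep x - 1 and z - 1 within the reach of \<open>gap\<close>.\<close>
  have identity: "beta_sum n A x y z - beta_sum n A (x - 1) y z - (beta_sum n A x y (z - 1) - beta_sum n A (x - 1) y (z - 1))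
    = beta_sum n R x y (z - 1) - beta_sum n R (x - 1) (y - 1) (z - 1) - beta_sum n R x (y - 1) z
      + beta_sum n R (x - 1) (y - 1 - 1) z"
    if "2 \<le> x" "2 \<le> y" "2 \<le> z" for x y z
  proof -
    define r where "r = nat (y - 1)"
    have y: "y = int r + 1" using that by (simp add: r_def)
    have q: "tri (a # blk 2 j @ blk (2 + int j + 1) (m - j) @ [b]) = q (j + 2) (2 - a) (b - int n + 1)"
      if "j \<le> m" "a \<le> 1" "int n \<le> b" for j a b
    proof -
      have e: "j + 2 - 2 = j" "int (j + 2) + 1 = 2 + int j + 1" "n - 1 - (j + 2) = m - j"
        using that(1) n by (auto simp: m_def)
      have "tri ((2 - (2 - a)) # blk 2 (j + 2 - 2) @ blk (int (j + 2) + 1) (n - 1 - (j + 2)) @ [(b - int n + 1) + int n - 1])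
        = q (j + 2) (2 - a) (b - int n + 1)"
        unfolding q_def by (rule gap) (use that n in \<open>auto simp: m_def\<close>)
      then show ?thesis unfolding e by simp
    qed
    let ?x = "2 - x" and ?z = "z + int n - 2"
    let ?mid = "blk 2 m @ [2 + int m + int r]"
    have mid: "y + int n - 2 = 2 + int m + int r" using n by (simp add: y m_def)
    have tri: "alpha_beta n u y w = tri ((2 - u) # ?mid @ [w + int n - 2])" for u w
      unfolding alpha_beta_tri[OF n] mid m_def by simp
    have "alpha_beta n x y z - alpha_beta n (x - 1) y z - (alpha_beta n x y (z - 1) - alpha_beta n (x - 1) y (z - 1))
      = (\<Sum>l\<in>interl ?mid. tri (?x # l @ [?z]))"
    proof -
      have "sorted_wrt (<) ?mid" by (auto simp: sorted_wrt_append sorted_blk set_blk)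
      from tri_mixed_difference[OF this, of ?x ?z] show ?thesis
        unfolding tri by (simp add: algebra_simps)
    qed
    also have "\<dots> = (\<Sum>j\<le>m. beta (j + 2) (int r + 1) * q (j + 2) x (z - 1)
        - beta (j + 2) (int r) * (q (j + 2) (x - 1) (z - 1) + q (j + 2) x z)
        + beta (j + 2) (int r - 1) * q (j + 2) (x - 1) z)"
      unfolding interl_sum_formula
    proof (rule sum.cong[OF refl])
      fix j assume "j \<in> {..m}"
      then have j: "j \<le> m" by simp
      have Q: "tri (?x # blk 2 j @ blk (2 + int j + 1) (m - j) @ [?z]) = q (j + 2) x (z - 1)"
        "tri ((?x + 1) # blk 2 j @ blk (2 + int j + 1) (m - j) @ [?z]) = q (j + 2) (x - 1) (z - 1)"
        "tri (?x # blk 2 j @ blk (2 + int j + 1) (m - j) @ [?z + 1]) = q (j + 2) x z"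
        "tri ((?x + 1) # blk 2 j @ blk (2 + int j + 1) (m - j) @ [?z + 1]) = q (j + 2) (x - 1) z"
        using that by (subst q[OF j]; simp add: algebra_simps)+
      show "beta (j + 2) (int r + 1) * tri (?x # blk 2 j @ blk (2 + int j + 1) (m - j) @ [?z])
        - beta (j + 2) (int r) * (tri ((?x + 1) # blk 2 j @ blk (2 + int j + 1) (m - j) @ [?z])
          + tri (?x # blk 2 j @ blk (2 + int j + 1) (m - j) @ [?z + 1]))
        + beta (j + 2) (int r - 1) * tri ((?x + 1) # blk 2 j @ blk (2 + int j + 1) (m - j) @ [?z + 1])
        = beta (j + 2) (int r + 1) * q (j + 2) x (z - 1)
        - beta (j + 2) (int r) * (q (j + 2) (x - 1) (z - 1) + q (j + 2) x z)
        + beta (j + 2) (int r - 1) * q (j + 2) (x - 1) z"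
        unfolding Q ..
    qed
    finally show ?thesis
      unfolding A[symmetric] RS y by (simp add: sum.distrib sum_subtractf algebra_simps)
  qed
  \<comment> \<open>Let S, I, T raise s, i, t. Shifting x, y or z by -1 acts on coefficients as 1 -
    S, 1 - I or 1 - T. The left side of \<open>identity\<close> then becomes S T applied to
    \<open>A\<close>, and the right side becomes (I - T)(S + I - S I) applied to \<open>R\<close>,
    whose six monomials are the six terms.\<close>
  define D where "D s i t = A (Suc s) i (Suc t)
    - (R (s + 1) (i + 1) t + R (s + 1) (i + 1) (t + 1)
     + R s (i + 2) t - R (s + 1) (i + 2) t - R s (i + 1) (t + 1) - R (s + 1) i (t + 1))" for s i t
  have "D s i t = 0"
  proof (rule beta_sum_independent[where n = n and lb = 2 and c = D])
    fix x y z :: int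
    assume "2 \<le> x" "2 \<le> y" "2 \<le> z"
    moreover have "beta_sum n c x (y - 2) z = beta_sum n (\<lambda>s i t. c s i t - c s (Suc i) t) x (y - 1) z"
      if "\<And>s t. c s n t = 0" for c x
      using beta_sum_shift_y[of c n x "y - 1" z] that by simp
    ultimately show "beta_sum n D x y z = 0"
      unfolding D_def using identity[of x y z]
      by (simp add: beta_sum_shift_x beta_sum_shift_y beta_sum_shift_z A0 R0
          beta_sum_diff beta_sum_add)
  qed fact+
  then show ?thesis by (simp add: D_def A_def)
qed

section \<open>Chains of interlacing states\<close>

lemma interl_sorted_bounds:
  "sorted_wrt (<) r \<Longrightarrow> (r \<noteq> [] \<Longrightarrow> a \<le> hd r) \<Longrightarrow> l \<in> interl (a # r) \<Longrightarrow>
    sorted_wrt (<) l \<and> (\<forall>v\<in>set l. a \<le> v \<and> v \<le> last (a # r))"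
proof (induction r arbitrary: a l)
  case (Cons b r)
  have hd: "r \<noteq> [] \<Longrightarrow> b + 1 \<le> hd r" using Cons.prems(1) by (cases r) auto
  have last: "b \<le> last (b # r)"
    using Cons.prems(1) by (cases r) (auto intro: less_imp_le)
  consider l0 ys where "l = l0 # ys" "a \<le> l0" "l0 < b" "ys \<in> interl (b # r)"
    | ys where "l = b # ys" "ys \<in> interl ((b + 1) # r)"
    using Cons.prems(3) by auto
  then show ?case
  proof cases
    case 1
    then have "sorted_wrt (<) ys \<and> (\<forall>v\<in>set ys. b \<le> v \<and> v \<le> last (b # r))"
      using Cons.prems(1) hd by (intro Cons.IH) auto
    then show ?thesis using 1 last by force
  next
    case 2
    have IH: "sorted_wrt (<) ys \<and> (\<forall>v\<in>set ys. b + 1 \<le> v \<and> v \<le> last ((b + 1) # r))"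
      using 2 Cons.prems(1) hd by (intro Cons.IH) auto
    have "v \<le> last (b # r)" if "v \<in> set ys" for v
      using IH that 2(2) by (cases r) auto
    then show ?thesis using 2 IH Cons.prems(2) last by force
  qed
qed auto

lemma interl_sorted:
  assumes "sorted_wrt (<) k" "l \<in> interl k"
  shows "sorted_wrt (<) l" "\<And>v. v \<in> set l \<Longrightarrow> hd k \<le> v \<and> v \<le> last k"
proof -
  obtain a r where k: "k = a # r" using assms by (cases k) auto
  have "sorted_wrt (<) l \<and> (\<forall>v\<in>set l. a \<le> v \<and> v \<le> last (a # r))"
    by (rule interl_sorted_bounds) (use assms k in \<open>auto intro: less_imp_le\<close>)
  then show "sorted_wrt (<) l" "\<And>v. v \<in> set l \<Longrightarrow> hd k \<le> v \<and> v \<le> last k"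
    by (auto simp: k)
qed

definition set_left :: "int \<Rightarrow> int list \<Rightarrow> int list" where
  "set_left x l = (if l \<noteq> [] \<and> hd l = 1 then x # tl l else l)"

definition set_right :: "int \<Rightarrow> int \<Rightarrow> int list \<Rightarrow> int list" where
  "set_right n z l = (if l \<noteq> [] \<and> last l = n then butlast l @ [z] else l)"

text \<open>The default value 1 makes \<open>set_left\<close> the identity, so a row not starting
  with 1 contributes one unchanged term.\<close>

definition left_range :: "int \<Rightarrow> int list \<Rightarrow> int set" where
  "left_range x l = (if l \<noteq> [] \<and> hd l = 1 then {x..1} else {1})"

definition right_range :: "int \<Rightarrow> int \<Rightarrow> int list \<Rightarrow> int set" where
  "right_range n z l = (if l \<noteq> [] \<and> last l = n then {n..z} else {n})"

lemma set_left_1 [simp]: "set_left 1 l = l"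
  by (cases l) (auto simp: set_left_def)

lemma set_right_same [simp]: "set_right n n l = l"
  by (metis append_butlast_last_id set_right_def)

text \<open>Lowering the first entry from 1 to x gives room only to the first entry of the
  interlacing row: [x, b) consists of [x, 1] and [2, b), and collapsing [x, 1] to the value 1 leaves
  the rows interlacing \<open>k\<close>.\<close>

lemma sum_interl_set_left:
  fixes f :: "int list \<Rightarrow> real"
  assumes "sorted_wrt (<) k" "k \<noteq> []" "1 \<le> hd k" "x \<le> 1"
  shows "sum f (interl (set_left x k)) = (\<Sum>l\<in>interl k. \<Sum>x'\<in>left_range x l. f (set_left x' l))"
proof (cases "hd k = 1")
  case False
  have "left_range x l = {1}" if "l \<in> interl k" for l
  proof (cases l)
    case (Cons v vs)
    then have "hd k \<le> v" using interl_sorted(2)[OF assms(1) that] by simp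
    then show ?thesis using Cons False assms(3) by (simp add: left_range_def)
  qed (simp add: left_range_def)
  moreover have "set_left x k = k" using False by (simp add: set_left_def)
  ultimately show ?thesis by simp
next
  case True
  then obtain r where k: "k = 1 # r" using assms(2) by (cases k) auto
  show ?thesis
  proof (cases r)
    case Nil
    then show ?thesis by (simp add: k set_left_def left_range_def)
  next
    case (Cons b r')
    have b: "2 \<le> b" using assms(1) k Cons by simp
    define S where "S l = (\<Sum>ys\<in>interl (b # r'). f (l # ys))" for l
    have "{x..<b} = {x..1} \<union> {2..<b}" using assms(4) b by auto
    then have split: "sum S {x..<b} = sum S {x..1} + sum S {2..<b}"
      by (simp only:) (rule sum.union_disjoint; auto)
    have "(\<Sum>x'\<in>left_range x (l # ys). f (set_left x' (l # ys)))
        = (if l = 1 then (\<Sum>x'\<in>{x..1}. f (x' # ys)) else f (l # ys))" for l ys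
      by (auto simp: left_range_def set_left_def)
    then have "(\<Sum>l\<in>interl k. \<Sum>x'\<in>left_range x l. f (set_left x' l))
        = (\<Sum>l\<in>{1..<b}. \<Sum>ys\<in>interl (b # r'). if l = 1 then (\<Sum>x'\<in>{x..1}. f (x' # ys)) else f (l # ys))
          + (\<Sum>ys\<in>interl ((b + 1) # r'). f (b # ys))"
      unfolding k Cons sum_interl using b by simp
    also have "{1..<b} = insert 1 {2..<b}" using b by auto
    also have "(\<Sum>l\<in>insert 1 {2..<b}. \<Sum>ys\<in>interl (b # r'). if l = 1 then (\<Sum>x'\<in>{x..1}. f (x' # ys)) else f (l # ys))
        = (\<Sum>ys\<in>interl (b # r'). \<Sum>x'\<in>{x..1}. f (x' # ys)) + sum S {2..<b}"
      by (simp add: S_def)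
    also have "(\<Sum>ys\<in>interl (b # r'). \<Sum>x'\<in>{x..1}. f (x' # ys)) = sum S {x..1}"
      unfolding S_def by (rule sum.swap)
    finally show ?thesis
      unfolding split[symmetric] by (simp add: k Cons set_left_def sum_interl S_def del: interl.simps)
  qed
qed

lemma sum_interl_snoc_last:
  fixes f :: "int list \<Rightarrow> real"
  assumes "\<And>u. u \<in> set us \<Longrightarrow> u < c" "a \<le> c" "\<And>ys w. w \<noteq> c \<Longrightarrow> f (ys @ [w]) = 0"
  shows "sum f (interl (a # us @ [c])) = (\<Sum>ys\<in>interl (a # us). f (ys @ [c]))"
  using assms
proof (induction us arbitrary: a f)
  case Nil
  have "f [l] = 0" if "l < c" for l using Nil(3)[of l "[]"] that by simp
  then show ?case by (simp add: sum_interl del: interl.simps(3))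
next
  case (Cons e us)
  have IH: "sum f (interl (a' # us @ [c])) = (\<Sum>ys\<in>interl (a' # us). f (ys @ [c]))"
    if "a' \<le> c" "\<And>ys w. w \<noteq> c \<Longrightarrow> f (ys @ [w]) = 0" for a' and f :: "int list \<Rightarrow> real"
    using Cons.prems that by (intro Cons.IH) auto
  have "e \<le> c" "e + 1 \<le> c" using Cons.prems(1)[of e] by auto
  moreover have "f (l # ys @ [w]) = 0" if "w \<noteq> c" for l ys w
    using Cons.prems(3)[OF that, of "l # ys"] by simp
  ultimately show ?case
    unfolding append_Cons sum_interl by (simp add: IH)
qed

lemma sum_interl_set_right:
  fixes f :: "int list \<Rightarrow> real"
  assumes "sorted_wrt (<) k" "k \<noteq> []" "last k \<le> n" "n \<le> z"
  shows "sum f (interl (set_right n z k)) = (\<Sum>l\<in>interl k. \<Sum>z'\<in>right_range n z l. f (set_right n z' l))"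
proof (cases "last k = n")
  case False
  have "right_range n z l = {n}" if "l \<in> interl k" for l
  proof (cases "l = []")
    case False
    then have "last l \<le> last k" using interl_sorted(2)[OF assms(1) that, of "last l"] by simp
    then show ?thesis using \<open>last k \<noteq> n\<close> assms(3) by (simp add: right_range_def)
  qed (simp add: right_range_def)
  moreover have "set_right n z k = k" using False by (simp add: set_right_def)
  ultimately show ?thesis by simp
next
  case True
  then obtain us where k: "k = us @ [n]" using assms(2) by (metis append_butlast_last_id)
  show ?thesis
  proof (cases us)
    case Nil
    then show ?thesis by (simp add: k set_right_def right_range_def)
  next
    case (Cons a us')
    have less: "\<And>u. u \<in> set us' \<Longrightarrow> u < n" "a \<le> n"
      using assms(1) by (auto simp: k Cons sorted_wrt_append)
    \<comment> \<open>The extra rows, with last entry beyond n, are attached to the rows ending in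
      n, so that both sums range over \<open>interl k\<close>.\<close>
    define h where "h l = (if l \<noteq> [] \<and> last l = n then \<Sum>z'\<in>{n<..z}. f (butlast l @ [z']) else 0)" for l
    have "{n..z} = insert n {n<..z}" using assms(4) by auto
    then have "(\<Sum>z'\<in>right_range n z l. f (set_right n z' l)) = f l + h l" for l
      by (auto simp: right_range_def set_right_def h_def)
    then have "(\<Sum>l\<in>interl k. \<Sum>z'\<in>right_range n z l. f (set_right n z' l)) = sum f (interl k) + sum h (interl k)"
      by (simp add: sum.distrib)
    also have "sum h (interl k) = (\<Sum>ys\<in>interl (a # us'). h (ys @ [n]))"
      unfolding k Cons append_Cons by (rule sum_interl_snoc_last) (use less in \<open>auto simp: h_def\<close>)
    also have "\<dots> = (\<Sum>z'\<in>{n<..z}. \<Sum>ys\<in>interl (a # us'). f (ys @ [z']))"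
      unfolding h_def by (simp add: sum.swap[of _ "{n<..z}"])
    also have "sum f (interl k) + \<dots> = sum f (interl (a # us' @ [z]))"
      unfolding k Cons append_Cons by (rule sum_interl_snoc[symmetric]) (use less assms in auto)
    finally show ?thesis by (simp add: k Cons set_right_def)
  qed
qed

text \<open>For increasing \<open>k\<close> these are the monotone triangles with bottom row
  \<open>k\<close>, read upwards, with the empty row left out.\<close>

fun state_chains :: "nat \<Rightarrow> int list \<Rightarrow> int list list set" where
  "state_chains 0 k = (if k = [] then {[]} else {})"
| "state_chains (Suc r) k = (\<Union>l\<in>interl k. (#) k ` state_chains r l)"

definition occurrences :: "int \<Rightarrow> int list list \<Rightarrow> nat" where
  "occurrences v c = length (filter (\<lambda>k. v \<in> set k) c)"

text \<open>If 1 occurs in s + 1 rows and the lowest of these entries is replaced by x, the other s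
  may take weakly monotone values between x and 1, in beta s (2 - x) ways. If it does not occur,
  there is nothing to choose.\<close>

fun weight :: "nat \<Rightarrow> int \<Rightarrow> real" where
  "weight 0 w = 1"
| "weight (Suc s) w = beta s w"

lemma finite_state_chains: "finite (state_chains r k)"
  by (induction r arbitrary: k) (auto simp: finite_interl)

lemma sum_chains_Suc:
  "(\<Sum>c\<in>state_chains (Suc r) k. g c) = (\<Sum>l\<in>interl k. \<Sum>c\<in>state_chains r l. (g (k # c) :: real))"
proof -
  have hd: "hd c = l" if "c \<in> state_chains r l" "c \<noteq> []" for c r l
    using that by (cases r) (auto split: if_splits)
  have empty: "c = [] \<longleftrightarrow> l = []" if "c \<in> state_chains r l" for c r l
    using that by (cases r) (auto split: if_splits)
  have "(\<Sum>c\<in>state_chains (Suc r) k. g c) = (\<Sum>l\<in>interl k. sum g ((#) k ` state_chains r l))"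
    unfolding state_chains.simps
  proof (rule sum.UNION_disjoint)
    show "\<forall>l\<in>interl k. \<forall>l'\<in>interl k. l \<noteq> l' \<longrightarrow> (#) k ` state_chains r l \<inter> (#) k ` state_chains r l' = {}"
    proof (intro ballI impI)
      fix l l' :: "int list" assume ne: "l \<noteq> l'"
      have "l = l'" if "c \<in> state_chains r l" "c \<in> state_chains r l'" for c
        using hd[OF that(1)] hd[OF that(2)] empty[OF that(1)] empty[OF that(2)] by (cases "c = []") auto
      then show "(#) k ` state_chains r l \<inter> (#) k ` state_chains r l' = {}"
        using ne by blast
    qed
  qed (auto simp: finite_interl finite_state_chains)
  also have "\<dots> = (\<Sum>l\<in>interl k. \<Sum>c\<in>state_chains r l. g (k # c))"
    by (simp add: sum.reindex inj_on_def)
  finally show ?thesis .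
qed

text \<open>An interlacing row stays between the first and the last entry of its predecessor, so a
  value outside the span of \<open>k\<close> never enters the chain.\<close>

lemma occurrences_zero:
  assumes "c \<in> state_chains r k" "sorted_wrt (<) k" "(\<forall>u\<in>set k. v < u) \<or> (\<forall>u\<in>set k. u < v)"
  shows "occurrences v c = 0"
  using assms
proof (induction r arbitrary: k c)
  case (Suc r)
  then obtain l d where l: "l \<in> interl k" "d \<in> state_chains r l" "c = k # d" by auto
  have ne: "k \<noteq> []" using l(1) by auto
  have "(\<forall>u\<in>set l. v < u) \<or> (\<forall>u\<in>set l. u < v)"
    using interl_sorted(2)[OF Suc.prems(2) l(1)] Suc.prems(3) ne
    by (meson hd_in_set last_in_set order.strict_trans1 order.strict_trans2)
  then have "occurrences v d = 0"
    using Suc.IH l interl_sorted(1)[OF Suc.prems(2) l(1)] by blast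
  moreover have "v \<notin> set k" using Suc.prems(3) by auto
  ultimately show ?case by (simp add: l(3) occurrences_def)
qed (auto simp: occurrences_def split: if_splits)

lemma sum_beta_interval:
  "0 \<le> b \<Longrightarrow> (\<Sum>w\<in>{1..b}. beta s w) = beta (Suc s) b"
proof (induction b rule: int_ge_induct)
  case (step b)
  have "{1..b + 1} = insert (b + 1) {1..b}" using step by auto
  then show ?case using step beta_Suc[of s "b + 1"] by simp
qed simp

lemma occurrences_head:
  assumes "c \<in> state_chains r l" "v \<in> set l"
  shows "\<exists>s. occurrences v c = Suc s"
  using assms by (cases r) (auto simp: occurrences_def split: if_splits)

text \<open>Summation over the outermost entry raises the index of the weight by one, which accounts
  for one more state containing that entry.\<close>

lemma sum_weight_left:
  assumes k: "sorted_wrt (<) k" "\<forall>v\<in>set k. 1 \<le> v" and l: "l \<in> interl k" and c: "c \<in> state_chains r l" and x: "x \<le> 1"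
  shows "(\<Sum>x'\<in>left_range x l. weight (occurrences 1 c) (2 - x')) = weight (occurrences 1 (k # c)) (2 - x)"
proof -
  have ne: "k \<noteq> []" using l by auto
  have sl: "sorted_wrt (<) l" by (rule interl_sorted(1)[OF k(1) l])
  show ?thesis
  proof (cases "l \<noteq> [] \<and> hd l = 1")
    case True
    then have "hd k \<le> 1" using interl_sorted(2)[OF k(1) l, of 1] by (metis hd_in_set)
    then have "1 \<in> set k" using k(2) ne by (metis hd_in_set order_antisym)
    moreover obtain s where s: "occurrences 1 c = Suc s"
      using occurrences_head[OF c] True by (metis hd_in_set)
    moreover have "(\<Sum>x'\<in>{x..1}. beta s (2 - x')) = (\<Sum>w\<in>{1..2 - x}. beta s w)"
      by (rule sum.reindex_bij_witness[of _ "\<lambda>w. 2 - w" "\<lambda>x. 2 - x"]) auto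
    moreover have "occurrences 1 (k # c) = Suc (Suc s)" using calculation by (simp add: occurrences_def)
    ultimately show ?thesis
      using True x by (simp add: left_range_def sum_beta_interval)
  next
    case False
    have "\<forall>u\<in>set l. 1 < u"
    proof
      fix u assume u: "u \<in> set l"
      then have "hd l \<le> u" using sl by (cases l) (auto intro: less_imp_le)
      moreover have "l \<noteq> []" using u by auto
      then have "hd k \<le> hd l" using interl_sorted(2)[OF k(1) l] by simp
      then have "1 \<le> hd l" using k(2) ne by (meson hd_in_set order_trans)
      ultimately show "1 < u" using False \<open>l \<noteq> []\<close> by force
    qed
    then have "occurrences 1 c = 0" using occurrences_zero[OF c sl] by blast
    moreover have "occurrences 1 (k # c) = 0 \<or> occurrences 1 (k # c) = Suc 0"
      using calculation by (simp add: occurrences_def)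
    ultimately show ?thesis using False by (auto simp: left_range_def)
  qed
qed

lemma sum_weight_right:
  assumes k: "sorted_wrt (<) k" "\<forall>v\<in>set k. v \<le> n" and l: "l \<in> interl k" and c: "c \<in> state_chains r l" and z: "n \<le> z"
  shows "(\<Sum>z'\<in>right_range n z l. weight (occurrences n c) (z' - n + 1)) = weight (occurrences n (k # c)) (z - n + 1)"
proof -
  have ne: "k \<noteq> []" using l by auto
  have sl: "sorted_wrt (<) l" by (rule interl_sorted(1)[OF k(1) l])
  show ?thesis
  proof (cases "l \<noteq> [] \<and> last l = n")
    case True
    then have "n \<le> last k" using interl_sorted(2)[OF k(1) l, of n] by (metis last_in_set)
    then have "n \<in> set k" using k(2) ne by (metis last_in_set order_antisym)
    moreover obtain s where s: "occurrences n c = Suc s"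
      using occurrences_head[OF c] True by (metis last_in_set)
    moreover have "(\<Sum>z'\<in>{n..z}. beta s (z' - n + 1)) = (\<Sum>w\<in>{1..z - n + 1}. beta s w)"
      by (rule sum.reindex_bij_witness[of _ "\<lambda>w. w + n - 1" "\<lambda>z. z - n + 1"]) auto
    moreover have "occurrences n (k # c) = Suc (Suc s)" using calculation by (simp add: occurrences_def)
    ultimately show ?thesis
      using True z by (simp add: right_range_def sum_beta_interval)
  next
    case False
    have "\<forall>u\<in>set l. u < n"
    proof
      fix u assume u: "u \<in> set l"
      then have lne: "l \<noteq> []" by auto
      have "l = butlast l @ [last l]" using lne by simp
      then have "u \<le> last l" using sl u sorted_wrt_append[of "(<)" "butlast l" "[last l]"]
        by (metis Un_iff empty_iff insert_iff less_imp_le list.set(1) list.simps(15) order_refl set_append)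
      moreover have "last l \<le> last k" using interl_sorted(2)[OF k(1) l] lne by simp
      then have "last l \<le> n" using k(2) ne by (meson last_in_set order_trans)
      ultimately show "u < n" using False lne by force
    qed
    then have "occurrences n c = 0" using occurrences_zero[OF c sl] by blast
    moreover have "occurrences n (k # c) = 0 \<or> occurrences n (k # c) = Suc 0"
      using calculation by (simp add: occurrences_def)
    ultimately show ?thesis using False by (auto simp: right_range_def)
  qed
qed

text \<open>Collapsing all entries below 1 to 1 and all above n to n maps the triangles counted on
  the left to chains starting with \<open>k\<close>; the two weights count the fibres. The bound 2
  <= n keeps the two ends from meeting in one entry.\<close>

lemma tri_chains:
  assumes "2 \<le> n" "length k = r" "sorted_wrt (<) k" "\<forall>v\<in>set k. 1 \<le> v \<and> v \<le> n" "x \<le> 1" "n \<le> z"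
  shows "tri (set_left x (set_right n z k))
    = (\<Sum>c\<in>state_chains r k. weight (occurrences 1 c) (2 - x) * weight (occurrences n c) (z - n + 1))"
  using assms(2-)
proof (induction r arbitrary: k x z)
  case 0
  then show ?case by (simp add: set_left_def set_right_def tri_Nil occurrences_def)
next
  case (Suc r)
  have ne: "k \<noteq> []" using Suc.prems by auto
  let ?k = "set_right n z k"
  have k_snoc: "k = butlast k @ [last k]" using ne by simp
  have sorted_r: "sorted_wrt (<) ?k"
  proof (cases "last k = n")
    case True
    have "sorted_wrt (<) (butlast k @ [last k])" using Suc.prems(2) k_snoc by simp
    then show ?thesis using True Suc.prems(5) ne by (auto simp: set_right_def sorted_wrt_append)
  qed (use Suc.prems in \<open>simp add: set_right_def\<close>)
  have ne_r: "?k \<noteq> []" using ne by (simp add: set_right_def)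
  have hd_r: "1 \<le> hd ?k"
  proof (cases "butlast k")
    case Nil
    then have "k = [last k]" using k_snoc by simp
    then show ?thesis using Suc.prems assms(1) by (metis hd_in_set last_ConsL list.sel(1) list.set_intros(1) order_trans set_right_def append_self_conv2 Nil)
  next
    case (Cons a as)
    then have "hd ?k = hd k" by (metis append_is_Nil_conv hd_append2 list.distinct(1) k_snoc set_right_def)
    then show ?thesis using Suc.prems ne by simp
  qed
  have sorted_l: "sorted_wrt (<) (set_left x ?k)"
    using sorted_r Suc.prems(4) by (cases ?k) (auto simp: set_left_def)
  \<comment> \<open>Since 1 < n <= z', replacing a last entry n by z' neither creates nor destroys a
    leading 1.\<close>
  have left_right: "left_range x (set_right n z' l) = left_range x l" if "n \<le> z'" for z' l
    using that assms(1)
    by (cases l rule: rev_cases; cases "butlast l") (auto simp: left_range_def set_right_def hd_append)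
  have "tri (set_left x ?k) = sum tri (interl (set_left x ?k))"
    by (rule tri_sum_interl[OF sorted_l]) (simp add: set_left_def ne_r)
  also have "\<dots> = (\<Sum>l\<in>interl ?k. \<Sum>x'\<in>left_range x l. tri (set_left x' l))"
    by (rule sum_interl_set_left[OF sorted_r ne_r hd_r Suc.prems(4)])
  also have "\<dots> = (\<Sum>l\<in>interl k. \<Sum>z'\<in>right_range n z l. \<Sum>x'\<in>left_range x (set_right n z' l). tri (set_left x' (set_right n z' l)))"
    by (rule sum_interl_set_right) (use Suc.prems ne in auto)
  also have "\<dots> = (\<Sum>l\<in>interl k. \<Sum>z'\<in>right_range n z l. \<Sum>x'\<in>left_range x l. tri (set_left x' (set_right n z' l)))"
    by (intro sum.cong refl) (use Suc.prems left_right in \<open>auto simp: right_range_def split: if_splits\<close>)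
  also have "\<dots> = (\<Sum>l\<in>interl k. \<Sum>c\<in>state_chains r l. weight (occurrences 1 (k # c)) (2 - x) * weight (occurrences n (k # c)) (z - n + 1))"
  proof (rule sum.cong[OF refl])
    fix l assume l: "l \<in> interl k"
    have IH: "tri (set_left x' (set_right n z' l)) = (\<Sum>c\<in>state_chains r l. weight (occurrences 1 c) (2 - x') * weight (occurrences n c) (z' - n + 1))"
      if "x' \<in> left_range x l" "z' \<in> right_range n z l" for x' z'
    proof (rule Suc.IH)
      show "length l = r" using length_interl[OF l] Suc.prems(1) by simp
      show "sorted_wrt (<) l" by (rule interl_sorted(1)[OF Suc.prems(2) l])
      show "\<forall>v\<in>set l. 1 \<le> v \<and> v \<le> n"
        using interl_sorted(2)[OF Suc.prems(2) l] Suc.prems(3) ne by (meson hd_in_set last_in_set order_trans)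
    qed (use that Suc.prems in \<open>auto simp: left_range_def right_range_def split: if_splits\<close>)
    have "(\<Sum>z'\<in>right_range n z l. \<Sum>x'\<in>left_range x l. tri (set_left x' (set_right n z' l)))
      = (\<Sum>z'\<in>right_range n z l. \<Sum>x'\<in>left_range x l. \<Sum>c\<in>state_chains r l. weight (occurrences 1 c) (2 - x') * weight (occurrences n c) (z' - n + 1))"
      by (intro sum.cong refl IH)
    also have "\<dots> = (\<Sum>c\<in>state_chains r l. \<Sum>z'\<in>right_range n z l. \<Sum>x'\<in>left_range x l. weight (occurrences 1 c) (2 - x') * weight (occurrences n c) (z' - n + 1))"
      by (simp add: sum.swap[of _ _ "state_chains r l"])
    also have "\<dots> = (\<Sum>c\<in>state_chains r l. (\<Sum>x'\<in>left_range x l. weight (occurrences 1 c) (2 - x')) * (\<Sum>z'\<in>right_range n z l. weight (occurrences n c) (z' - n + 1)))"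
      by (intro sum.cong refl) (simp add: sum_product sum.swap[of _ "left_range x l"])
    also have "\<dots> = (\<Sum>c\<in>state_chains r l. weight (occurrences 1 (k # c)) (2 - x) * weight (occurrences n (k # c)) (z - n + 1))"
    proof (rule sum.cong[OF refl])
      fix c assume c: "c \<in> state_chains r l"
      have "\<forall>v\<in>set k. 1 \<le> v" "\<forall>v\<in>set k. v \<le> n" using Suc.prems(3) by auto
      then show "(\<Sum>x'\<in>left_range x l. weight (occurrences 1 c) (2 - x')) * (\<Sum>z'\<in>right_range n z l. weight (occurrences n c) (z' - n + 1))
        = weight (occurrences 1 (k # c)) (2 - x) * weight (occurrences n (k # c)) (z - n + 1)"
        using sum_weight_left[OF Suc.prems(2) _ l c Suc.prems(4)] sum_weight_right[OF Suc.prems(2) _ l c Suc.prems(5)] by simp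
    qed
    finally show "(\<Sum>z'\<in>right_range n z l. \<Sum>x'\<in>left_range x l. tri (set_left x' (set_right n z' l)))
      = (\<Sum>c\<in>state_chains r l. weight (occurrences 1 (k # c)) (2 - x) * weight (occurrences n (k # c)) (z - n + 1))" .
  qed
  also have "\<dots> = (\<Sum>c\<in>state_chains (Suc r) k. weight (occurrences 1 c) (2 - x) * weight (occurrences n c) (z - n + 1))"
    by (rule sum_chains_Suc[symmetric])
  finally show ?case .
qed

section \<open>Alternating sign matrices as chains of states\<close>

definition count_le :: "int list \<Rightarrow> int \<Rightarrow> nat" where
  "count_le l c = length (filter (\<lambda>v. v \<le> c) l)"

lemma count_le_simps [simp]:
  "count_le [] c = 0"
  "count_le (v # l) c = (if v \<le> c then Suc (count_le l c) else count_le l c)"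
  by (simp_all add: count_le_def)

lemma count_le_zero: "(\<And>v. v \<in> set l \<Longrightarrow> c < v) \<Longrightarrow> count_le l c = 0"
  by (force simp: count_le_def filter_empty_conv)

text \<open>Interlacing of increasing lists means that up to any point c the longer list is ahead by
  0 or 1 entries. In this form it can be compared with the prefix sums of a matrix row.\<close>

lemma interl_iff_counts_aux:
  "sorted_wrt (<) r \<Longrightarrow> (r \<noteq> [] \<Longrightarrow> a \<le> hd r) \<Longrightarrow> sorted_wrt (<) l \<Longrightarrow>
    l \<in> interl (a # r) \<longleftrightarrow>
      length r = length l \<and> (\<forall>c. count_le l c \<le> count_le (a # r) c \<and> count_le (a # r) c \<le> Suc (count_le l c))"
proof (induction r arbitrary: a l)
  case (Cons b r)
  have hd: "r \<noteq> [] \<Longrightarrow> b + 1 \<le> hd r" using Cons.prems(1) by (cases r) auto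
  have r0: "count_le r c = 0" if "c \<le> b" for c
    by (rule count_le_zero) (use Cons.prems(1) that in auto)
  have IH: "ys \<in> interl (b' # r) \<longleftrightarrow>
      length r = length ys \<and> (\<forall>c. count_le ys c \<le> count_le (b' # r) c \<and> count_le (b' # r) c \<le> Suc (count_le ys c))"
    if "b' \<le> b + 1" "sorted_wrt (<) ys" for b' ys
    by (rule Cons.IH) (use Cons.prems(1) hd that in \<open>auto intro: order_trans\<close>)
  have ab: "a \<le> b" using Cons.prems(2) by simp
  show ?case
  proof (cases l)
    case Nil
    then show ?thesis by auto
  next
    case (Cons l0 ys)
    have ys: "sorted_wrt (<) ys" "\<And>v. v \<in> set ys \<Longrightarrow> l0 < v"
      using Cons.prems(3) Cons by auto
    have ys0: "count_le ys c = 0" if "c \<le> l0" for c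
      by (rule count_le_zero) (use ys that in force)
    have mem: "l \<in> interl (a # b # r) \<longleftrightarrow>
        (a \<le> l0 \<and> l0 < b \<and> ys \<in> interl (b # r)) \<or> (l0 = b \<and> ys \<in> interl ((b + 1) # r))"
      using Cons by auto
    show ?thesis
    proof
      assume "l \<in> interl (a # b # r)"
      then consider "a \<le> l0" "l0 < b" "ys \<in> interl (b # r)" | "l0 = b" "ys \<in> interl ((b + 1) # r)"
        unfolding mem by blast
      then show "length (b # r) = length l \<and>
        (\<forall>c. count_le l c \<le> count_le (a # b # r) c \<and> count_le (a # b # r) c \<le> Suc (count_le l c))"
      proof cases
        case 1
        have len: "length r = length ys" and
          *: "count_le ys c \<le> count_le (b # r) c \<and> count_le (b # r) c \<le> Suc (count_le ys c)" for c
          using 1(3) IH[of b ys] ys by auto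
        have "count_le l c \<le> count_le (a # b # r) c \<and> count_le (a # b # r) c \<le> Suc (count_le l c)" for c
          using *[of c] 1 Cons ys0[of c] r0[of c] by (auto split: if_splits)
        then show ?thesis using len Cons by simp
      next
        case 2
        have len: "length r = length ys" and
          *: "count_le ys c \<le> count_le ((b + 1) # r) c \<and> count_le ((b + 1) # r) c \<le> Suc (count_le ys c)" for c
          using 2(2) IH[of "b + 1" ys] ys by auto
        have "count_le l c \<le> count_le (a # b # r) c \<and> count_le (a # b # r) c \<le> Suc (count_le l c)" for c
          using *[of c] 2 Cons ys0[of c] r0[of c] ab by (auto split: if_splits)
        then show ?thesis using len Cons by simp
      qed
    next
      assume R: "length (b # r) = length l \<and>
        (\<forall>c. count_le l c \<le> count_le (a # b # r) c \<and> count_le (a # b # r) c \<le> Suc (count_le l c))"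
      have len: "length r = length ys" using R Cons by simp
      have *: "count_le (l0 # ys) c \<le> count_le (a # b # r) c" "count_le (a # b # r) c \<le> Suc (count_le (l0 # ys) c)" for c
        using R Cons by auto
      \<comment> \<open>The count at c = l0 forces an entry of the longer list to be at most l0; the
        count at c = b, where that list already has two entries, forces l0 <= b.\<close>
      have al: "a \<le> l0"
        using *(1)[of l0] ab r0[of l0] by (auto split: if_splits)
      have lb: "l0 \<le> b"
        using *(2)[of b] ab ys0[of b] by (auto split: if_splits)
      show "l \<in> interl (a # b # r)"
      proof (cases "l0 < b")
        case True
        have "count_le ys c \<le> count_le (b # r) c \<and> count_le (b # r) c \<le> Suc (count_le ys c)" for c
          using *[of c] al True ys0[of c] r0[of c] by (cases "l0 \<le> c") (auto split: if_splits)
        then have "ys \<in> interl (b # r)" using IH[of b ys] ys len by auto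
        then show ?thesis unfolding mem using al True by blast
      next
        case False
        then have "l0 = b" using lb by simp
        have "count_le ys c \<le> count_le ((b + 1) # r) c \<and> count_le ((b + 1) # r) c \<le> Suc (count_le ys c)" for c
          using *[of c] ab \<open>l0 = b\<close> ys0[of c] r0[of c] by (cases "b + 1 \<le> c") (auto split: if_splits)
        then have "ys \<in> interl ((b + 1) # r)" using IH[of "b + 1" ys] ys len by auto
        then show ?thesis unfolding mem using \<open>l0 = b\<close> by blast
      qed
    qed
  qed
qed auto

lemma interl_iff_counts:
  assumes "sorted_wrt (<) k" "sorted_wrt (<) l"
  shows "l \<in> interl k \<longleftrightarrow> length k = Suc (length l) \<and>
    (\<forall>c. count_le l c \<le> count_le k c \<and> count_le k c \<le> Suc (count_le l c))"
proof (cases k)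
  case (Cons a r)
  have "l \<in> interl (a # r) \<longleftrightarrow>
      length r = length l \<and> (\<forall>c. count_le l c \<le> count_le (a # r) c \<and> count_le (a # r) c \<le> Suc (count_le l c))"
    by (rule interl_iff_counts_aux) (use assms Cons in \<open>auto intro: less_imp_le\<close>)
  then show ?thesis using Cons by auto
qed simp

section \<open>Sets of columns as increasing lists\<close>

definition columns :: "nat \<Rightarrow> (nat \<Rightarrow> bool) \<Rightarrow> int list" where
  "columns n P = filter (\<lambda>v. P (nat v)) [1..int n]"

lemma sorted_columns: "sorted_wrt (<) (columns n P)"
  unfolding columns_def by (rule sorted_wrt_filter) (rule sorted_wrt_upto)

lemma in_columns: "int j \<in> set (columns n P) \<longleftrightarrow> 1 \<le> j \<and> j \<le> n \<and> P j"
  by (auto simp: columns_def)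

lemma set_columns: "v \<in> set (columns n P) \<Longrightarrow> 1 \<le> v \<and> v \<le> int n"
  by (auto simp: columns_def)

lemma upto_Suc: "[1..int (Suc m)] = [1..int m] @ [int (Suc m)]"
  using upto_rec2[of 1 "int (Suc m)"] by simp

lemma length_columns: "int (length (columns n P)) = (\<Sum>j=1..n. of_bool (P j))"
proof (induction n)
  case (Suc n)
  have "columns (Suc n) P = columns n P @ (if P (Suc n) then [int (Suc n)] else [])"
    unfolding columns_def upto_Suc by (simp del: of_nat_Suc)
  then show ?case using Suc by simp
qed (simp add: columns_def)

lemma count_le_columns: "m \<le> n \<Longrightarrow> count_le (columns n P) (int m) = length (columns m P)"
proof -
  assume "m \<le> n"
  then have "filter (\<lambda>v. v \<le> int m) [1..int n] = [1..int m]"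
  proof (induction n rule: dec_induct)
    case (step n)
    then show ?case unfolding upto_Suc by simp
  qed (simp add: filter_id_conv)
  then have "filter (\<lambda>v. P (nat v)) (filter (\<lambda>v. v \<le> int m) [1..int n]) = columns m P"
    by (simp add: columns_def)
  then show ?thesis
    by (simp add: count_le_def columns_def conj_commute)
qed

lemma count_le_columns_clamp: "count_le (columns n P) c = count_le (columns n P) (int (nat (min c (int n))))"
proof -
  have "filter (\<lambda>v. v \<le> c) (columns n P) = filter (\<lambda>v. v \<le> int (nat (min c (int n)))) (columns n P)"
    by (rule filter_cong[OF refl]) (use set_columns in force)
  then show ?thesis by (simp add: count_le_def)
qed

text \<open>The right-hand side is the prefix-sum condition for a row of an alternating sign matrix
  with entries [P j] - [Q j]. It holds because prefix sums of indicators are the counts in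
  \<open>interl_iff_counts\<close>.\<close>

lemma interl_columns_iff:
  "columns n Q \<in> interl (columns n P) \<longleftrightarrow>
    (\<forall>m\<le>n. (\<Sum>j=1..m. of_bool (P j) - of_bool (Q j) :: int) \<in> {0, 1})
    \<and> (\<Sum>j=1..n. of_bool (P j) - of_bool (Q j) :: int) = 1"
proof -
  have len: "(\<Sum>j=1..m. of_bool (P j) - of_bool (Q j) :: int) = int (length (columns m P)) - int (length (columns m Q))" for m
    by (simp add: sum_subtractf length_columns)
  have "columns n Q \<in> interl (columns n P) \<longleftrightarrow> length (columns n P) = Suc (length (columns n Q)) \<and>
    (\<forall>c. count_le (columns n Q) c \<le> count_le (columns n P) c \<and> count_le (columns n P) c \<le> Suc (count_le (columns n Q) c))"
    by (rule interl_iff_counts) (rule sorted_columns)+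
  also have "(\<forall>c. count_le (columns n Q) c \<le> count_le (columns n P) c \<and> count_le (columns n P) c \<le> Suc (count_le (columns n Q) c))
    \<longleftrightarrow> (\<forall>m\<le>n. count_le (columns n Q) (int m) \<le> count_le (columns n P) (int m) \<and> count_le (columns n P) (int m) \<le> Suc (count_le (columns n Q) (int m)))"
    (is "(\<forall>c. ?C c) \<longleftrightarrow> _")
  proof
    assume *: "\<forall>m\<le>n. ?C (int m)"
    show "\<forall>c. ?C c"
    proof
      fix c
      have "nat (min c (int n)) \<le> n" by simp
      then have "?C (int (nat (min c (int n))))" using * by blast
      then show "?C c" by (simp only: count_le_columns_clamp[of n _ c])
    qed
  qed blast
  moreover have "int a - int b \<in> {0, 1} \<longleftrightarrow> b \<le> a \<and> a \<le> Suc b" "int a - int b = 1 \<longleftrightarrow> a = Suc b" for a b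
    by auto
  ultimately show ?thesis
    unfolding len by (auto simp: count_le_columns)
qed

lemma sorted_eq_columns:
  assumes "sorted_wrt (<) l" "\<And>v. v \<in> set l \<Longrightarrow> 1 \<le> v \<and> v \<le> int n"
  shows "l = columns n (\<lambda>j. int j \<in> set l)"
proof (rule sorted_distinct_set_unique)
  show "sorted l" "distinct l"
    using assms(1) by (simp_all add: strict_sorted_iff)
  show "sorted (columns n (\<lambda>j. int j \<in> set l))" "distinct (columns n (\<lambda>j. int j \<in> set l))"
    using sorted_columns by (simp_all add: strict_sorted_iff)
  show "set l = set (columns n (\<lambda>j. int j \<in> set l))"
    using assms(2) by (force simp: columns_def)
qed

section \<open>Alternation of signs and prefix sums\<close>

lemma prefix_imp_alternating:
  assumes "\<forall>m\<le>n. (\<Sum>j=1..m. v j) \<in> {0, 1}"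
  shows "alternating_line n v"
  unfolding alternating_line_def
proof (intro allI impI)
  fix j1 j2
  assume *: "1 \<le> j1 \<and> j1 < j2 \<and> j2 \<le> n \<and> v j1 \<noteq> 0 \<and> v j2 \<noteq> 0 \<and> (\<forall>j. j1 < j \<and> j < j2 \<longrightarrow> v j = 0)"
  define P where "P m = (\<Sum>j=1..m. v j)" for m
  have P: "P m \<in> {0, 1}" if "m \<le> n" for m using assms that by (auto simp: P_def)
  have step: "P (Suc m) = P m + v (Suc m)" for m by (simp add: P_def)
  obtain i1 where i1: "j1 = Suc i1" using * by (cases j1) auto
  obtain i2 where i2: "j2 = Suc i2" using * by (cases j2) auto
  have "P m = P j1" if "j1 \<le> m" "m \<le> i2" for m
    using that
  proof (induction m rule: dec_induct)
    case (step m)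
    then show ?case using * i2 \<open>\<And>m. P (Suc m) = P m + v (Suc m)\<close>[of m] by simp
  qed simp
  from this[of i2] have "P i2 = P j1" using * i2 by linarith
  moreover have "P i1 \<in> {0, 1}" "P j1 \<in> {0, 1}" "P j2 \<in> {0, 1}" using P * i1 by auto
  moreover have "P j1 = P i1 + v j1" "P j2 = P i2 + v j2" using step i1 i2 by auto
  ultimately show "v j2 = - v j1" using * by auto
qed

lemma alternating_imp_prefix:
  assumes "alternating_line n v" "\<forall>j\<in>{1..n}. v j \<in> {- 1, 0, 1}" "(\<Sum>j=1..n. v j) = 1"
  shows "\<forall>m\<le>n. (\<Sum>j=1..m. v j) \<in> {0, 1}"
proof -
  define P where "P m = (\<Sum>j=1..m. v j)" for m
  have step: "P (Suc m) = P m + v (Suc m)" for m by (simp add: P_def)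
  \<comment> \<open>Here \<open>e\<close> is the sign of the first nonzero entry, arbitrary while
    there is none. Prefix sums stay in {0, e}, and the latest nonzero entry is e exactly when the
    current sum is e. Only the total 1 excludes e = -1 at the end.\<close>
  have "\<exists>e\<in>{- 1, 1}. (\<forall>d\<le>m. P d \<in> {0, e})
      \<and> (\<forall>j. 1 \<le> j \<and> j \<le> m \<and> v j \<noteq> 0 \<and> (\<forall>j'. j < j' \<and> j' \<le> m \<longrightarrow> v j' = 0) \<longrightarrow> v j \<in> {e, - e} \<and> (v j = e \<longleftrightarrow> P m = e))
      \<and> ((\<forall>j. 1 \<le> j \<and> j \<le> m \<longrightarrow> v j = 0) \<longrightarrow> (\<forall>d\<le>m. P d = 0))" if "m \<le> n" for m
    using that
  proof (induction m)
    case 0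
    then show ?case by (auto simp: P_def)
  next
    case (Suc m)
    then obtain e where e: "e \<in> {- 1, 1}" "\<forall>d\<le>m. P d \<in> {0, e}"
      and last: "\<And>j. 1 \<le> j \<Longrightarrow> j \<le> m \<Longrightarrow> v j \<noteq> 0 \<Longrightarrow> (\<And>j'. j < j' \<Longrightarrow> j' \<le> m \<Longrightarrow> v j' = 0) \<Longrightarrow>
        v j \<in> {e, - e} \<and> (v j = e \<longleftrightarrow> P m = e)"
      and zero: "(\<And>j. 1 \<le> j \<Longrightarrow> j \<le> m \<Longrightarrow> v j = 0) \<Longrightarrow> (\<forall>d\<le>m. P d = 0)"
      by (metis Suc_leD)
    show ?case
    proof (cases "v (Suc m) = 0")
      case True
      show ?thesis
      proof (rule bexI[OF _ e(1)], intro conjI)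
        show "\<forall>d\<le>Suc m. P d \<in> {0, e}" using e True step[of m] by (auto simp: le_Suc_eq)
        show "\<forall>j. 1 \<le> j \<and> j \<le> Suc m \<and> v j \<noteq> 0 \<and> (\<forall>j'. j < j' \<and> j' \<le> Suc m \<longrightarrow> v j' = 0) \<longrightarrow>
          v j \<in> {e, - e} \<and> (v j = e \<longleftrightarrow> P (Suc m) = e)"
          using last True step[of m] by (metis add.right_neutral le_SucE le_SucI)
        show "(\<forall>j. 1 \<le> j \<and> j \<le> Suc m \<longrightarrow> v j = 0) \<longrightarrow> (\<forall>d\<le>Suc m. P d = 0)"
          using zero True step[of m] by (auto simp: le_Suc_eq)
      qed
    next
      case False
      show ?thesis
      proof (cases "\<forall>j. 1 \<le> j \<and> j \<le> m \<longrightarrow> v j = 0")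
        case True
        then have P0: "\<forall>d\<le>m. P d = 0" using zero by blast
        have "v (Suc m) \<in> {- 1, 0, 1}" using assms(2) Suc.prems by auto
        then show ?thesis
          using False P0 step[of m] by (intro bexI[of _ "v (Suc m)"]) (auto simp: le_Suc_eq True)
      next
        case nz: False
        define S where "S = {j. 1 \<le> j \<and> j \<le> m \<and> v j \<noteq> 0}"
        have S: "finite S" "S \<noteq> {}" using nz by (auto simp: S_def)
        define j0 where "j0 = Max S"
        have j0: "1 \<le> j0" "j0 \<le> m" "v j0 \<noteq> 0" using Max_in[OF S] by (auto simp: j0_def S_def)
        have after: "v j' = 0" if "j0 < j'" "j' \<le> m" for j'
        proof (rule ccontr)
          assume "v j' \<noteq> 0"
          then have "j' \<in> S" using that j0 by (auto simp: S_def)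
          then show False using Max_ge[OF S(1), of j'] that by (simp add: j0_def)
        qed
        have "v (Suc m) = - v j0"
          using assms(1)[unfolded alternating_line_def, rule_format, of j0 "Suc m"] j0 after False Suc.prems by auto
        moreover have "v j0 \<in> {e, - e} \<and> (v j0 = e \<longleftrightarrow> P m = e)"
          by (rule last) (use j0 after in auto)
        moreover have "P m \<in> {0, e}" using e by auto
        ultimately have vP: "v (Suc m) \<in> {e, - e}" "P (Suc m) \<in> {0, e}" "v (Suc m) = e \<longleftrightarrow> P (Suc m) = e"
          using step[of m] e(1) by auto
        show ?thesis
        proof (rule bexI[OF _ e(1)], intro conjI)
          show "\<forall>d\<le>Suc m. P d \<in> {0, e}" using e vP by (auto simp: le_Suc_eq)
          show "\<forall>j. 1 \<le> j \<and> j \<le> Suc m \<and> v j \<noteq> 0 \<and> (\<forall>j'. j < j' \<and> j' \<le> Suc m \<longrightarrow> v j' = 0) \<longrightarrow>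
            v j \<in> {e, - e} \<and> (v j = e \<longleftrightarrow> P (Suc m) = e)"
            using vP False by (metis le_neq_implies_less order_refl)
          show "(\<forall>j. 1 \<le> j \<and> j \<le> Suc m \<longrightarrow> v j = 0) \<longrightarrow> (\<forall>d\<le>Suc m. P d = 0)"
            using False by auto
        qed
      qed
    qed
  qed
  from this[of n] obtain e where "\<forall>d\<le>n. P d \<in> {0, e}" by auto
  moreover have "P n = 1" using assms(3) by (simp add: P_def)
  ultimately have "\<forall>d\<le>n. P d \<in> {0, 1}" by (metis insertE insertI1 order_refl singletonD zero_neq_one insertI2)
  then show ?thesis by (simp add: P_def)
qed

section \<open>Column tails and the states of a matrix\<close>

definition col_tail :: "nat \<Rightarrow> (nat \<Rightarrow> nat \<Rightarrow> int) \<Rightarrow> nat \<Rightarrow> nat \<Rightarrow> int" where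
  "col_tail n A r c = (\<Sum>r'=r..n. A r' c)"

lemma col_tail_Suc: "r \<le> n \<Longrightarrow> col_tail n A r c = A r c + col_tail n A (Suc r) c"
  by (simp add: col_tail_def sum.atLeast_Suc_atMost)

lemma col_tail_last [simp]: "col_tail n A (Suc n) c = 0"
  by (simp add: col_tail_def)

lemma prefix_col_tail:
  assumes "m \<le> n"
  shows "(\<Sum>r=1..m. A r c) = col_tail n A 1 c - col_tail n A (Suc m) c"
  using assms
proof (induction m)
  case (Suc m)
  then show ?case using col_tail_Suc[of "Suc m" n A c] by simp
qed simp

lemma is_asm_iff:
  "is_asm n A \<longleftrightarrow>
    (\<forall>r c. r \<notin> {1..n} \<or> c \<notin> {1..n} \<longrightarrow> A r c = 0) \<and>
    (\<forall>r\<in>{1..n}. (\<forall>m\<le>n. (\<Sum>c=1..m. A r c) \<in> {0, 1}) \<and> (\<Sum>c=1..n. A r c) = 1) \<and>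
    (\<forall>c\<in>{1..n}. (\<forall>r\<in>{1..n}. col_tail n A r c \<in> {0, 1}) \<and> col_tail n A 1 c = 1)"
  (is "_ \<longleftrightarrow> ?supp \<and> ?rows \<and> ?cols")
proof
  assume asm: "is_asm n A"
  have rows: ?rows
  proof
    fix r assume "r \<in> {1..n}"
    then have "alternating_line n (A r)" "\<forall>j\<in>{1..n}. A r j \<in> {- 1, 0, 1}" "(\<Sum>c=1..n. A r c) = 1"
      using asm unfolding is_asm_def by auto
    then show "(\<forall>m\<le>n. (\<Sum>c=1..m. A r c) \<in> {0, 1}) \<and> (\<Sum>c=1..n. A r c) = 1"
      using alternating_imp_prefix by blast
  qed
  have cols: ?cols
  proof
    fix c assume "c \<in> {1..n}"
    then have *: "alternating_line n (\<lambda>r. A r c)" "\<forall>j\<in>{1..n}. A j c \<in> {- 1, 0, 1}" "(\<Sum>r=1..n. A r c) = 1"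
      using asm unfolding is_asm_def by auto
    have prefix: "\<forall>m\<le>n. (\<Sum>r=1..m. A r c) \<in> {0, 1}"
      by (rule alternating_imp_prefix[OF *])
    have one: "col_tail n A 1 c = 1" using *(3) by (simp add: col_tail_def)
    have "col_tail n A r c \<in> {0, 1}" if "r \<in> {1..n}" for r
    proof -
      define m where "m = r - 1"
      have m: "r = Suc m" "m \<le> n" using that by (auto simp: m_def)
      have "(\<Sum>r=1..m. A r c) = 1 - col_tail n A r c" using prefix_col_tail[OF m(2), of A c] one m by simp
      moreover have "(\<Sum>r=1..m. A r c) \<in> {0, 1}" using prefix m by blast
      ultimately show ?thesis by auto
    qed
    then show "(\<forall>r\<in>{1..n}. col_tail n A r c \<in> {0, 1}) \<and> col_tail n A 1 c = 1" using one by blast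
  qed
  show "?supp \<and> ?rows \<and> ?cols" using asm rows cols unfolding is_asm_def by blast
next
  assume *: "?supp \<and> ?rows \<and> ?cols"
  then have supp: ?supp and rows: ?rows and cols: ?cols by blast+
  have entries: "A r c \<in> {- 1, 0, 1}" for r c
  proof (cases "r \<in> {1..n} \<and> c \<in> {1..n}")
    case True
    then obtain m where m: "c = Suc m" by (cases c) auto
    have "\<forall>m\<le>n. (\<Sum>c=1..m. A r c) \<in> {0, 1}" using rows True by blast
    then have "(\<Sum>c=1..m. A r c) \<in> {0, 1}" "(\<Sum>c=1..Suc m. A r c) \<in> {0, 1}"
      using True m by (auto simp del: sum.cl_ivl_Suc)
    then show ?thesis using m by auto
  next
    case False
    then show ?thesis using supp by auto
  qed
  have tails: "(\<Sum>r=1..m. A r c) \<in> {0, 1}" if "c \<in> {1..n}" "m \<le> n" for m c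
  proof (cases "m = n")
    case True
    then show ?thesis using prefix_col_tail[of n n A c] cols that by simp
  next
    case False
    then have "col_tail n A (Suc m) c \<in> {0, 1}" using cols that by auto
    moreover have "col_tail n A 1 c = 1" using cols that by auto
    ultimately show ?thesis using prefix_col_tail[OF that(2), of A c] by auto
  qed
  show "is_asm n A"
    unfolding is_asm_def
  proof (intro conjI ballI)
    show "\<forall>r c. A r c \<in> {- 1, 0, 1}" using entries by blast
    show ?supp by (rule supp)
    show "(\<Sum>c=1..n. A r c) = 1" if "r \<in> {1..n}" for r using rows that by blast
    show "(\<Sum>r=1..n. A r c) = 1" if "c \<in> {1..n}" for c
      using cols that unfolding col_tail_def by blast
    show "alternating_line n (\<lambda>c. A r c)" if "r \<in> {1..n}" for r
      by (rule prefix_imp_alternating) (use rows that in blast)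
    show "alternating_line n (\<lambda>r. A r c)" if "c \<in> {1..n}" for c
      by (rule prefix_imp_alternating) (use tails that in blast)
  qed
qed

text \<open>Tails are taken from below so that the states of an alternating sign matrix lose one
  column per row and begin, just below the top row, with all columns except the position of the top
  1. This is a list with a gap, as in the block formula.\<close>

definition state :: "nat \<Rightarrow> (nat \<Rightarrow> nat \<Rightarrow> int) \<Rightarrow> nat \<Rightarrow> int list" where
  "state n A r = columns n (\<lambda>c. col_tail n A r c = 1)"

definition states :: "nat \<Rightarrow> (nat \<Rightarrow> nat \<Rightarrow> int) \<Rightarrow> int list list" where
  "states n A = map (state n A) [2..<n + 1]"

lemma asm_state_interl:
  assumes "is_asm n A" "r \<in> {1..n}"
  shows "state n A (Suc r) \<in> interl (state n A r)"
proof -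
  have "of_bool (col_tail n A r j = 1) - of_bool (col_tail n A (Suc r) j = 1) = A r j" if "j \<in> {1..n}" for j
  proof -
    have "col_tail n A r j \<in> {0, 1}" using assms that unfolding is_asm_iff by blast
    moreover have "col_tail n A (Suc r) j \<in> {0, 1}"
    proof (cases "r = n")
      case False
      then have "Suc r \<in> {1..n}" using assms(2) by auto
      then show ?thesis using assms(1) that unfolding is_asm_iff by blast
    qed simp
    ultimately show ?thesis using col_tail_Suc[of r n A j] assms(2) by auto
  qed
  then have "(\<Sum>j=1..m. of_bool (col_tail n A r j = 1) - of_bool (col_tail n A (Suc r) j = 1)) = (\<Sum>j=1..m. A r j)"
    if "m \<le> n" for m
    using that by (intro sum.cong) auto
  then show ?thesis
    using assms unfolding state_def interl_columns_iff is_asm_iff by simp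
qed

lemma state_chains_map:
  "(\<And>j. j < r \<Longrightarrow> g (Suc j) \<in> interl (g j)) \<Longrightarrow> g r = [] \<Longrightarrow> map g [0..<r] \<in> state_chains r (g 0)"
proof (induction r arbitrary: g)
  case (Suc r)
  have "map (\<lambda>j. g (Suc j)) [0..<r] \<in> state_chains r (g (Suc 0))"
    by (rule Suc.IH) (use Suc.prems in auto)
  moreover have "map g [0..<Suc r] = g 0 # map (\<lambda>j. g (Suc j)) [0..<r]"
    by (simp add: upt_conv_Cons map_Suc_upt[symmetric] del: upt_Suc)
  moreover have "g (Suc 0) \<in> interl (g 0)" using Suc.prems(1)[of 0] by simp
  ultimately show ?case by auto
qed simp

lemma state_chains_nth:
  "c \<in> state_chains r k \<Longrightarrow> length c = r \<and> (if r = 0 then k = [] else c ! 0 = k \<and>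
     (\<forall>j. Suc j < r \<longrightarrow> c ! Suc j \<in> interl (c ! j)) \<and> [] \<in> interl (c ! (r - 1)))"
proof (induction r arbitrary: c k)
  case 0
  then show ?case by (auto split: if_splits)
next
  case (Suc r)
  then obtain l d where d: "l \<in> interl k" "d \<in> state_chains r l" "c = k # d" by auto
  note IH = Suc.IH[OF d(2)]
  show ?case
  proof (cases r)
    case 0
    then show ?thesis using IH d by auto
  next
    case (Suc r')
    have "c ! Suc j \<in> interl (c ! j)" if "Suc j < Suc r" for j
      using IH d that Suc by (cases j) auto
    moreover have "[] \<in> interl (c ! r)" using IH d Suc by simp
    ultimately show ?thesis using IH d by simp
  qed
qed

lemma state_chains_sorted:
  assumes "c \<in> state_chains r k" "sorted_wrt (<) k" "\<And>v. v \<in> set k \<Longrightarrow> 1 \<le> v \<and> v \<le> N" "l \<in> set c"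
  shows "sorted_wrt (<) l \<and> (\<forall>v\<in>set l. 1 \<le> v \<and> v \<le> N)"
  using assms
proof (induction r arbitrary: c k)
  case 0
  then show ?case by (auto split: if_splits)
next
  case (Suc r)
  then obtain l' d where d: "l' \<in> interl k" "d \<in> state_chains r l'" "c = k # d" by auto
  have ne: "k \<noteq> []" using d(1) by auto
  show ?case
  proof (cases "l = k")
    case True
    then show ?thesis using Suc.prems by blast
  next
    case False
    show ?thesis
    proof (rule Suc.IH[OF d(2)])
      show "sorted_wrt (<) l'" by (rule interl_sorted(1)[OF Suc.prems(2) d(1)])
      show "1 \<le> v \<and> v \<le> N" if "v \<in> set l'" for v
        using interl_sorted(2)[OF Suc.prems(2) d(1) that] Suc.prems(3)[OF hd_in_set[OF ne]]
          Suc.prems(3)[OF last_in_set[OF ne]] by linarith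
      show "l \<in> set d" using False Suc.prems(4) d(3) by simp
    qed
  qed
qed

text \<open>A full column tail is 1 and the next one is 0 or 1, so the top row is nonnegative; with
  row sum 1 all its entries besides the given 1 vanish.\<close>

lemma asm_top_row:
  assumes "is_asm n A" "1 \<le> n" "i \<in> {1..n}" "A 1 i = 1"
  shows "state n A 2 = columns n (\<lambda>j. j \<noteq> i)"
proof -
  have n1: "1 \<in> {1..n}" using assms(2) by simp
  have A: "A 1 j = 1 - col_tail n A 2 j" if "j \<in> {1..n}" for j
    using col_tail_Suc[of 1 n A j] assms(1,2) that unfolding is_asm_iff by (auto simp: numeral_2_eq_2)
  have tail: "col_tail n A 2 j \<in> {0, 1}" if "j \<in> {1..n}" for j
  proof (cases "2 \<le> n")
    case True
    then show ?thesis using assms(1) that unfolding is_asm_iff by auto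
  next
    case False
    then have "n = 1" using assms(2) by simp
    then show ?thesis by (simp add: col_tail_def)
  qed
  have "A 1 j = 0" if "j \<in> {1..n}" "j \<noteq> i" for j
  proof -
    have "(\<Sum>c=1..n. A 1 c) = 1" using assms(1) n1 unfolding is_asm_iff by blast
    moreover have "(\<Sum>c=1..n. A 1 c) = A 1 i + (\<Sum>c\<in>{1..n} - {i}. A 1 c)"
      using assms(3) by (simp add: sum.remove)
    ultimately have "(\<Sum>c\<in>{1..n} - {i}. A 1 c) = 0" using assms(4) by simp
    moreover have "0 \<le> A 1 c" if "c \<in> {1..n} - {i}" for c
      using A[of c] tail[of c] that by auto
    ultimately have "\<forall>c\<in>{1..n} - {i}. A 1 c = 0" by (subst (asm) sum_nonneg_eq_0_iff) auto
    then show ?thesis using that by blast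
  qed
  then have "col_tail n A 2 j = 1 \<longleftrightarrow> j \<noteq> i" if "j \<in> {1..n}" for j
    using A[OF that] that assms(4) by (cases "j = i") auto
  note tail_iff = this
  show ?thesis
    unfolding state_def columns_def
  proof (intro filter_cong refl)
    fix v assume "v \<in> set [1..int n]"
    then have "nat v \<in> {1..n}" by auto
    then show "(col_tail n A 2 (nat v) = 1) = (nat v \<noteq> i)" by (rule tail_iff)
  qed
qed

text \<open>The inverse takes differences of consecutive indicator functions. The column conditions
  then follow by telescoping, and the row conditions are interlacing in the form
  \<open>interl_columns_iff\<close>.\<close>

lemma bij_betw_states:
  assumes n: "2 \<le> n" and i: "i \<in> {1..n}"
  shows "bij_betw (states n) {A. is_asm n A \<and> A 1 i = 1} (state_chains (n - 1) (columns n (\<lambda>j. j \<noteq> i)))"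
  unfolding bij_betw_def
proof (intro conjI subset_antisym)
  show "inj_on (states n) {A. is_asm n A \<and> A 1 i = 1}"
  proof (rule inj_onI)
    fix A B
    assume A: "A \<in> {A. is_asm n A \<and> A 1 i = 1}" and B: "B \<in> {A. is_asm n A \<and> A 1 i = 1}"
      and eq: "states n A = states n B"
    have tails: "col_tail n A r c = col_tail n B r c" if "r \<in> {1..n + 1}" "c \<in> {1..n}" for r c
    proof -
      have "r = 1 \<or> r = Suc n \<or> r \<in> {2..n}" using that by auto
      then consider "r = 1" | "r = Suc n" | "r \<in> {2..n}" by blast
      then show ?thesis
      proof cases
        case 1
        then show ?thesis using A B that unfolding is_asm_iff by simp
      next
        case 2
        then show ?thesis by simp
      next
        case 3
        then have "state n A r = state n B r" using eq by (auto simp: states_def)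
        then have "int c \<in> set (state n A r) \<longleftrightarrow> int c \<in> set (state n B r)" by simp
        then have "col_tail n A r c = 1 \<longleftrightarrow> col_tail n B r c = 1"
          unfolding state_def in_columns using that by auto
        moreover have "col_tail n A r c \<in> {0, 1}" "col_tail n B r c \<in> {0, 1}"
          using A B 3 that unfolding is_asm_iff by auto
        ultimately show ?thesis by auto
      qed
    qed
    show "A = B"
    proof (intro ext)
      fix r c
      show "A r c = B r c"
      proof (cases "r \<in> {1..n} \<and> c \<in> {1..n}")
        case True
        then show ?thesis
          using tails[of r c] tails[of "Suc r" c] col_tail_Suc[of r n A c] col_tail_Suc[of r n B c] by auto
      next
        case False
        then show ?thesis using A B unfolding is_asm_iff by auto
      qed
    qed
  qed
next
  show "states n ` {A. is_asm n A \<and> A 1 i = 1} \<subseteq> state_chains (n - 1) (columns n (\<lambda>j. j \<noteq> i))"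
  proof (intro image_subsetI)
    fix A assume A: "A \<in> {A. is_asm n A \<and> A 1 i = 1}"
    have "[2..<n + 1] = map (\<lambda>j. j + 2) [0..<n - 1]"
      using n map_add_upt[of 2 "n - 1"] by (simp add: add.commute)
    then have "states n A = map (\<lambda>j. state n A (j + 2)) [0..<n - 1]"
      unfolding states_def by (simp only: map_map comp_def)
    also have "\<dots> \<in> state_chains (n - 1) (state n A (0 + 2))"
    proof (rule state_chains_map)
      show "state n A (Suc j + 2) \<in> interl (state n A (j + 2))" if "j < n - 1" for j
        using asm_state_interl[of n A "j + 2"] A that by simp
      have "n - 1 + 2 = Suc n" using n by simp
      then show "state n A (n - 1 + 2) = []"
        by (simp only: state_def columns_def col_tail_last) simp
    qed
    finally show "states n A \<in> state_chains (n - 1) (columns n (\<lambda>j. j \<noteq> i))"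
      using asm_top_row[of n A i] A n i by (simp add: numeral_2_eq_2)
  qed
next
  show "state_chains (n - 1) (columns n (\<lambda>j. j \<noteq> i)) \<subseteq> states n ` {A. is_asm n A \<and> A 1 i = 1}"
  proof
    fix c assume c: "c \<in> state_chains (n - 1) (columns n (\<lambda>j. j \<noteq> i))"
    have len: "length c = n - 1" and c0: "c ! 0 = columns n (\<lambda>j. j \<noteq> i)"
      and cs: "\<And>j. Suc j < n - 1 \<Longrightarrow> c ! Suc j \<in> interl (c ! j)" and cl: "[] \<in> interl (c ! (n - 1 - 1))"
      using state_chains_nth[OF c] n by auto
    \<comment> \<open>Row 1 receives all columns, since full tails are 1, and row n + 1 none. The
      chain supplies rows 2 to n, hence the offset 2.\<close>
    define P where "P r j \<longleftrightarrow> (if r = 1 then True else if r \<le> n then int j \<in> set (c ! (r - 2)) else False)" for r j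
    have cols: "c ! (r - 2) = columns n (P r)" if "2 \<le> r" "r \<le> n" for r
    proof -
      have "c ! (r - 2) \<in> set c" using that len by simp
      then have "sorted_wrt (<) (c ! (r - 2)) \<and> (\<forall>v\<in>set (c ! (r - 2)). 1 \<le> v \<and> v \<le> int n)"
        by (intro state_chains_sorted[OF c sorted_columns]) (auto dest: set_columns)
      then have "c ! (r - 2) = columns n (\<lambda>j. int j \<in> set (c ! (r - 2)))"
        by (intro sorted_eq_columns) auto
      moreover have "P r = (\<lambda>j. int j \<in> set (c ! (r - 2)))" using that by (auto simp: P_def)
      ultimately show ?thesis by simp
    qed
    have last: "columns n (P (Suc n)) = []" using n by (simp add: columns_def P_def)
    have interl: "columns n (P (Suc r)) \<in> interl (columns n (P r))" if r: "r \<in> {1..n}" for r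
    proof -
      consider "r = 1" | "r = n" "2 \<le> r" | "2 \<le> r" "r < n" using r by fastforce
      then show ?thesis
      proof cases
        case 1
        have "P 2 = (\<lambda>j. int j \<in> set (columns n (\<lambda>j. j \<noteq> i)))" using n c0 by (auto simp: P_def)
        then have "of_bool (P 1 j) - of_bool (P 2 j) = (of_bool (j = i) :: int)" if "j \<in> {1..n}" for j
          using that by (simp add: P_def in_columns)
        then have "(\<Sum>j=1..m. of_bool (P 1 j) - of_bool (P 2 j) :: int) = of_bool (i \<in> {1..m})" if "m \<le> n" for m
        proof -
          have "(\<Sum>j=1..m. of_bool (P 1 j) - of_bool (P 2 j) :: int) = (\<Sum>j\<in>{1..m}. if j = i then 1 else 0)"
            using that \<open>\<And>j. j \<in> {1..n} \<Longrightarrow> of_bool (P 1 j) - of_bool (P 2 j) = (of_bool (j = i) :: int)\<close>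
            by (intro sum.cong) auto
          then show ?thesis by simp
        qed
        then show ?thesis
          unfolding 1 interl_columns_iff using i by (auto simp: numeral_2_eq_2)
      next
        case 2
        then show ?thesis using cl cols[of n] last by (simp add: numeral_2_eq_2)
      next
        case 3
        then have "Suc r - 2 = Suc (r - 2)" "Suc (r - 2) < n - 1" by auto
        then have "c ! (Suc r - 2) \<in> interl (c ! (r - 2))" by (simp only: cs)
        then show ?thesis using cols[of r] cols[of "Suc r"] 3 by simp
      qed
    qed
    define A where "A r j = (if r \<in> {1..n} \<and> j \<in> {1..n} then of_bool (P r j) - of_bool (P (Suc r) j) else 0 :: int)" for r j
    have tail: "col_tail n A r j = of_bool (P r j)" if "r \<in> {1..n + 1}" "j \<in> {1..n}" for r j
    proof -
      have "col_tail n A r j = (\<Sum>r'=r..n. of_bool (P r' j) - of_bool (P (Suc r') j))"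
        unfolding col_tail_def using that by (intro sum.cong) (auto simp: A_def)
      also have "\<dots> = of_bool (P r j) - of_bool (P (Suc n) j)"
        using sum_Suc_diff[of r n "\<lambda>r. - of_bool (P r j) :: int"] that by simp
      finally show ?thesis using n by (simp add: P_def)
    qed
    have row: "(\<Sum>j=1..m. A r j) = (\<Sum>j=1..m. of_bool (P r j) - of_bool (P (Suc r) j))" if "r \<in> {1..n}" "m \<le> n" for r m
      using that by (intro sum.cong) (auto simp: A_def)
    have asm: "is_asm n A"
      unfolding is_asm_iff
    proof (intro conjI ballI)
      show "\<forall>r c. r \<notin> {1..n} \<or> c \<notin> {1..n} \<longrightarrow> A r c = 0" by (auto simp: A_def)
      fix r assume r: "r \<in> {1..n}"
      note row_sums = interl[OF r, unfolded interl_columns_iff]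
      show "\<forall>m\<le>n. (\<Sum>c=1..m. A r c) \<in> {0, 1}"
      proof (intro allI impI)
        fix m assume m: "m \<le> n"
        show "(\<Sum>c=1..m. A r c) \<in> {0, 1}" unfolding row[OF r m] using row_sums m by blast
      qed
      show "(\<Sum>c=1..n. A r c) = 1" unfolding row[OF r order_refl] using row_sums by blast
    next
      fix j assume j: "j \<in> {1..n}"
      show "col_tail n A 1 j = 1" using tail[of 1 j] j by (simp add: P_def)
      show "col_tail n A r j \<in> {0, 1}" if "r \<in> {1..n}" for r using tail[of r j] j that by auto
    qed
    have top: "A 1 i = 1"
    proof -
      have "\<not> P 2 i" using n c0 in_columns[of i n "\<lambda>j. j \<noteq> i"] by (simp add: P_def)
      then show ?thesis using i n by (simp add: A_def P_def numeral_2_eq_2)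
    qed
    have state: "state n A r = c ! (r - 2)" if "2 \<le> r" "r \<le> n" for r
    proof -
      have "state n A r = columns n (P r)"
        unfolding state_def columns_def
      proof (intro filter_cong refl)
        fix v assume "v \<in> set [1..int n]"
        then have "nat v \<in> {1..n}" by auto
        moreover have "r \<in> {1..n + 1}" using that by auto
        ultimately show "(col_tail n A r (nat v) = 1) = P r (nat v)" by (simp only: tail) simp
      qed
      then show ?thesis using cols[OF that] by simp
    qed
    have "states n A = c"
    proof (rule nth_equalityI)
      show "length (states n A) = length c" using len n by (simp add: states_def del: upt_Suc)
      show "states n A ! j = c ! j" if "j < length (states n A)" for j
        using that n state[of "j + 2"] by (simp add: states_def del: upt_Suc)
    qed
    then show "c \<in> states n ` {A. is_asm n A \<and> A 1 i = 1}" using asm top by blast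
  qed
qed

text \<open>In the first and the last column there are no negative entries, so the position of the
  \<open>1\<close> can be read off from the number of states containing that column.\<close>

lemma asm_nonneg_column:
  assumes asm: "is_asm n A" and c: "c \<in> {1..n}" and nonneg: "\<And>r. r \<in> {1..n} \<Longrightarrow> 0 \<le> A r c" and s: "1 \<le> s"
  shows "A s c = 1 \<longleftrightarrow> Suc (occurrences (int c) (states n A)) = s"
proof -
  have tail01: "col_tail n A r c \<in> {0, 1}" if "r \<in> {1..n}" for r
    using asm c that unfolding is_asm_iff by blast
  have one: "col_tail n A 1 c = 1" using asm c unfolding is_asm_iff by blast
  have main: "s0 \<in> {1..n} \<and> Suc (occurrences (int c) (states n A)) = s0" if "A s0 c = 1" for s0
  proof -
    have s0: "s0 \<in> {1..n}" using asm that unfolding is_asm_iff by (metis zero_neq_one)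
    have low: "col_tail n A r c = 1" if "r \<in> {1..s0}" for r
    proof -
      have "A s0 c \<le> (\<Sum>r'\<in>{r..n}. A r' c)"
        by (rule member_le_sum) (use that s0 nonneg in auto)
      then show ?thesis using tail01[of r] that s0 \<open>A s0 c = 1\<close> by (auto simp: col_tail_def)
    qed
    have high: "col_tail n A r c = 0" if "s0 < r" "r \<in> {1..n}" for r
    proof -
      have "(\<Sum>r'\<in>insert s0 {r..n}. A r' c) \<le> (\<Sum>r'\<in>{s0..n}. A r' c)"
        by (rule sum_mono2) (use that s0 nonneg in auto)
      moreover have "(\<Sum>r'\<in>insert s0 {r..n}. A r' c) = A s0 c + col_tail n A r c"
        using that by (simp add: col_tail_def)
      ultimately have "1 + col_tail n A r c \<le> col_tail n A s0 c"
        using \<open>A s0 c = 1\<close> by (simp add: col_tail_def)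
      then show ?thesis using tail01[OF that(2)] tail01[OF s0] by auto
    qed
    have "occurrences (int c) (states n A) = length (filter (\<lambda>r. int c \<in> set (state n A r)) [2..<n + 1])"
      by (simp add: occurrences_def states_def filter_map comp_def del: upt_Suc)
    also have "\<dots> = card (set (filter (\<lambda>r. int c \<in> set (state n A r)) [2..<n + 1]))"
      by (rule distinct_card[symmetric]) (simp del: upt_Suc)
    also have "set (filter (\<lambda>r. int c \<in> set (state n A r)) [2..<n + 1]) = {2..s0}"
    proof -
      have "int c \<in> set (state n A r) \<longleftrightarrow> r \<le> s0" if "r \<in> {2..n}" for r
        unfolding state_def in_columns using low[of r] high[of r] that c by (cases "r \<le> s0") auto
      then show ?thesis using s0 by (auto simp del: upt_Suc)
    qed
    finally show ?thesis using s0 by simp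
  qed
  have "\<exists>s0. A s0 c = 1"
  proof (rule ccontr)
    assume "\<nexists>s0. A s0 c = 1"
    then have "A r c = 0" if "r \<in> {1..n}" for r
      using asm that nonneg[OF that] unfolding is_asm_def by (metis (no_types, opaque_lifting) insertE singletonD neg_0_le_iff_le not_one_le_zero)
    then show False using one by (simp add: col_tail_def)
  qed
  then show ?thesis using main by metis
qed

lemma asm_first_column_nonneg: "is_asm n A \<Longrightarrow> r \<in> {1..n} \<Longrightarrow> 0 \<le> A r 1"
proof -
  assume "is_asm n A" "r \<in> {1..n}"
  then have "\<forall>m\<le>n. (\<Sum>c=1..m. A r c) \<in> {0, 1}" "1 \<le> n" unfolding is_asm_iff by auto
  then have "(\<Sum>c=1..1. A r c) \<in> {0, 1}" by blast
  then show ?thesis by auto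
qed

lemma asm_last_column_nonneg: "is_asm n A \<Longrightarrow> r \<in> {1..n} \<Longrightarrow> 0 \<le> A r n"
proof -
  assume *: "is_asm n A" "r \<in> {1..n}"
  then obtain m where n: "n = Suc m" by (cases n) auto
  have "(\<Sum>c=1..m. A r c) \<in> {0, 1}" "(\<Sum>c=1..n. A r c) = 1" using * n unfolding is_asm_iff by auto
  then show ?thesis using n by auto
qed

text \<open>Among the states of rows 2 to n, a 1 in row s + 1 of a boundary column is seen by rows 2
  to s + 1, that is, by s of them.\<close>

lemma asm_count_state_chains:
  assumes n: "2 \<le> n" and i: "i \<in> {1..n}"
  shows "asm_count n (Suc s) i (Suc t) =
    card {c \<in> state_chains (n - 1) (columns n (\<lambda>j. j \<noteq> i)). occurrences 1 c = s \<and> occurrences (int n) c = t}"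
proof -
  let ?S = "{A. is_asm n A \<and> A 1 i = 1}"
  let ?C = "state_chains (n - 1) (columns n (\<lambda>j. j \<noteq> i))"
  have pos: "A (Suc s) 1 = 1 \<longleftrightarrow> occurrences 1 (states n A) = s"
    "A (Suc t) n = 1 \<longleftrightarrow> occurrences (int n) (states n A) = t" if "is_asm n A" for A
    using asm_nonneg_column[OF that, of 1 "Suc s"] asm_nonneg_column[OF that, of n "Suc t"]
      asm_first_column_nonneg[OF that] asm_last_column_nonneg[OF that] n by auto
  have bij: "bij_betw (states n) ?S ?C" by (rule bij_betw_states[OF n i])
  have "bij_betw (states n) {A \<in> ?S. occurrences 1 (states n A) = s \<and> occurrences (int n) (states n A) = t}
    {c \<in> ?C. occurrences 1 c = s \<and> occurrences (int n) c = t}"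
    using bij unfolding bij_betw_def by (auto intro: inj_on_subset)
  moreover have "{A. is_asm n A \<and> A (Suc s) 1 = 1 \<and> A 1 i = 1 \<and> A (Suc t) n = 1}
    = {A \<in> ?S. occurrences 1 (states n A) = s \<and> occurrences (int n) (states n A) = t}"
    using pos by blast
  ultimately show ?thesis
    unfolding asm_count_def by (simp add: bij_betw_same_card)
qed

text \<open>A 1 in a top corner is the only 1 of its boundary column. This settles i = 1 and i = n,
  where omitting i leaves no gap inside the block.\<close>

lemma asm_count_zero:
  assumes "n < s \<or> n < t \<or> i \<notin> {1..n} \<or> (i = 1 \<and> 2 \<le> s) \<or> (i = n \<and> 2 \<le> t)"
  shows "asm_count n s i t = 0"
proof -
  have False if A: "is_asm n A" "A s 1 = 1" "A 1 i = 1" "A t n = 1" for A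
  proof -
    have "s \<in> {1..n}" "t \<in> {1..n}" "i \<in> {1..n}" using A unfolding is_asm_iff by (metis zero_neq_one)+
    moreover have "\<not> (i = 1 \<and> 2 \<le> s)"
    proof
      assume *: "i = 1 \<and> 2 \<le> s"
      have "Suc (occurrences 1 (states n A)) = u" if "A u 1 = 1" "1 \<le> u" for u
        using asm_nonneg_column[OF A(1), of 1 u] asm_first_column_nonneg[OF A(1)] that \<open>s \<in> {1..n}\<close> by auto
      from this[of 1] this[of s] show False using * A by auto
    qed
    moreover have "\<not> (i = n \<and> 2 \<le> t)"
    proof
      assume *: "i = n \<and> 2 \<le> t"
      have "Suc (occurrences (int n) (states n A)) = u" if "A u n = 1" "1 \<le> u" for u
        using asm_nonneg_column[OF A(1), of n u] asm_last_column_nonneg[OF A(1)] that \<open>s \<in> {1..n}\<close> by auto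
      from this[of 1] this[of t] show False using * A by auto
    qed
    ultimately show False using assms by auto
  qed
  then have "{A. is_asm n A \<and> A s 1 = 1 \<and> A 1 i = 1 \<and> A t n = 1} = {}" by blast
  then show ?thesis unfolding asm_count_def by (simp only: card.empty)
qed

section \<open>Counting at arguments with a gap, and the conclusion\<close>

lemma columns_gap:
  assumes "2 \<le> i" "i < n"
  shows "columns n (\<lambda>j. j \<noteq> i) = 1 # blk 2 (i - 2) @ blk (int i + 1) (n - 1 - i) @ [int n]"
proof (rule sorted_distinct_set_unique)
  let ?l = "1 # blk 2 (i - 2) @ blk (int i + 1) (n - 1 - i) @ [int n]"
  have "sorted_wrt (<) ?l"
    using assms by (auto simp: sorted_wrt_append sorted_blk set_blk)
  then show "sorted ?l" "distinct ?l" by (simp_all only: strict_sorted_iff)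
  show "sorted (columns n (\<lambda>j. j \<noteq> i))" "distinct (columns n (\<lambda>j. j \<noteq> i))"
    using sorted_columns by (simp_all add: strict_sorted_iff)
  show "set (columns n (\<lambda>j. j \<noteq> i)) = set ?l"
    using assms by (auto simp: set_blk columns_def split: if_splits)
qed

text \<open>Since 2 <= i < n, both 1 and n are present in the first state and can be moved out to 2
  - x and z + n - 1. Grouping the chains by s + 1 and t + 1 occurrences of these columns gives the
  weights beta s x and beta t z and puts the boundary ones into rows s + 2 and t + 2.\<close>

lemma tri_gap_asm_count:
  assumes i: "2 \<le> i" "i < n" and "1 \<le> x" "1 \<le> z"
  shows "tri ((2 - x) # blk 2 (i - 2) @ blk (int i + 1) (n - 1 - i) @ [z + int n - 1])
    = (\<Sum>s<n. \<Sum>t<n. real (asm_count n (s + 2) i (t + 2)) * (beta s x * beta t z))"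
proof -
  let ?K = "columns n (\<lambda>j. j \<noteq> i)" and ?C = "state_chains (n - 1) (columns n (\<lambda>j. j \<noteq> i))"
  have K: "?K = 1 # blk 2 (i - 2) @ blk (int i + 1) (n - 1 - i) @ [int n]" by (rule columns_gap[OF i])
  have n: "2 \<le> n" using i by simp
  have len: "length ?K = n - 1" unfolding K using i by simp
  have "set_left (2 - x) (set_right (int n) (z + int n - 1) ?K)
      = (2 - x) # blk 2 (i - 2) @ blk (int i + 1) (n - 1 - i) @ [z + int n - 1]"
    unfolding K set_right_def set_left_def by (simp add: butlast_append)
  then have "tri ((2 - x) # blk 2 (i - 2) @ blk (int i + 1) (n - 1 - i) @ [z + int n - 1])
      = tri (set_left (2 - x) (set_right (int n) (z + int n - 1) ?K))" by simp
  also have "\<dots> = (\<Sum>c\<in>?C. weight (occurrences 1 c) (2 - (2 - x)) * weight (occurrences (int n) c) (z + int n - 1 - int n + 1))"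
    by (rule tri_chains[OF _ len sorted_columns]) (use n assms set_columns in auto)
  also have "\<dots> = (\<Sum>c\<in>?C. \<Sum>s<n. \<Sum>t<n. of_bool (occurrences 1 c = s + 1 \<and> occurrences (int n) c = t + 1) * (beta s x * beta t z))"
  proof (rule sum.cong[OF refl])
    fix c assume c: "c \<in> ?C"
    then have "length c = n - 1" using state_chains_nth by blast
    then have le: "occurrences v c \<le> n - 1" for v
      unfolding occurrences_def by (metis length_filter_le)
    have "c \<noteq> []" "hd c = ?K" using c n by (cases "n - 1"; auto)+
    then have "?K \<in> set c" by (metis hd_in_set)
    then have "0 < occurrences v c" if "v \<in> set ?K" for v
      using that by (auto simp: occurrences_def length_greater_0_conv filter_empty_conv)
    then have "0 < occurrences 1 c" "0 < occurrences (int n) c" by (auto simp: K)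
    then obtain s0 t0 where st: "occurrences 1 c = Suc s0" "occurrences (int n) c = Suc t0"
      by (metis gr0_implies_Suc)
    then have lt: "s0 < n" "t0 < n" using le[of 1] le[of "int n"] by auto
    have "(\<Sum>s<n. \<Sum>t<n. of_bool (occurrences 1 c = s + 1 \<and> occurrences (int n) c = t + 1) * (beta s x * beta t z))
      = (\<Sum>s<n. if s0 = s then (\<Sum>t<n. if t0 = t then beta s x * beta t z else 0) else 0)"
      by (intro sum.cong refl) (auto simp: st intro!: sum.cong)
    also have "\<dots> = beta s0 x * beta t0 z" using lt by simp
    finally show "weight (occurrences 1 c) (2 - (2 - x)) * weight (occurrences (int n) c) (z + int n - 1 - int n + 1)
      = (\<Sum>s<n. \<Sum>t<n. of_bool (occurrences 1 c = s + 1 \<and> occurrences (int n) c = t + 1) * (beta s x * beta t z))"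
      by (simp add: st)
  qed
  also have "\<dots> = (\<Sum>s<n. \<Sum>t<n. (\<Sum>c\<in>?C. of_bool (occurrences 1 c = s + 1 \<and> occurrences (int n) c = t + 1)) * (beta s x * beta t z))"
  proof -
    have "(\<Sum>c\<in>?C. \<Sum>s<n. \<Sum>t<n. F c s t) = (\<Sum>s<n. \<Sum>t<n. \<Sum>c\<in>?C. F c s t)"
      for F :: "int list list \<Rightarrow> nat \<Rightarrow> nat \<Rightarrow> real"
      by (subst sum.swap) (intro sum.cong refl sum.swap)
    then show ?thesis by (simp only: sum_distrib_right)
  qed
  also have "\<dots> = (\<Sum>s<n. \<Sum>t<n. real (asm_count n (s + 2) i (t + 2)) * (beta s x * beta t z))"
  proof (intro sum.cong refl)
    fix s t
    have "(\<Sum>c\<in>?C. of_bool (occurrences 1 c = s + 1 \<and> occurrences (int n) c = t + 1))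
      = real (card {c \<in> ?C. occurrences 1 c = s + 1 \<and> occurrences (int n) c = t + 1})"
      by (simp add: finite_state_chains Int_def conj_commute of_bool_def sum.If_cases)
    then show "(\<Sum>c\<in>?C. of_bool (occurrences 1 c = s + 1 \<and> occurrences (int n) c = t + 1)) * (beta s x * beta t z)
      = real (asm_count n (s + 2) i (t + 2)) * (beta s x * beta t z)"
      using asm_count_state_chains[OF n, of i "s + 1" "t + 1"] i by simp
  qed
  finally show ?thesis .
qed

text \<open>For n = 2 the update at position n - 1 = 1 overwrites k_1, so the polynomial is constant
  in x and its coefficients with s = 2 vanish.\<close>

lemma Abb_2:
  assumes "i < 2" "t < 2"
  shows "Abb 2 2 (Suc i) (Suc t) = 0"
proof -
  define c where "c s i t = Abb 2 (Suc s) (Suc i) (Suc t)" for s i t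
  have exp: "alpha_beta 2 x y z = beta_sum 2 c x y z" for x y z
    unfolding c_def by (rule Abb_properties) simp
  have "c 2 i t = 0" for i t
    using Abb_properties(2)[of 2 "Suc 2" "Suc i" "Suc t"] unfolding c_def by fastforce
  then have "beta_sum 2 (\<lambda>s i t. c (Suc s) i t) x y z = beta_sum 2 c x y z - beta_sum 2 c (x - 1) y z" for x y z
    by (simp add: beta_sum_shift_x beta_sum_diff)
  also have "\<dots> x y z = 0" for x y z
    unfolding exp[symmetric] alpha_beta_def special_args_def by simp
  finally have "c (Suc 0) i t = 0"
    by (intro beta_sum_independent[where n = 2 and lb = 0 and c = "\<lambda>s i t. c (Suc s) i t" and s = 0]) (use assms in auto)
  then show ?thesis by (simp add: c_def numeral_2_eq_2)
qed

lemma asm_count_2: "asm_count 2 2 i 2 = 0"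
proof -
  have "\<not> (is_asm 2 A \<and> A 2 1 = 1 \<and> A 1 i = 1 \<and> A 2 2 = 1)" for A
  proof
    assume *: "is_asm 2 A \<and> A 2 1 = 1 \<and> A 1 i = 1 \<and> A 2 2 = 1"
    then have "(\<Sum>c=1..2. A 2 c) = 1" unfolding is_asm_def by auto
    then show False using * by (simp add: numeral_2_eq_2)
  qed
  then have "{A. is_asm 2 A \<and> A 2 1 = 1 \<and> A 1 i = 1 \<and> A 2 2 = 1} = {}" by blast
  then show ?thesis unfolding asm_count_def by (simp only: card.empty)
qed

theorem theorem1:
  fixes n s i t :: nat
  assumes "2 \<le> n" and "s \<in> {2..n}" and "t \<in> {2..n}" and "i \<in> {1..n}"
  shows "Abb n s i t =
           real (asm_count n (s+1) i t) + real (asm_count n (s+1) i (t+1))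
         + real (asm_count n s (i+1) t) - real (asm_count n (s+1) (i+1) t)
         - real (asm_count n s i (t+1)) - real (asm_count n (s+1) (i-1) (t+1))"
proof (cases "n = 2")
  case True
  then have st: "s = 2" "t = 2" using assms by auto
  have "Abb 2 2 (Suc (i - 1)) (Suc 1) = 0" by (rule Abb_2) (use assms True in auto)
  then have "Abb 2 2 i 2 = 0" using assms by (simp add: numeral_2_eq_2)
  then show ?thesis
    unfolding True st by (simp add: asm_count_zero asm_count_2)
next
  case False
  \<comment> \<open>The offset 2 in s and t reflects that index 0 of \<open>beta\<close> belongs to
    a 1 in row 2 of the boundary column; \<open>i\<close> is itself the omitted entry and is not
    shifted.\<close>
  define R where "R s i t = real (asm_count n (s + 2) i (t + 2))" for s i t
  have "R s i t = 0" if "n \<le> s \<or> n \<le> t \<or> i < 2 \<or> n \<le> i" for s i t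
  proof -
    have "n < s + 2 \<or> n < t + 2 \<or> i \<notin> {1..n} \<or> (i = 1 \<and> 2 \<le> s + 2) \<or> (i = n \<and> 2 \<le> t + 2)"
      using that by (auto simp: less_2_cases_iff)
    then show ?thesis unfolding R_def by (simp only: asm_count_zero of_nat_0)
  qed
  then have "Abb n (s - 2 + 2) (i - 1 + 1) (t - 2 + 2)
    = R (s - 2 + 1) (i - 1 + 1) (t - 2) + R (s - 2 + 1) (i - 1 + 1) (t - 2 + 1)
     + R (s - 2) (i - 1 + 2) (t - 2) - R (s - 2 + 1) (i - 1 + 2) (t - 2)
     - R (s - 2) (i - 1 + 1) (t - 2 + 1) - R (s - 2 + 1) (i - 1) (t - 2 + 1)"
    by (intro Abb_of_gap_expansion) (use assms False in \<open>auto simp: R_def intro!: tri_gap_asm_count[simplified]\<close>)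
  moreover have "s - 2 + 2 = s" "i - 1 + 1 = i" "t - 2 + 2 = t" "s - 2 + 1 + 2 = s + 1" "t - 2 + 1 + 2 = t + 1" "i - 1 + 2 = i + 1"
    using assms by auto
  ultimately show ?thesis unfolding R_def by simp
qed

end
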